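(* Let $\bar\varepsilon>0$ be such that $$\varepsilon := \frac{\bar\varepsilon}{40\sum_{t=1}^{T-1} M_t^2/\mu_t} < \frac12 ,$$ and suppose that BSDDP is run with averaging parameter $\tau_0=\tau:=\dfrac{1}{1+\varepsilon^{2^{T-1}-1}}$. Let $K$ denote the first iteration index of BSDDP satisfying $e_0^K\le\bar\varepsilon$. Let $$P=\left\lceil\left(1+\left[\frac{40}{\bar\varepsilon}\sum_{t=1}^{T-1}\frac{M_t^2}{\mu_t}\right]^{2^{T-1}-1}\right)\log\left(\frac{4}{\bar\varepsilon}\sum_{t=1}^{T-1}M_tD_t\right)\right\rceil,\qquad p=\prod_{t=2}^{T}\min_{\tilde\xi_t\in\Xi_t}\mathbb{P}(\xi_t=\tilde\xi_t),$$ $$R=P\cdot\prod_{t=2}^{T}N_t+1 .$$ Then $$\mathbb{E}[K]\le\sum_{i=1}^{R}\frac{1}{p^i}.$$ In addition, for any $n\ge1$, $$\mathbb{P}(K>n)\le(1-p^R)^{\lfloor n/R\rfloor}.$$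
   Context: **Problem.** $T\ge2$ is the number of stages; $\|\cdot\|$ is the Euclidean norm; $X_t\subset\mathbb{R}^{n_t}$ ($t=1,\dots,T$) are nonempty compact convex sets, with diameters $D_t=\sup_{x,x'\in X_t}\|x-x'\|$. For $M,\mu>0$, $\mathcal{F}(M,\mu)$ is the class of functions $G:\mathbb{R}^m\times\mathbb{R}^n\to\mathbb{R}$ such that: (i) $G$ is (jointly) convex; (ii) for every $y$, $G(y,\cdot)$ is $M$-Lipschitz; (iii) for every $x$, $G(\cdot,x)$ is $\mu$-strongly convex; (iv) an oracle $G'_x(y,x)\in\partial_xG(y,x)$ with $\|G'_x(y,x)\|\le M$ is available. $F_1:X_1\to\mathbb{R}$ is $\mu_1$-strongly convex and $M_1$-Lipschitz on $X_1$ ($\mu_1,M_1>0$). For $t=2,\dots,T$: $\xi_t$ is a random variable with finite support $\Xi_t$ of size $N_t$ (each point having positive probability), $\xi_2,\dots,\xi_T$ are independent, and for some $M_{t-1},\mu_t>0$ we have $F_t(\cdot,\cdot\,;\omega)\in\mathcal{F}(M_{t-1},\mu_t)$ for every $\omega\in\Xi_t$ (first argument in $\mathbb{R}^{n_t}$, second in $\mathbb{R}^{n_{t-1}}$). **True cost-to-go functions.** $\mathcal{Q}_T\equiv0$, and for $t=T,\dots,2$, $x\in\mathbb{R}^{n_{t-1}}$: $\mathfrak{Q}_{t-1}(x;\omega)=\min_{u\in X_t}F_t(u,x;\omega)+\mathcal{Q}_t(u)$ and $\mathcal{Q}_{t-1}(x)=\mathbb{E}_{\xi_t}[\mathfrak{Q}_{t-1}(x;\xi_t)]$.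 **Algorithm BSDDP.** Input: $\tau_0\in(0,1)$ and convex $M_t$-Lipschitz functions $\Gamma_t^1\le\mathcal{Q}_t$ ($t=1,\dots,T-1$); $\Gamma_T^k\equiv0$ for all $k$. Scenarios $\zeta^k=(\xi_2^k,\dots,\xi_T^k)$, $k\ge1$, are i.i.d. samples of $(\xi_2,\dots,\xi_T)$. For $k\ge1$, $\ell(k)$ is the largest $j<k$ with $\zeta^j=\zeta^k$ if such $j$ exists, and $\ell(k)=k$ otherwise. Given $\Gamma_1^k,\dots,\Gamma_T^k$, define for $t=1,\dots,T-1$ $$V_t^k(x;\omega)=\min_{u\in X_{t+1}}F_{t+1}(u,x;\omega)+\Gamma_{t+1}^k(u),\qquad \mathcal{V}_t^k(x)=\mathbb{E}_{\xi_{t+1}}[V_t^k(x;\xi_{t+1})],$$ $\mathcal{V}_T^k\equiv0$, and $\mathcal{V}_0^k=\min_{u\in X_1}F_1(u)+\Gamma_1^k(u)$. *Forward pass:* $x_1^k$ is the minimizer of $F_1+\Gamma_1^k$ over $X_1$; for $t=2,\dots,T$, $x_t^k$ is the minimizer of $F_t(\cdot,x_{t-1}^k;\xi_t^k)+\Gamma_t^k$ over $X_t$. *Cuts* ($k\ge2$): if $\ell(k)=k$, then $\Gamma_t^k=\Gamma_t^{k-1}$ for all $t$. If $\ell(k)<k$, then for $t=T$ down to $2$: for each $\omega\in\Xi_t$ a (deterministic) oracle computes $s_{t-1}^{k-1}(\omega)\in\partial V_{t-1}^k(\cdot\,;\omega)(x_{t-1}^{\ell(k)})$, and $\Gamma_{t-1}^k=\max\{\Gamma_{t-1}^{k-1},\ell_{\mathcal{V}_{t-1}^k}(\cdot\,;x_{t-1}^{\ell(k)})\}$,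 where $\ell_{\mathcal{V}_{t-1}^k}(\cdot\,;y)=\mathbb{E}_{\xi_t}[V_{t-1}^k(y;\xi_t)+\langle s_{t-1}^{k-1}(\xi_t),\cdot-y\rangle]$ with $y=x_{t-1}^{\ell(k)}$. *First-stage solution:* $y_1^k=x_1^k$ if $\ell(k)=k$, and $y_1^k=(1-\tau_0)x_1^k+\tau_0y_1^{\ell(k)}$ if $\ell(k)<k$. **Error.** $e_0^k=(F_1+\mathcal{Q}_1)(y_1^k)-\mathcal{V}_0^k$.
   Formalization: The formal theorem adds the assumption (4/ε̄)·ΣM_tD_t > 1, i.e. P ≥ 1; otherwise R ≤ 1 and the claim is undefined or false, e.g. for P = 0 with Γ_1^1 a very negative constant, where P(K>1) = 1 > 1 − p. *)

theory Defs
  imports "HOL-Probability.Probability"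
begin

text \<open>The usual normalisation, with the factor \<open>\<mu>/2\<close>: equivalently \<open>f - (\<mu>/2) \<parallel>\<cdot>\<parallel>\<^sup>2\<close> is convex.\<close>

definition strongly_convex_on :: "real \<Rightarrow> 'a::euclidean_space set \<Rightarrow> ('a \<Rightarrow> real) \<Rightarrow> bool"
  where "strongly_convex_on \<mu> S f \<longleftrightarrow> convex S \<and>
    (\<forall>x\<in>S. \<forall>y\<in>S. \<forall>c\<in>{0..1}.
      f ((1 - c) *\<^sub>R x + c *\<^sub>R y)
        \<le> (1 - c) * f x + c * f y - \<mu> / 2 * c * (1 - c) * (norm (x - y))\<^sup>2)"

definition subdifferential :: "'a::euclidean_space set \<Rightarrow> ('a \<Rightarrow> real) \<Rightarrow> 'a \<Rightarrow> 'a set"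
  where "subdifferential V f x = {s \<in> V. \<forall>y\<in>V. f x + s \<bullet> (y - x) \<le> f y}"

text \<open>The class \<open>\<F>(M,\<mu>)\<close>. The spaces \<open>\<real>\<^sup>m\<close> and \<open>\<real>\<^sup>n\<close> of the first and the second argument are
  represented by linear subspaces \<open>U\<close> and \<open>V\<close> of an ambient Euclidean space, so that spaces of
  different dimensions can occur in one family indexed by stages.\<close>

definition cost_class ::
  "'a::euclidean_space set \<Rightarrow> 'a set \<Rightarrow> real \<Rightarrow> real \<Rightarrow> ('a \<Rightarrow> 'a \<Rightarrow> real) \<Rightarrow> bool"
  where "cost_class U V M \<mu> G \<longleftrightarrow>
    convex_on (U \<times> V) (\<lambda>(y, x). G y x) \<and>
    (\<forall>y\<in>U. M-lipschitz_on V (G y)) \<and>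
    (\<forall>x\<in>V. strongly_convex_on \<mu> U (\<lambda>y. G y x)) \<and>
    (\<exists>G'. \<forall>y\<in>U. \<forall>x\<in>V. G' y x \<in> subdifferential V (G y) x \<and> norm (G' y x) \<le> M)"

text \<open>Recursion from stage \<open>T\<close> down to stage \<open>t\<close>. The recursions are introduced outside the locales
  because \<^verbatim>\<open>function\<close> does not support locale parameters with hidden type variables.\<close>

function backward_rec :: "nat \<Rightarrow> 'b \<Rightarrow> (nat \<Rightarrow> 'b \<Rightarrow> 'b) \<Rightarrow> nat \<Rightarrow> 'b"
  where "backward_rec T b step t =
    (if t < T then step t (backward_rec T b step (Suc t)) else b)"
  by pat_completeness auto
termination by (relation "Wellfounded.measure (\<lambda>(T, b, step, t). T - t)") auto
declare backward_rec.simps [simp del]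

text \<open>\<open>\<l>(k)\<close> for the sequence \<open>z\<close> of scenarios.\<close>

definition last_visit :: "(nat \<Rightarrow> nat \<Rightarrow> 'o) \<Rightarrow> nat \<Rightarrow> nat"
  where "last_visit z k =
    (if \<exists>j\<in>{1..<k}. z j = z k then Max {j \<in> {1..<k}. z j = z k} else k)"

text \<open>Iterates that start with \<open>b\<close>, remain unchanged when \<open>\<l>(k) = k\<close>, and are otherwise computed by
  \<open>step k\<close> from the iterates \<open>k - 1\<close> and \<open>\<l>(k)\<close>.\<close>

function revisit_rec ::
    "'b \<Rightarrow> (nat \<Rightarrow> 'b \<Rightarrow> 'b \<Rightarrow> 'b) \<Rightarrow> (nat \<Rightarrow> nat \<Rightarrow> 'o) \<Rightarrow> nat \<Rightarrow> 'b"
  where "revisit_rec b step z k =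
    (if k \<le> 1 then b
     else if last_visit z k < k
     then step k (revisit_rec b step z (k - 1)) (revisit_rec b step z (last_visit z k))
     else revisit_rec b step z (k - 1))"
  by pat_completeness auto
termination by (relation "Wellfounded.measure (\<lambda>(b, step, z, k). k)") auto
declare revisit_rec.simps [simp del]

text \<open>The averages \<open>y\<^sup>k\<close> of the points \<open>x k\<close> with averaging parameter \<open>\<tau>\<close>.\<close>

function revisit_average ::
    "real \<Rightarrow> (nat \<Rightarrow> 'a::real_vector) \<Rightarrow> (nat \<Rightarrow> nat \<Rightarrow> 'o) \<Rightarrow> nat \<Rightarrow> 'a"
  where "revisit_average \<tau> x z k =
    (if last_visit z k < k
     then (1 - \<tau>) *\<^sub>R x k + \<tau> *\<^sub>R revisit_average \<tau> x z (last_visit z k)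
     else x k)"
  by pat_completeness auto
termination by (relation "Wellfounded.measure (\<lambda>(\<tau>, x, z, k). k)") auto
declare revisit_average.simps [simp del]

text \<open>\<open>E t\<close> plays the role of \<open>\<real>\<^bsup>n\<^sub>t\<^esup>\<close> (a subspace of dimension \<open>n\<^sub>t\<close> of the ambient space \<open>'a\<close>,
  with the induced Euclidean norm). \<open>\<Omega>\<close> is the underlying probability space, and \<open>\<Xi> t\<close> is the
  support of \<open>\<xi> t\<close>; measurability into \<^term>\<open>count_space (\<Xi> t)\<close>, which is part of
  \<open>indep_vars\<close>, makes \<open>\<xi> t\<close> take its values in \<open>\<Xi> t\<close>.\<close>

locale multistage_problem = prob_space \<Omega>
  for \<Omega> :: "'w measure" +
  fixes T :: nat
    and E X :: "nat \<Rightarrow> 'a::euclidean_space set"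
    and F1 :: "'a \<Rightarrow> real"
    and F :: "nat \<Rightarrow> 'a \<Rightarrow> 'a \<Rightarrow> 'o \<Rightarrow> real"
    and M \<mu> :: "nat \<Rightarrow> real"
    and \<Xi> :: "nat \<Rightarrow> 'o set"
    and \<xi> :: "nat \<Rightarrow> 'w \<Rightarrow> 'o"
  assumes T_ge_2: "2 \<le> T"
    and subspace_E: "t \<in> {1..T} \<Longrightarrow> subspace (E t)"
    and X_subset: "t \<in> {1..T} \<Longrightarrow> X t \<subseteq> E t"
    and X_nonempty: "t \<in> {1..T} \<Longrightarrow> X t \<noteq> {}"
    and X_compact: "t \<in> {1..T} \<Longrightarrow> compact (X t)"
    and X_convex: "t \<in> {1..T} \<Longrightarrow> convex (X t)"
    and M_pos: "t \<in> {1..T-1} \<Longrightarrow> 0 < M t"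
    and mu_pos: "t \<in> {1..T} \<Longrightarrow> 0 < \<mu> t"
    and F1_strongly_convex: "strongly_convex_on (\<mu> 1) (X 1) F1"
    and F1_lipschitz: "(M 1)-lipschitz_on (X 1) F1"
    and F_class: "t \<in> {2..T} \<Longrightarrow> \<omega> \<in> \<Xi> t \<Longrightarrow>
          cost_class (E t) (E (t - 1)) (M (t - 1)) (\<mu> t) (\<lambda>y x. F t y x \<omega>)"
    and support_finite: "t \<in> {2..T} \<Longrightarrow> finite (\<Xi> t)"
    and support_pos: "t \<in> {2..T} \<Longrightarrow> \<omega> \<in> \<Xi> t \<Longrightarrow> 0 < prob {w \<in> space \<Omega>. \<xi> t w = \<omega>}"
    and xi_indep: "indep_vars (\<lambda>t. count_space (\<Xi> t)) \<xi> {2..T}"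
begin

text \<open>For \<open>\<phi> = \<Q>\<^bsub>t+1\<^esub>\<close> this is \<open>\<QQ>\<^sub>t(x;\<omega>)\<close>, and for \<open>\<phi> = \<Gamma>\<^bsub>t+1\<^esub>\<^sup>k\<close> it is \<open>V\<^sub>t\<^sup>k(x;\<omega>)\<close>. The infimum is a
  minimum: the objective is continuous on the nonempty compact set \<open>X (Suc t)\<close> in both uses.\<close>

definition stage_value :: "nat \<Rightarrow> ('a \<Rightarrow> real) \<Rightarrow> 'a \<Rightarrow> 'o \<Rightarrow> real"
  where "stage_value t \<phi> x \<omega> = (INF u\<in>X (Suc t). F (Suc t) u x \<omega> + \<phi> u)"

definition Q :: "nat \<Rightarrow> 'a \<Rightarrow> real"
  where "Q = backward_rec T (\<lambda>x. 0)
    (\<lambda>t \<phi> x. expectation (\<lambda>w. stage_value t \<phi> x (\<xi> (Suc t) w)))"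

text \<open>The decisions \<open>x\<^sub>1, x\<^sub>2, \<dots>\<close> of a forward pass with models \<open>\<Gamma> t\<close> along the scenario \<open>s\<close>. The
  minimizers are unique by strong convexity. Stage \<open>0\<close> does not exist.\<close>

fun forward :: "(nat \<Rightarrow> 'a \<Rightarrow> real) \<Rightarrow> (nat \<Rightarrow> 'o) \<Rightarrow> nat \<Rightarrow> 'a"
  where
    "forward \<Gamma> s 0 = undefined"
  | "forward \<Gamma> s (Suc 0) = arg_min_on (\<lambda>u. F1 u + \<Gamma> 1 u) (X 1)"
  | "forward \<Gamma> s (Suc (Suc t)) = arg_min_on
       (\<lambda>u. F (Suc (Suc t)) u (forward \<Gamma> s (Suc t)) (s (Suc (Suc t))) + \<Gamma> (Suc (Suc t)) u)
       (X (Suc (Suc t)))"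

end

text \<open>\<open>\<zeta> k w\<close> is the scenario of iteration \<open>k\<close>, with components indexed by \<open>{2..T}\<close>. The
  subgradient oracle is a fixed, nonrandom function of the iteration index \<open>k\<close>, the stage \<open>t\<close>, the
  realisation \<open>\<omega>\<close>, the current model \<open>\<phi>\<close> of \<open>\<Q>\<^bsub>t+1\<^esub>\<close> and the query point \<open>y\<close>; at query points its
  answer is a subgradient of \<open>V\<^sub>t(\<cdot>;\<omega>)\<close> at \<open>y\<close>.\<close>

locale bsddp = multistage_problem \<Omega> T E X F1 F M \<mu> \<Xi> \<xi>
  for \<Omega> :: "'w measure"
    and T :: nat
    and E X :: "nat \<Rightarrow> 'a::euclidean_space set"
    and F1 :: "'a \<Rightarrow> real"
    and F :: "nat \<Rightarrow> 'a \<Rightarrow> 'a \<Rightarrow> 'o \<Rightarrow> real"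
    and M \<mu> :: "nat \<Rightarrow> real"
    and \<Xi> :: "nat \<Rightarrow> 'o set"
    and \<xi> :: "nat \<Rightarrow> 'w \<Rightarrow> 'o" +
  fixes \<tau>\<^sub>0 :: real
    and \<Gamma>\<^sub>1 :: "nat \<Rightarrow> 'a \<Rightarrow> real"
    and oracl :: "nat \<Rightarrow> nat \<Rightarrow> 'o \<Rightarrow> ('a \<Rightarrow> real) \<Rightarrow> 'a \<Rightarrow> 'a"
    and \<zeta> :: "nat \<Rightarrow> 'w \<Rightarrow> nat \<Rightarrow> 'o"
  assumes tau_range: "0 < \<tau>\<^sub>0" "\<tau>\<^sub>0 < 1"
    and init_convex: "t \<in> {1..T-1} \<Longrightarrow> convex_on (E t) (\<Gamma>\<^sub>1 t)"
    and init_lipschitz: "t \<in> {1..T-1} \<Longrightarrow> (M t)-lipschitz_on (E t) (\<Gamma>\<^sub>1 t)"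
    and init_le: "t \<in> {1..T-1} \<Longrightarrow> x \<in> E t \<Longrightarrow> \<Gamma>\<^sub>1 t x \<le> Q t x"
    and oracle_subgradient: "t \<in> {1..T-1} \<Longrightarrow> \<omega> \<in> \<Xi> (Suc t) \<Longrightarrow>
          convex_on (E (Suc t)) \<phi> \<Longrightarrow> y \<in> X t \<Longrightarrow>
          oracl k t \<omega> \<phi> y \<in> subdifferential (E t) (\<lambda>x. stage_value t \<phi> x \<omega>) y"
    and samples_indep:
          "indep_vars (\<lambda>k. \<Pi>\<^sub>M t\<in>{2..T}. count_space (\<Xi> t)) \<zeta> {1..}"
    and samples_distr: "1 \<le> k \<Longrightarrow>
          distr \<Omega> (\<Pi>\<^sub>M t\<in>{2..T}. count_space (\<Xi> t)) (\<zeta> k) =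
          distr \<Omega> (\<Pi>\<^sub>M t\<in>{2..T}. count_space (\<Xi> t)) (\<lambda>w. \<lambda>t\<in>{2..T}. \<xi> t w)"
begin

text \<open>The linearization of \<open>\<V>\<^sub>t\<^sup>k\<close> at \<open>y\<close> when \<open>\<phi> = \<Gamma>\<^bsub>t+1\<^esub>\<^sup>k\<close>.\<close>

definition cut :: "nat \<Rightarrow> nat \<Rightarrow> ('a \<Rightarrow> real) \<Rightarrow> 'a \<Rightarrow> 'a \<Rightarrow> real"
  where "cut k t \<phi> y x = expectation (\<lambda>w.
    stage_value t \<phi> y (\<xi> (Suc t) w) + oracl k t (\<xi> (Suc t) w) \<phi> y \<bullet> (x - y))"

text \<open>The models \<open>\<Gamma>\<^sub>t\<^sup>k\<close> obtained from \<open>\<Gamma>\<^sub>t\<^bsup>k-1\<^esup>\<close> by one backward sweep with query points \<open>y t\<close>.\<close>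

definition backward :: "nat \<Rightarrow> (nat \<Rightarrow> 'a \<Rightarrow> real) \<Rightarrow> (nat \<Rightarrow> 'a) \<Rightarrow> nat \<Rightarrow> 'a \<Rightarrow> real"
  where "backward k \<Gamma> y = backward_rec T (\<lambda>x. 0)
    (\<lambda>t \<phi> x. max (\<Gamma> t x) (cut k t \<phi> (y t) x))"

text \<open>\<open>model z k t\<close> is \<open>\<Gamma>\<^sub>t\<^sup>k\<close> when the sampled scenarios are \<open>z 1, z 2, \<dots>\<close>.\<close>

definition model :: "(nat \<Rightarrow> nat \<Rightarrow> 'o) \<Rightarrow> nat \<Rightarrow> nat \<Rightarrow> 'a \<Rightarrow> real"
  where "model z = revisit_rec (\<lambda>t. if t < T then \<Gamma>\<^sub>1 t else (\<lambda>x. 0))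
    (\<lambda>k \<Gamma> \<Gamma>'. backward k \<Gamma> (forward \<Gamma>' (z (last_visit z k)))) z"

definition decision :: "(nat \<Rightarrow> nat \<Rightarrow> 'o) \<Rightarrow> nat \<Rightarrow> nat \<Rightarrow> 'a"
  where "decision z k = forward (model z k) (z k)"

definition first_stage_solution :: "(nat \<Rightarrow> nat \<Rightarrow> 'o) \<Rightarrow> nat \<Rightarrow> 'a"
  where "first_stage_solution z = revisit_average \<tau>\<^sub>0 (\<lambda>k. decision z k 1) z"

definition lower_value :: "(nat \<Rightarrow> nat \<Rightarrow> 'o) \<Rightarrow> nat \<Rightarrow> real"
  where "lower_value z k = (INF u\<in>X 1. F1 u + model z k 1 u)"

definition gap :: "(nat \<Rightarrow> nat \<Rightarrow> 'o) \<Rightarrow> nat \<Rightarrow> real"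
  where "gap z k = F1 (first_stage_solution z k) + Q 1 (first_stage_solution z k) - lower_value z k"

text \<open>The random index \<open>K\<close>; it is \<open>\<infinity>\<close> if the tolerance is never reached.\<close>

definition first_hit :: "real \<Rightarrow> 'w \<Rightarrow> enat"
  where "first_hit \<epsilon> w = Inf {enat k | k. 1 \<le> k \<and> gap (\<lambda>j. \<zeta> j w) k \<le> \<epsilon>}"

end

end

theory Submission
  imports Defs
begin

text \<open>
  The proof has a deterministic half, which shows that a long run of suitable scenarios forces the
  gap below the tolerance, and a probabilistic half, which bounds the waiting time for such a run.

  For the first half, let \<open>k\<close> be an iteration that revisits a scenario, \<open>l = \<l>(k)\<close> the previous visit,
  and consider the problem of stage \<open>t\<close> along this scenario. Its model value rises from \<open>l\<close> to \<open>k\<close> by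
  at least \<open>\<mu>\<^sub>t/2\<close> times the squared displacement of its solution, up to a Lipschitz term in the
  displacement of the decision of stage \<open>t - 1\<close> (\<open>path_value_growth\<close>). Hence either the solution
  hardly moves, and then the cut at the old point makes the model accurate at the new one, or the
  error drops. So the error \<open>e\<^sub>t\<close> of this problem satisfies, for every \<open>\<delta>\<^sub>t > 0\<close>, an inequality of
  the form \<open>e\<^sub>t\<^sup>k \<le> e\<^bsub>t+1\<^esub> + (e\<^sub>t\<^sup>l - e\<^sub>t\<^sup>k)/\<delta>\<^sub>t + O(M\<^sub>t r\<^sub>t) + O(M\<^bsub>t-1\<^esub> r\<^bsub>t-1\<^esub>/\<delta>\<^sub>t) - \<mu>\<^sub>t r\<^sub>t\<^sup>2/(2\<delta>\<^sub>t)\<close>,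
  where \<open>r\<^sub>t\<close> are the displacements. For the first stage the average with \<open>\<tau> = 1/(1 + \<delta>\<^sub>1)\<close> gives the same
  inequality for the gap. In a weighted sum over the stages the squares absorb the linear terms at the
  price \<open>\<delta>\<^sub>t M\<^sub>t\<^sup>2/(\<delta>\<^bsub>t+1\<^esub>\<^sup>2 \<mu>\<^sub>t)\<close>, which is of order \<open>\<epsilon> M\<^sub>t\<^sup>2/\<mu>\<^sub>t\<close> if \<open>\<delta>\<^sub>t\<close> is of order \<open>\<epsilon> \<delta>\<^bsub>t+1\<^esub>\<^sup>2\<close>. From
  \<open>\<delta>\<^bsub>T-1\<^esub>\<close> of order \<open>\<epsilon>\<close> this leads to the exponent \<open>2\<^bsup>T-1\<^esup> - 1\<close> for \<open>\<delta>\<^sub>1\<close>. The result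
  (\<open>weighted_contraction\<close>) is that the gap plus a weighted sum of the errors contracts by the factor
  \<open>1/(1 + \<delta>\<^sub>1)\<close> at each revisit, up to an additive constant that is a fraction of the tolerance.

  The term \<open>e\<^bsub>t+1\<^esub>\<close> enters because the cut averages over all realisations of the next stage,
  while the path follows only one. This one has to have at least the average error, so the path must
  be a worst one. The model of iteration \<open>k\<close> depends on the scenario of iteration \<open>k\<close>, since this decides
  where the cuts are placed, and nothing ensures that some scenario is worst for the model which it
  generates itself. Therefore \<open>worst_scenario\<close> refers to the model of iteration \<open>k - 1\<close> and to the
  tentative decisions which that model yields. It lies between the models of \<open>l\<close> and of \<open>k\<close>, so each
  displacement \<open>r\<^sub>t\<close> is split into two moves, both paid for by the rise of the values. The constant \<open>40\<close>
  leaves enough room for this (\<open>weights_exist\<close>).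

  Among \<open>R\<close> consecutive iterations some scenario occurs at least \<open>P + 1\<close> times. From its second
  occurrence on, the gap and the errors are at most \<open>2 \<Sum>\<^sub>t M\<^sub>t D\<^sub>t\<close>, so that \<open>P - 1\<close> contractions bring the gap
  below the tolerance (\<open>gap_small_in_run\<close>).

  For the second half, a worst scenario exists after every history, and it is sampled with
  probability at least \<open>p\<close>. The waiting time is thus dominated by that for \<open>R\<close> consecutive successes
  of probability \<open>p\<close>: after any history the next \<open>R\<close> scenarios are all worst with probability
  at least \<open>p\<^sup>R\<close>, and the expected waiting time is \<open>\<Sum>\<^bsub>i=1\<^esub>\<^bsup>R\<^esup> p\<^bsup>-i\<^esup>\<close>.
\<close>

section \<open>Convex functions on subspaces and strongly convex minimization\<close>

text \<open>A subspace need not be open, so a linear projection onto it is used to extend \<open>f\<close> to a convex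
  function on the whole space.\<close>

lemma convex_on_subspace_continuous:
  fixes f :: "'a::euclidean_space \<Rightarrow> real"
  assumes S: "subspace S" and f: "convex_on S f"
  shows "continuous_on S f"
proof -
  have "linear (id :: 'a \<Rightarrow> 'a)" by (rule linear_id)
  from linear_exists_left_inverse_on[OF this S]
  obtain g where g: "range g \<subseteq> S" "linear g" "\<forall>v\<in>S. g v = v" by auto
  have "convex_on UNIV (\<lambda>x. f (g x))"
  proof (rule convex_onI)
    fix t :: real and x y :: 'a
    assume "0 < t" "t < 1"
    then show "f (g ((1 - t) *\<^sub>R x + t *\<^sub>R y)) \<le> (1 - t) * f (g x) + t * f (g y)"
      using convex_onD[OF f, of t "g x" "g y"] g(1)
      by (auto simp: linear_add[OF g(2)] linear_scale[OF g(2)])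
  qed simp
  then have "continuous_on UNIV (\<lambda>x. f (g x))"
    by (intro convex_on_continuous) auto
  then have "continuous_on S (\<lambda>x. f (g x))"
    by (rule continuous_on_subset) simp
  then show ?thesis
    by (rule continuous_on_eq) (simp add: g(3))
qed

lemma strongly_convex_imp_convex:
  assumes "strongly_convex_on \<mu> S f" "0 \<le> \<mu>"
  shows "convex_on S f"
proof (rule convex_onI)
  fix t :: real and x y
  assume t: "0 < t" "t < 1" and xy: "x \<in> S" "y \<in> S"
  have "f ((1 - t) *\<^sub>R x + t *\<^sub>R y)
      \<le> (1 - t) * f x + t * f y - \<mu> / 2 * t * (1 - t) * (norm (x - y))\<^sup>2"
    using assms(1) t xy unfolding strongly_convex_on_def by auto
  moreover have "0 \<le> \<mu> / 2 * t * (1 - t) * (norm (x - y))\<^sup>2"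
    using t assms(2) by auto
  ultimately show "f ((1 - t) *\<^sub>R x + t *\<^sub>R y) \<le> (1 - t) * f x + t * f y"
    by linarith
qed (use assms(1) in \<open>simp add: strongly_convex_on_def\<close>)

lemma strongly_convex_on_add_convex:
  assumes f: "strongly_convex_on \<mu> S f" and g: "convex_on S g"
  shows "strongly_convex_on \<mu> S (\<lambda>x. f x + g x)"
  unfolding strongly_convex_on_def
proof (intro conjI ballI)
  show "convex S" using g by (simp add: convex_on_def)
next
  fix x y and c :: real assume "x \<in> S" "y \<in> S" "c \<in> {0..1}"
  then have "f ((1 - c) *\<^sub>R x + c *\<^sub>R y)
        \<le> (1 - c) * f x + c * f y - \<mu> / 2 * c * (1 - c) * (norm (x - y))\<^sup>2"
    and "g ((1 - c) *\<^sub>R x + c *\<^sub>R y) \<le> (1 - c) * g x + c * g y"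
    using f convex_onD[OF g] unfolding strongly_convex_on_def by auto
  then show "f ((1 - c) *\<^sub>R x + c *\<^sub>R y) + g ((1 - c) *\<^sub>R x + c *\<^sub>R y)
        \<le> (1 - c) * (f x + g x) + c * (f y + g y) - \<mu> / 2 * c * (1 - c) * (norm (x - y))\<^sup>2"
    by (simp add: algebra_simps)
qed

text \<open>The strong convexity inequality between the minimizer and \<open>y\<close> is divided by the weight \<open>c\<close>
  of \<open>y\<close>, which then tends to \<open>0\<close>.\<close>

lemma strongly_convex_minimizer_growth:
  assumes f: "strongly_convex_on \<mu> S f"
    and X: "convex X" "X \<subseteq> S" and x: "x \<in> X" "\<And>u. u \<in> X \<Longrightarrow> f x \<le> f u" and y: "y \<in> X"
  shows "f x + \<mu> / 2 * (norm (y - x))\<^sup>2 \<le> f y"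
proof -
  let ?d = "\<mu> / 2 * (norm (y - x))\<^sup>2"
  have "f x + (1 - c) * ?d \<le> f y" if c: "0 < c" "c < 1" for c
  proof -
    have "(1 - c) *\<^sub>R x + c *\<^sub>R y \<in> X"
      using X(1) x(1) y c by (auto simp: convex_alt)
    then have "f x \<le> f ((1 - c) *\<^sub>R x + c *\<^sub>R y)" by (rule x(2))
    also have "\<dots> \<le> (1 - c) * f x + c * f y - \<mu> / 2 * c * (1 - c) * (norm (x - y))\<^sup>2"
      using f[unfolded strongly_convex_on_def, THEN conjunct2, rule_format, of x y c] c x(1) y X(2)
      by (simp add: subset_iff)
    finally have "c * (f x + (1 - c) * ?d) \<le> c * f y"
      by (simp add: algebra_simps norm_minus_commute)
    then show ?thesis using c by simp
  qed
  then have "eventually (\<lambda>c. f x + (1 - c) * ?d \<le> f y) (at_right (0::real))"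
    by (intro eventually_at_rightI[of 0 1]) auto
  moreover have "((\<lambda>c. f x + (1 - c) * ?d) \<longlongrightarrow> f x + (1 - 0) * ?d) (at_right 0)"
    by (intro tendsto_intros)
  ultimately show ?thesis
    using tendsto_upperbound[of _ _ "at_right (0::real)"] by fastforce
qed

lemma arg_min_on_attained:
  assumes "compact X" "X \<noteq> {}" "continuous_on X (f :: 'a::topological_space \<Rightarrow> real)"
  shows "arg_min_on f X \<in> X" "\<And>u. u \<in> X \<Longrightarrow> f (arg_min_on f X) \<le> f u"
    "(INF u\<in>X. f u) = f (arg_min_on f X)"
proof -
  obtain x where x: "x \<in> X" "\<forall>y\<in>X. f x \<le> f y"
    using continuous_attains_inf[OF assms] by blast
  have *: "arg_min_on f X \<in> X \<and> (\<forall>y\<in>X. f (arg_min_on f X) \<le> f y)"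
    unfolding arg_min_on_def by (rule arg_minI[of _ x]) (use x in \<open>auto simp: not_less\<close>)
  then show "arg_min_on f X \<in> X" and **: "\<And>u. u \<in> X \<Longrightarrow> f (arg_min_on f X) \<le> f u" by auto
  show "(INF u\<in>X. f u) = f (arg_min_on f X)"
    using * by (intro cInf_eq_minimum) auto
qed

section \<open>Stage problems\<close>

context multistage_problem
begin

lemma stage_ranges:
  assumes "t \<in> {1..T-1}"
  shows "t \<in> {1..T}" "Suc t \<in> {2..T}" "Suc t \<in> {1..T}"
  using assms by auto

lemma F_convex:
  assumes "t \<in> {1..T-1}" "\<omega> \<in> \<Xi> (Suc t)"
  shows "convex_on (E (Suc t) \<times> E t) (\<lambda>(y, x). F (Suc t) y x \<omega>)"
    and "\<And>y x x'. y \<in> E (Suc t) \<Longrightarrow> x \<in> E t \<Longrightarrow> x' \<in> E t \<Longrightarrow>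
      F (Suc t) y x \<omega> \<le> F (Suc t) y x' \<omega> + M t * norm (x - x')"
    and "\<And>x. x \<in> E t \<Longrightarrow> strongly_convex_on (\<mu> (Suc t)) (E (Suc t)) (\<lambda>y. F (Suc t) y x \<omega>)"
proof -
  have *: "cost_class (E (Suc t)) (E t) (M t) (\<mu> (Suc t)) (\<lambda>y x. F (Suc t) y x \<omega>)"
    using F_class[of "Suc t" \<omega>] stage_ranges[OF assms(1)] assms(2) by simp
  then show "convex_on (E (Suc t) \<times> E t) (\<lambda>(y, x). F (Suc t) y x \<omega>)"
    and "\<And>x. x \<in> E t \<Longrightarrow> strongly_convex_on (\<mu> (Suc t)) (E (Suc t)) (\<lambda>y. F (Suc t) y x \<omega>)"
    by (auto simp: cost_class_def)
  fix y x x' assume "y \<in> E (Suc t)" "x \<in> E t" "x' \<in> E t"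
  then have "norm (F (Suc t) y x \<omega> - F (Suc t) y x' \<omega>) \<le> M t * norm (x - x')"
    using * by (intro lipschitz_on_normD) (auto simp: cost_class_def)
  then show "F (Suc t) y x \<omega> \<le> F (Suc t) y x' \<omega> + M t * norm (x - x')" by auto
qed

lemma stage_objective_strongly_convex:
  assumes "t \<in> {1..T-1}" "\<omega> \<in> \<Xi> (Suc t)" "convex_on (E (Suc t)) \<phi>" "x \<in> E t"
  shows "strongly_convex_on (\<mu> (Suc t)) (E (Suc t)) (\<lambda>u. F (Suc t) u x \<omega> + \<phi> u)"
  by (rule strongly_convex_on_add_convex[OF F_convex(3)[OF assms(1,2,4)] assms(3)])

lemma stage_objective_continuous:
  assumes "t \<in> {1..T-1}" "\<omega> \<in> \<Xi> (Suc t)" "convex_on (E (Suc t)) \<phi>" "x \<in> E t"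
  shows "continuous_on (X (Suc t)) (\<lambda>u. F (Suc t) u x \<omega> + \<phi> u)"
proof (rule continuous_on_subset[OF convex_on_subspace_continuous])
  show "convex_on (E (Suc t)) (\<lambda>u. F (Suc t) u x \<omega> + \<phi> u)"
    using strongly_convex_imp_convex[OF stage_objective_strongly_convex[OF assms]]
      mu_pos[of "Suc t"] stage_ranges[OF assms(1)] by simp
qed (use stage_ranges[OF assms(1)] subspace_E X_subset in auto)

definition stage_argmin :: "nat \<Rightarrow> ('a \<Rightarrow> real) \<Rightarrow> 'a \<Rightarrow> 'o \<Rightarrow> 'a"
  where "stage_argmin t \<phi> x \<omega> = arg_min_on (\<lambda>u. F (Suc t) u x \<omega> + \<phi> u) (X (Suc t))"

lemma stage_argmin:
  assumes "t \<in> {1..T-1}" "\<omega> \<in> \<Xi> (Suc t)" "convex_on (E (Suc t)) \<phi>" "x \<in> E t"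
  shows "stage_argmin t \<phi> x \<omega> \<in> X (Suc t)"
    and "stage_value t \<phi> x \<omega> = F (Suc t) (stage_argmin t \<phi> x \<omega>) x \<omega> + \<phi> (stage_argmin t \<phi> x \<omega>)"
    and "\<And>u. u \<in> X (Suc t) \<Longrightarrow> stage_value t \<phi> x \<omega> \<le> F (Suc t) u x \<omega> + \<phi> u"
proof -
  have "compact (X (Suc t))" "X (Suc t) \<noteq> {}"
    using X_compact X_nonempty stage_ranges[OF assms(1)] by auto
  note * = arg_min_on_attained[OF this stage_objective_continuous[OF assms]]
  show "stage_argmin t \<phi> x \<omega> \<in> X (Suc t)"
    using *(1) by (simp add: stage_argmin_def)
  show **: "stage_value t \<phi> x \<omega> = F (Suc t) (stage_argmin t \<phi> x \<omega>) x \<omega> + \<phi> (stage_argmin t \<phi> x \<omega>)"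
    using *(3) by (simp add: stage_value_def stage_argmin_def)
  show "\<And>u. u \<in> X (Suc t) \<Longrightarrow> stage_value t \<phi> x \<omega> \<le> F (Suc t) u x \<omega> + \<phi> u"
    unfolding ** using *(2) by (simp add: stage_argmin_def)
qed

lemma stage_value_growth:
  assumes "t \<in> {1..T-1}" "\<omega> \<in> \<Xi> (Suc t)" "convex_on (E (Suc t)) \<phi>" "x \<in> E t" "u \<in> X (Suc t)"
  shows "stage_value t \<phi> x \<omega> + \<mu> (Suc t) / 2 * (norm (u - stage_argmin t \<phi> x \<omega>))\<^sup>2
    \<le> F (Suc t) u x \<omega> + \<phi> u"
  unfolding stage_argmin(2)[OF assms(1-4)]
proof (rule strongly_convex_minimizer_growth[OF stage_objective_strongly_convex[OF assms(1-4)]])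
  show "convex (X (Suc t))" "X (Suc t) \<subseteq> E (Suc t)"
    using X_convex X_subset stage_ranges[OF assms(1)] by auto
  show "F (Suc t) (stage_argmin t \<phi> x \<omega>) x \<omega> + \<phi> (stage_argmin t \<phi> x \<omega>) \<le> F (Suc t) u x \<omega> + \<phi> u"
    if "u \<in> X (Suc t)" for u
    using stage_argmin(2,3)[OF assms(1-4)] that by simp
qed (use stage_argmin(1)[OF assms(1-4)] assms(5) in auto)

lemma stage_value_lipschitz:
  assumes "t \<in> {1..T-1}" "\<omega> \<in> \<Xi> (Suc t)" "convex_on (E (Suc t)) \<phi>" "x \<in> E t" "y \<in> E t"
  shows "stage_value t \<phi> x \<omega> \<le> stage_value t \<phi> y \<omega> + M t * norm (x - y)"
proof -
  let ?u = "stage_argmin t \<phi> y \<omega>"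
  note u = stage_argmin(1,2)[OF assms(1,2,3,5)]
  have "?u \<in> E (Suc t)"
    using u(1) X_subset stage_ranges[OF assms(1)] by blast
  then show ?thesis
    using stage_argmin(3)[OF assms(1-4) u(1)] u(2) F_convex(2)[OF assms(1,2) _ assms(4,5), of ?u]
    by simp
qed

lemma stage_value_le_shift:
  assumes "t \<in> {1..T-1}" "\<omega> \<in> \<Xi> (Suc t)" "convex_on (E (Suc t)) \<phi>" "convex_on (E (Suc t)) \<psi>"
    and "x \<in> E t" "\<And>u. u \<in> X (Suc t) \<Longrightarrow> \<phi> u \<le> \<psi> u + c"
  shows "stage_value t \<phi> x \<omega> \<le> stage_value t \<psi> x \<omega> + c"
  using stage_argmin(3)[OF assms(1,2,3,5) stage_argmin(1)[OF assms(1,2,4,5)]]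
    stage_argmin(2)[OF assms(1,2,4,5)] assms(6)[OF stage_argmin(1)[OF assms(1,2,4,5)]]
  by simp

text \<open>Partial minimization of a jointly convex function.\<close>

lemma stage_value_convex:
  assumes "t \<in> {1..T-1}" "\<omega> \<in> \<Xi> (Suc t)" "convex_on (E (Suc t)) \<phi>"
  shows "convex_on (E t) (\<lambda>x. stage_value t \<phi> x \<omega>)"
proof (rule convex_onI)
  show E: "convex (E t)" using subspace_E stage_ranges[OF assms(1)] subspace_imp_convex by blast
  fix c :: real and x y assume c: "0 < c" "c < 1" and xy: "x \<in> E t" "y \<in> E t"
  let ?u = "stage_argmin t \<phi> x \<omega>" and ?v = "stage_argmin t \<phi> y \<omega>"
  let ?z = "(1 - c) *\<^sub>R x + c *\<^sub>R y" and ?w = "(1 - c) *\<^sub>R ?u + c *\<^sub>R ?v"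
  note u = stage_argmin(1,2)[OF assms xy(1)] and v = stage_argmin(1,2)[OF assms xy(2)]
  have XE: "X (Suc t) \<subseteq> E (Suc t)" "convex (X (Suc t))"
    using X_subset X_convex stage_ranges[OF assms(1)] by auto
  then have w: "?w \<in> X (Suc t)"
    using u(1) v(1) c by (auto simp: convex_alt)
  have z: "?z \<in> E t" using E xy c by (auto simp: convex_alt)
  have "stage_value t \<phi> ?z \<omega> \<le> F (Suc t) ?w ?z \<omega> + \<phi> ?w"
    by (rule stage_argmin(3)[OF assms z w])
  also have "F (Suc t) ?w ?z \<omega> \<le> (1 - c) * F (Suc t) ?u x \<omega> + c * F (Suc t) ?v y \<omega>"
    using convex_onD[OF F_convex(1)[OF assms(1,2)], of c "(?u, x)" "(?v, y)"] c u(1) v(1) XE xy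
    by auto
  also have "\<phi> ?w \<le> (1 - c) * \<phi> ?u + c * \<phi> ?v"
    using convex_onD[OF assms(3), of c ?u ?v] c u(1) v(1) XE by auto
  finally show "stage_value t \<phi> ?z \<omega> \<le> (1 - c) * stage_value t \<phi> x \<omega> + c * stage_value t \<phi> y \<omega>"
    unfolding u(2) v(2) by (simp add: algebra_simps)
qed

subsection \<open>Expectations over one stage\<close>

abbreviation xi_mean :: "nat \<Rightarrow> ('o \<Rightarrow> real) \<Rightarrow> real"
  where "xi_mean t g \<equiv> expectation (\<lambda>w. g (\<xi> (Suc t) w))"

abbreviation xi_prob :: "nat \<Rightarrow> 'o \<Rightarrow> real"
  where "xi_prob t \<omega> \<equiv> prob {w \<in> space \<Omega>. \<xi> t w = \<omega>}"

lemma xi_measurable: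
  assumes "t \<in> {2..T}"
  shows "\<xi> t \<in> \<Omega> \<rightarrow>\<^sub>M count_space (\<Xi> t)"
  using xi_indep assms by (auto simp: indep_vars_def)

lemma xi_in_support:
  assumes "t \<in> {2..T}" "w \<in> space \<Omega>"
  shows "\<xi> t w \<in> \<Xi> t"
  using measurable_space[OF xi_measurable[OF assms(1)] assms(2)] by simp

lemma xi_event:
  assumes "t \<in> {2..T}"
  shows "{w \<in> space \<Omega>. \<xi> t w = \<omega>} \<in> events"
proof -
  have "{w \<in> space \<Omega>. \<xi> t w = \<omega>} = \<xi> t -` ({\<omega>} \<inter> \<Xi> t) \<inter> space \<Omega>"
    using xi_in_support[OF assms] by auto
  also have "\<dots> \<in> events"
    by (rule measurable_sets[OF xi_measurable[OF assms]]) simp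
  finally show ?thesis .
qed

lemma xi_mean_eq_sum:
  assumes "t \<in> {1..T-1}"
  shows "xi_mean t g = (\<Sum>\<omega>\<in>\<Xi> (Suc t). xi_prob (Suc t) \<omega> * g \<omega>)"
proof -
  note t = stage_ranges[OF assms]
  have "xi_mean t g = expectation (\<lambda>w. \<Sum>\<omega>\<in>\<Xi> (Suc t). g \<omega> * indicator {w \<in> space \<Omega>. \<xi> (Suc t) w = \<omega>} w)"
  proof (rule Bochner_Integration.integral_cong[OF refl])
    fix w assume w: "w \<in> space \<Omega>"
    have "(\<Sum>\<omega>\<in>\<Xi> (Suc t). g \<omega> * indicator {w \<in> space \<Omega>. \<xi> (Suc t) w = \<omega>} w)
       = (\<Sum>\<omega>\<in>\<Xi> (Suc t). if \<omega> = \<xi> (Suc t) w then g \<omega> else 0)"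
      by (rule sum.cong) (use w in \<open>auto simp: indicator_def\<close>)
    also have "\<dots> = g (\<xi> (Suc t) w)"
      using support_finite[OF t(2)] xi_in_support[OF t(2) w] by simp
    finally show "g (\<xi> (Suc t) w)
      = (\<Sum>\<omega>\<in>\<Xi> (Suc t). g \<omega> * indicator {w \<in> space \<Omega>. \<xi> (Suc t) w = \<omega>} w)" by simp
  qed
  also have "\<dots> = (\<Sum>\<omega>\<in>\<Xi> (Suc t). g \<omega> * xi_prob (Suc t) \<omega>)"
    using xi_event[OF t(2)]
    by (subst Bochner_Integration.integral_sum) (auto simp: emeasure_eq_measure)
  finally show ?thesis by (simp add: mult.commute)
qed

lemma xi_prob_sum:
  assumes "t \<in> {1..T-1}"
  shows "(\<Sum>\<omega>\<in>\<Xi> (Suc t). xi_prob (Suc t) \<omega>) = 1"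
  using xi_mean_eq_sum[OF assms, of "\<lambda>_. 1"] by (simp add: prob_space)

lemma support_nonempty:
  assumes "t \<in> {1..T-1}"
  shows "\<Xi> (Suc t) \<noteq> {}"
  using xi_prob_sum[OF assms] by auto

lemma xi_mean_mono_shift:
  assumes "t \<in> {1..T-1}" "\<And>\<omega>. \<omega> \<in> \<Xi> (Suc t) \<Longrightarrow> g \<omega> \<le> h \<omega> + c"
  shows "xi_mean t g \<le> xi_mean t h + c"
proof -
  have "xi_mean t g \<le> (\<Sum>\<omega>\<in>\<Xi> (Suc t). xi_prob (Suc t) \<omega> * (h \<omega> + c))"
    unfolding xi_mean_eq_sum[OF assms(1)]
    by (intro sum_mono mult_left_mono assms(2)) auto
  also have "\<dots> = xi_mean t h + c"
    using xi_prob_sum[OF assms(1)]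
    by (simp add: xi_mean_eq_sum[OF assms(1)] distrib_left sum.distrib flip: sum_distrib_right)
  finally show ?thesis .
qed

lemma xi_mean_diff_le_member:
  assumes "t \<in> {1..T-1}"
  shows "\<exists>\<omega>\<in>\<Xi> (Suc t). xi_mean t g - xi_mean t h \<le> g \<omega> - h \<omega>"
proof (rule ccontr)
  let ?S = "\<Xi> (Suc t)" and ?d = "xi_mean t g - xi_mean t h"
  assume "\<not> ?thesis"
  then have less: "g \<omega> - h \<omega> < ?d" if "\<omega> \<in> ?S" for \<omega> using that by force
  have "(\<Sum>\<omega>\<in>?S. xi_prob (Suc t) \<omega> * (g \<omega> - h \<omega>)) < (\<Sum>\<omega>\<in>?S. xi_prob (Suc t) \<omega> * ?d)"
    using stage_ranges[OF assms] support_nonempty[OF assms]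
    by (intro sum_strict_mono mult_strict_left_mono less support_pos support_finite) auto
  also have "\<dots> = ?d" using xi_prob_sum[OF assms] by (simp flip: sum_distrib_right)
  finally show False
    by (simp add: xi_mean_eq_sum[OF assms] right_diff_distrib sum_subtractf)
qed

lemma xi_mean_convex:
  assumes "t \<in> {1..T-1}" "\<And>\<omega>. \<omega> \<in> \<Xi> (Suc t) \<Longrightarrow> convex_on S (\<lambda>x. g x \<omega>)"
  shows "convex_on S (\<lambda>x. xi_mean t (g x))"
proof (rule convex_onI)
  show "convex S" using assms(2) support_nonempty[OF assms(1)] by (auto simp: convex_on_def)
  fix c :: real and x y assume c: "0 < c" "c < 1" "x \<in> S" "y \<in> S"
  let ?z = "(1 - c) *\<^sub>R x + c *\<^sub>R y"
  have "xi_mean t (g ?z) \<le> (\<Sum>\<omega>\<in>\<Xi> (Suc t). xi_prob (Suc t) \<omega> * ((1 - c) * g x \<omega> + c * g y \<omega>))"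
    unfolding xi_mean_eq_sum[OF assms(1)]
    by (intro sum_mono mult_left_mono convex_onD[OF assms(2)]) (use c in auto)
  also have "\<dots> = (1 - c) * xi_mean t (g x) + c * xi_mean t (g y)"
    unfolding xi_mean_eq_sum[OF assms(1)]
    by (simp add: sum_distrib_left sum.distrib algebra_simps sum_subtractf)
  finally show "xi_mean t (g ?z) \<le> (1 - c) * xi_mean t (g x) + c * xi_mean t (g y)" .
qed

definition expected_value :: "nat \<Rightarrow> ('a \<Rightarrow> real) \<Rightarrow> 'a \<Rightarrow> real"
  where "expected_value t \<phi> x = xi_mean t (stage_value t \<phi> x)"

lemma expected_value_lipschitz:
  assumes "t \<in> {1..T-1}" "convex_on (E (Suc t)) \<phi>" "x \<in> E t" "y \<in> E t"
  shows "expected_value t \<phi> x \<le> expected_value t \<phi> y + M t * norm (x - y)"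
  unfolding expected_value_def
  by (intro xi_mean_mono_shift stage_value_lipschitz assms)

lemma expected_value_le_shift:
  assumes "t \<in> {1..T-1}" "convex_on (E (Suc t)) \<phi>" "convex_on (E (Suc t)) \<psi>"
    and "x \<in> E t" "\<And>u. u \<in> X (Suc t) \<Longrightarrow> \<phi> u \<le> \<psi> u + c"
  shows "expected_value t \<phi> x \<le> expected_value t \<psi> x + c"
  unfolding expected_value_def
  by (intro xi_mean_mono_shift stage_value_le_shift assms)

lemma expected_value_convex:
  assumes "t \<in> {1..T-1}" "convex_on (E (Suc t)) \<phi>"
  shows "convex_on (E t) (expected_value t \<phi>)"
  unfolding expected_value_def
  by (intro xi_mean_convex stage_value_convex assms)

lemma Q_last: "T \<le> t \<Longrightarrow> Q t = (\<lambda>x. 0)"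
  unfolding Q_def by (subst backward_rec.simps) simp

lemma Q_step: "t < T \<Longrightarrow> Q t = expected_value t (Q (Suc t))"
  unfolding Q_def by (subst backward_rec.simps) (simp add: expected_value_def fun_eq_iff)

lemma convex_on_zero: "t \<in> {1..T} \<Longrightarrow> convex_on (E t) (\<lambda>x. 0)"
  using subspace_E[of t] by (simp add: convex_on_def subspace_imp_convex)

lemma Q_convex:
  assumes "t \<in> {1..T}"
  shows "convex_on (E t) (Q t)"
  using assms
proof (induction "T - t" arbitrary: t)
  case 0
  then show ?case using convex_on_zero[of t] by (simp add: Q_last)
next
  case (Suc n)
  then have "convex_on (E (Suc t)) (Q (Suc t))" by auto
  then show ?case
    using expected_value_convex[of t] Suc Q_step[of t] by auto
qed

lemma Q_lipschitz:
  assumes "t \<in> {1..T-1}" "x \<in> E t" "y \<in> E t"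
  shows "Q t x \<le> Q t y + M t * norm (x - y)"
  using expected_value_lipschitz[OF assms(1) Q_convex assms(2,3)] Q_step[of t] assms(1)
    stage_ranges[OF assms(1)] by auto

end

context multistage_problem
begin

section \<open>Forward passes\<close>

definition scenarios :: "(nat \<Rightarrow> 'o) set"
  where "scenarios = PiE {2..T} \<Xi>"

lemma scenario_in_support: "s \<in> scenarios \<Longrightarrow> t \<in> {1..T-1} \<Longrightarrow> s (Suc t) \<in> \<Xi> (Suc t)"
  using stage_ranges(2)[of t] by (auto simp: scenarios_def PiE_iff)

definition convex_model :: "(nat \<Rightarrow> 'a \<Rightarrow> real) \<Rightarrow> bool"
  where "convex_model \<Gamma> \<longleftrightarrow> (\<forall>t\<in>{1..T}. convex_on (E t) (\<Gamma> t))"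

definition model_le :: "(nat \<Rightarrow> 'a \<Rightarrow> real) \<Rightarrow> (nat \<Rightarrow> 'a \<Rightarrow> real) \<Rightarrow> bool"
  where "model_le \<Gamma> \<Gamma>' \<longleftrightarrow> (\<forall>t\<in>{1..T}. \<forall>x\<in>E t. \<Gamma> t x \<le> \<Gamma>' t x)"

definition root_value :: "(nat \<Rightarrow> 'a \<Rightarrow> real) \<Rightarrow> real"
  where "root_value \<Gamma> = (INF u\<in>X 1. F1 u + \<Gamma> 1 u)"

lemma one_in_stages: "1 \<in> {1..T}" "1 \<in> {1..T-1}"
  using T_ge_2 by auto

lemma convex_modelD:
  "convex_model \<Gamma> \<Longrightarrow> t \<in> {1..T} \<Longrightarrow> convex_on (E t) (\<Gamma> t)"
  "convex_model \<Gamma> \<Longrightarrow> t \<in> {1..T-1} \<Longrightarrow> convex_on (E (Suc t)) (\<Gamma> (Suc t))"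
  using stage_ranges(3) by (auto simp: convex_model_def)

lemma convex_model_Q: "convex_model Q"
  using Q_convex by (simp add: convex_model_def)

lemma model_leD: "model_le \<Gamma> \<Gamma>' \<Longrightarrow> t \<in> {1..T} \<Longrightarrow> x \<in> X t \<Longrightarrow> \<Gamma> t x \<le> \<Gamma>' t x"
  using X_subset[of t] unfolding model_le_def by blast

lemma model_le_trans: "model_le \<Gamma> \<Gamma>' \<Longrightarrow> model_le \<Gamma>' \<Gamma>'' \<Longrightarrow> model_le \<Gamma> \<Gamma>''"
  unfolding model_le_def by (meson order_trans)

lemma model_le_refl: "model_le \<Gamma> \<Gamma>"
  unfolding model_le_def by simp

lemma root_objective_continuous:
  assumes "convex_model \<Gamma>"
  shows "continuous_on (X 1) (\<lambda>u. F1 u + \<Gamma> 1 u)"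
proof (rule continuous_on_add)
  show "continuous_on (X 1) F1"
    using F1_lipschitz by (rule lipschitz_on_continuous_on)
  show "continuous_on (X 1) (\<Gamma> 1)"
    using convex_on_subspace_continuous[OF subspace_E convex_modelD(1)[OF assms]] one_in_stages(1)
      X_subset continuous_on_subset by blast
qed

lemma forward_one:
  assumes "convex_model \<Gamma>"
  shows "forward \<Gamma> s 1 \<in> X 1"
    and "root_value \<Gamma> = F1 (forward \<Gamma> s 1) + \<Gamma> 1 (forward \<Gamma> s 1)"
    and "\<And>u. u \<in> X 1 \<Longrightarrow> root_value \<Gamma> + \<mu> 1 / 2 * (norm (u - forward \<Gamma> s 1))\<^sup>2 \<le> F1 u + \<Gamma> 1 u"
proof -
  have "compact (X 1)" "X 1 \<noteq> {}"
    using X_compact X_nonempty one_in_stages by auto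
  note * = arg_min_on_attained[OF this root_objective_continuous[OF assms]]
  show in_X: "forward \<Gamma> s 1 \<in> X 1" using *(1) by simp
  show root: "root_value \<Gamma> = F1 (forward \<Gamma> s 1) + \<Gamma> 1 (forward \<Gamma> s 1)"
    using *(3) by (simp add: root_value_def)
  have X: "convex (X 1)" "X 1 \<subseteq> E 1"
    using X_convex X_subset one_in_stages by auto
  then have "convex_on (X 1) (\<Gamma> 1)"
    using convex_modelD(1)[OF assms one_in_stages(1)] by (auto intro: convex_on_subset)
  then have "strongly_convex_on (\<mu> 1) (X 1) (\<lambda>u. F1 u + \<Gamma> 1 u)"
    by (rule strongly_convex_on_add_convex[OF F1_strongly_convex])
  from strongly_convex_minimizer_growth[OF this X(1) subset_refl in_X] *(2)
  show "\<And>u. u \<in> X 1 \<Longrightarrow> root_value \<Gamma> + \<mu> 1 / 2 * (norm (u - forward \<Gamma> s 1))\<^sup>2 \<le> F1 u + \<Gamma> 1 u"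
    unfolding root by simp
qed

lemma forward_Suc:
  assumes "1 \<le> t"
  shows "forward \<Gamma> s (Suc t) = stage_argmin t (\<Gamma> (Suc t)) (forward \<Gamma> s t) (s (Suc t))"
  using assms by (cases t) (auto simp: stage_argmin_def)

lemma forward_in:
  assumes "convex_model \<Gamma>" "s \<in> scenarios"
  shows "t \<in> {1..T} \<Longrightarrow> forward \<Gamma> s t \<in> X t"
proof (induction t)
  case (Suc t)
  show ?case
  proof (cases "t = 0")
    case True
    then show ?thesis using forward_one(1)[OF assms(1)] by simp
  next
    case False
    then have t: "t \<in> {1..T-1}" using Suc.prems by auto
    have "forward \<Gamma> s t \<in> X t" using Suc.IH Suc.prems False by auto
    then have "forward \<Gamma> s t \<in> E t" using X_subset stage_ranges(1)[OF t] by blast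
    then show ?thesis
      using stage_argmin(1)[OF t scenario_in_support[OF assms(2) t] convex_modelD(2)[OF assms(1) t]]
        forward_Suc[of t] False by simp
  qed
qed simp

lemma forward_in_E:
  assumes "convex_model \<Gamma>" "s \<in> scenarios" "t \<in> {1..T}"
  shows "forward \<Gamma> s t \<in> E t"
  using forward_in[OF assms] X_subset[OF assms(3)] by blast

lemma forward_cong:
  assumes "\<And>r. r \<in> {2..t} \<Longrightarrow> s r = s' r"
  shows "forward \<Gamma> s t = forward \<Gamma> s' t"
  using assms
proof (induction t)
  case (Suc t)
  show ?case
  proof (cases "t = 0")
    case False
    have "forward \<Gamma> s t = forward \<Gamma> s' t" by (rule Suc.IH) (use Suc.prems in auto)
    moreover have "s (Suc t) = s' (Suc t)" using Suc.prems False by auto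
    ultimately show ?thesis using False by (simp add: forward_Suc)
  qed simp
qed simp

definition path_value :: "(nat \<Rightarrow> 'a \<Rightarrow> real) \<Rightarrow> (nat \<Rightarrow> 'o) \<Rightarrow> nat \<Rightarrow> real"
  where "path_value \<Gamma> s t = stage_value t (\<Gamma> (Suc t)) (forward \<Gamma> s t) (s (Suc t))"

text \<open>Here \<open>t\<close> is the stage whose decision is fixed: the error concerns the problem of stage \<open>t + 1\<close>
  after the realisation \<open>s (Suc t)\<close>.\<close>

definition path_error :: "(nat \<Rightarrow> 'a \<Rightarrow> real) \<Rightarrow> (nat \<Rightarrow> 'o) \<Rightarrow> nat \<Rightarrow> real"
  where "path_error \<Gamma> s t = stage_value t (Q (Suc t)) (forward \<Gamma> s t) (s (Suc t)) - path_value \<Gamma> s t"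

lemma path_value_attained:
  assumes "convex_model \<Gamma>" "s \<in> scenarios" "t \<in> {1..T-1}"
  shows "path_value \<Gamma> s t = F (Suc t) (forward \<Gamma> s (Suc t)) (forward \<Gamma> s t) (s (Suc t))
     + \<Gamma> (Suc t) (forward \<Gamma> s (Suc t))"
  using stage_argmin(2)[OF assms(3) scenario_in_support[OF assms(2,3)] convex_modelD(2)[OF assms(1,3)]
      forward_in_E[OF assms(1,2) stage_ranges(1)[OF assms(3)]]] assms(3) forward_Suc[of t \<Gamma> s]
  by (simp add: path_value_def)

text \<open>The new decision is feasible for the old problem, where strong convexity makes it suboptimal.
  Passing from the old problem to the new one replaces the previous decision, which costs at most the
  Lipschitz term, and raises the model.\<close>

lemma path_value_growth:
  assumes "convex_model \<Gamma>" "convex_model \<Gamma>'" "model_le \<Gamma> \<Gamma>'" "s \<in> scenarios" "t \<in> {1..T-1}"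
  shows "path_value \<Gamma> s t + \<mu> (Suc t) / 2 * (norm (forward \<Gamma>' s (Suc t) - forward \<Gamma> s (Suc t)))\<^sup>2
    \<le> path_value \<Gamma>' s t + M t * norm (forward \<Gamma>' s t - forward \<Gamma> s t)"
proof -
  let ?x = "forward \<Gamma> s t" and ?x' = "forward \<Gamma>' s t" and ?\<omega> = "s (Suc t)"
  let ?u = "forward \<Gamma>' s (Suc t)"
  note t = stage_ranges[OF assms(5)]
  have u: "?u \<in> X (Suc t)" by (rule forward_in[OF assms(2,4) t(3)])
  have x: "?x \<in> E t" "?x' \<in> E t" "?u \<in> E (Suc t)"
    using forward_in_E assms t by auto
  have \<omega>: "?\<omega> \<in> \<Xi> (Suc t)" by (rule scenario_in_support[OF assms(4,5)])
  have "path_value \<Gamma> s t + \<mu> (Suc t) / 2 * (norm (?u - forward \<Gamma> s (Suc t)))\<^sup>2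
    \<le> F (Suc t) ?u ?x ?\<omega> + \<Gamma> (Suc t) ?u"
    using stage_value_growth[OF assms(5) \<omega> convex_modelD(2)[OF assms(1,5)] x(1) u] assms(5)
    by (simp add: path_value_def forward_Suc)
  also have "\<dots> \<le> F (Suc t) ?u ?x' ?\<omega> + M t * norm (?x' - ?x) + \<Gamma>' (Suc t) ?u"
    using F_convex(2)[OF assms(5) \<omega> x(3) x(1) x(2)] model_leD[OF assms(3) t(3) u]
    by (simp add: norm_minus_commute)
  finally show ?thesis
    using path_value_attained[OF assms(2,4,5)] by simp
qed

lemma root_value_growth:
  assumes "convex_model \<Gamma>" "convex_model \<Gamma>'" "model_le \<Gamma> \<Gamma>'"
  shows "root_value \<Gamma> + \<mu> 1 / 2 * (norm (forward \<Gamma>' s 1 - forward \<Gamma> s 1))\<^sup>2 \<le> root_value \<Gamma>'"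
  using forward_one(3)[OF assms(1) forward_one(1)[OF assms(2), of s], of s]
    forward_one(2)[OF assms(2), of s]
    model_leD[OF assms(3) one_in_stages(1) forward_one(1)[OF assms(2), of s]]
  by simp

lemma path_error_nonneg:
  assumes "convex_model \<Gamma>" "model_le \<Gamma> Q" "s \<in> scenarios" "t \<in> {1..T-1}"
  shows "0 \<le> path_error \<Gamma> s t"
  using stage_value_le_shift[OF assms(4) scenario_in_support[OF assms(3,4)]
      convex_modelD(2)[OF assms(1,4)] convex_modelD(2)[OF convex_model_Q assms(4)]
      forward_in_E[OF assms(1,3) stage_ranges(1)[OF assms(4)]], of 0]
    model_leD[OF assms(2) stage_ranges(3)[OF assms(4)]]
  by (simp add: path_error_def path_value_def)

text \<open>The decision of the next stage, optimal for the model, is feasible for the true problem.\<close>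

lemma path_error_le_model_error:
  assumes "convex_model \<Gamma>" "s \<in> scenarios" "t \<in> {1..T-1}"
  shows "path_error \<Gamma> s t
    \<le> Q (Suc t) (forward \<Gamma> s (Suc t)) - \<Gamma> (Suc t) (forward \<Gamma> s (Suc t))"
  using stage_argmin(3)[OF assms(3) scenario_in_support[OF assms(2,3)]
      convex_modelD(2)[OF convex_model_Q assms(3)]
      forward_in_E[OF assms(1,2) stage_ranges(1)[OF assms(3)]]
      forward_in[OF assms(1,2) stage_ranges(3)[OF assms(3)]]]
    path_value_attained[OF assms]
  by (simp add: path_error_def)

text \<open>The Lipschitz term occurs twice, once for the model and once for the true cost-to-go.\<close>

lemma path_error_change:
  assumes "convex_model \<Gamma>" "convex_model \<Gamma>'" "model_le \<Gamma> \<Gamma>'" "s \<in> scenarios" "t \<in> {1..T-1}"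
  shows "path_error \<Gamma>' s t + \<mu> (Suc t) / 2 * (norm (forward \<Gamma>' s (Suc t) - forward \<Gamma> s (Suc t)))\<^sup>2
    \<le> path_error \<Gamma> s t + 2 * M t * norm (forward \<Gamma>' s t - forward \<Gamma> s t)"
  using path_value_growth[OF assms]
    stage_value_lipschitz[OF assms(5) scenario_in_support[OF assms(4,5)]
      convex_modelD(2)[OF convex_model_Q assms(5)]
      forward_in_E[OF assms(2,4) stage_ranges(1)[OF assms(5)]]
      forward_in_E[OF assms(1,4) stage_ranges(1)[OF assms(5)]]]
  by (simp add: path_error_def)

section \<open>Worst scenarios\<close>

text \<open>This turns the error of \<open>\<V>\<^sub>t\<close>, an average over all realisations of the next stage, into the
  error of the single problem that the path \<open>s\<close> visits next.\<close>

definition worst_scenario :: "(nat \<Rightarrow> 'a \<Rightarrow> real) \<Rightarrow> (nat \<Rightarrow> 'o) \<Rightarrow> bool"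
  where "worst_scenario \<Gamma> s \<longleftrightarrow> (\<forall>t\<in>{1..T-1}.
    expected_value t (Q (Suc t)) (forward \<Gamma> s t) - expected_value t (\<Gamma> (Suc t)) (forward \<Gamma> s t)
      \<le> path_error \<Gamma> s t)"

text \<open>The realisations are chosen stage by stage: that of stage \<open>t + 1\<close> does not change the decisions up
  to stage \<open>t\<close>.\<close>

lemma worst_scenario_exists: "\<exists>s\<in>scenarios. worst_scenario \<Gamma> s"
proof -
  let ?ok = "\<lambda>s t. expected_value t (Q (Suc t)) (forward \<Gamma> s t)
      - expected_value t (\<Gamma> (Suc t)) (forward \<Gamma> s t) \<le> path_error \<Gamma> s t"
  have "\<exists>s\<in>scenarios. \<forall>t\<in>{1..n}. ?ok s t" if "n \<le> T - 1" for n
    using that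
  proof (induction n)
    case 0
    have "\<forall>t\<in>{2..T}. \<Xi> t \<noteq> {}"
    proof
      fix t assume "t \<in> {2..T}"
      then have "t - 1 \<in> {1..T-1}" "Suc (t - 1) = t" by auto
      then show "\<Xi> t \<noteq> {}" using support_nonempty[of "t - 1"] by metis
    qed
    then have "scenarios \<noteq> {}" by (auto simp: scenarios_def PiE_eq_empty_iff)
    then show ?case by auto
  next
    case (Suc n)
    then obtain s where s: "s \<in> scenarios" "\<forall>t\<in>{1..n}. ?ok s t" by auto
    let ?t = "Suc n"
    have t: "?t \<in> {1..T-1}" using Suc.prems by simp
    obtain \<omega> where \<omega>: "\<omega> \<in> \<Xi> (Suc ?t)"
      "expected_value ?t (Q (Suc ?t)) (forward \<Gamma> s ?t)
        - expected_value ?t (\<Gamma> (Suc ?t)) (forward \<Gamma> s ?t)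
      \<le> stage_value ?t (Q (Suc ?t)) (forward \<Gamma> s ?t) \<omega>
        - stage_value ?t (\<Gamma> (Suc ?t)) (forward \<Gamma> s ?t) \<omega>"
      using xi_mean_diff_le_member[OF t] unfolding expected_value_def by blast
    let ?s = "s(Suc ?t := \<omega>)"
    have same: "forward \<Gamma> ?s r = forward \<Gamma> s r" if "r \<le> ?t" for r
      by (rule forward_cong) (use that in auto)
    have "?s \<in> scenarios"
      using s(1) \<omega>(1) stage_ranges(2)[OF t] by (auto simp: scenarios_def PiE_iff extensional_def)
    moreover have "?ok ?s t" if "t \<in> {1..?t}" for t
    proof (cases "t = ?t")
      case True
      then show ?thesis using \<omega>(2) same[of ?t] by (simp add: path_error_def path_value_def)
    next
      case False
      then have "t \<in> {1..n}" using that by auto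
      then show ?thesis
        using s(2) same[of t] by (auto simp: path_error_def path_value_def)
    qed
    ultimately show ?case by blast
  qed
  from this[of "T - 1"] show ?thesis unfolding worst_scenario_def by auto
qed

lemma expected_error_le:
  assumes "worst_scenario \<Gamma> s" "t \<in> {1..T-1}"
  shows "expected_value t (Q (Suc t)) (forward \<Gamma> s t) - expected_value t (\<Gamma> (Suc t)) (forward \<Gamma> s t)
      \<le> path_error \<Gamma> s t"
  using assms by (simp add: worst_scenario_def)

end

section \<open>Cuts and models\<close>

lemma last_visit_less:
  assumes "last_visit z k < k"
  shows "1 \<le> last_visit z k" "z (last_visit z k) = z k"
    and "\<And>j. last_visit z k < j \<Longrightarrow> j < k \<Longrightarrow> z j \<noteq> z k"
proof -
  let ?S = "{j \<in> {1..<k}. z j = z k}"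
  have ne: "?S \<noteq> {}" and eq: "last_visit z k = Max ?S"
    using assms by (auto simp: last_visit_def split: if_splits)
  have "Max ?S \<in> ?S" using ne by (intro Max_in) auto
  then show "1 \<le> last_visit z k" "z (last_visit z k) = z k" unfolding eq by auto
  show "z j \<noteq> z k" if "last_visit z k < j" "j < k" for j
  proof
    assume "z j = z k"
    then have "j \<le> Max ?S"
      using that \<open>1 \<le> last_visit z k\<close> by (intro Max_ge) auto
    then show False using that eq by simp
  qed
qed

lemma last_visit_le: "last_visit z k \<le> k"
proof (cases "\<exists>j\<in>{1..<k}. z j = z k")
  case True
  then have "Max {j \<in> {1..<k}. z j = z k} \<in> {j \<in> {1..<k}. z j = z k}" by (intro Max_in) auto
  then show ?thesis using True by (simp add: last_visit_def)
qed (simp add: last_visit_def)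

lemma last_visit_ge:
  assumes "1 \<le> j" "j < k" "z j = z k"
  shows "j \<le> last_visit z k" "last_visit z k < k"
proof -
  have ex: "\<exists>j\<in>{1..<k}. z j = z k" using assms by auto
  then have "Max {j \<in> {1..<k}. z j = z k} \<in> {j \<in> {1..<k}. z j = z k}" by (intro Max_in) auto
  then show "last_visit z k < k" using ex by (simp add: last_visit_def)
  show "j \<le> last_visit z k"
    unfolding last_visit_def using assms ex by (auto intro: Max_ge)
qed

lemma last_visit_cong:
  assumes "1 \<le> k" "\<And>j. j \<in> {1..k} \<Longrightarrow> z j = z' j"
  shows "last_visit z k = last_visit z' k"
proof -
  have "{j \<in> {1..<k}. z j = z k} = {j \<in> {1..<k}. z' j = z' k}" using assms by auto
  moreover have "(\<exists>j\<in>{1..<k}. z j = z k) = (\<exists>j\<in>{1..<k}. z' j = z' k)" using assms by auto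
  ultimately show ?thesis by (simp add: last_visit_def)
qed

context bsddp
begin

text \<open>The subgradient lies in \<open>E t\<close>, so the subgradient inequality at \<open>y + s\<close> bounds its norm by the
  Lipschitz constant.\<close>

lemma subgradient_lower_bound:
  assumes "t \<in> {1..T-1}" "\<omega> \<in> \<Xi> (Suc t)" "convex_on (E (Suc t)) \<phi>" "y \<in> X t" "x \<in> E t"
  shows "- (M t * norm (x - y)) \<le> oracl k t \<omega> \<phi> y \<bullet> (x - y)"
proof -
  let ?s = "oracl k t \<omega> \<phi> y"
  have sub: "?s \<in> E t" "\<And>y'. y' \<in> E t \<Longrightarrow> stage_value t \<phi> y \<omega> + ?s \<bullet> (y' - y) \<le> stage_value t \<phi> y' \<omega>"
    using oracle_subgradient[OF assms(1-4), of k] by (auto simp: subdifferential_def)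
  have y: "y \<in> E t" using assms(4) X_subset stage_ranges(1)[OF assms(1)] by blast
  have "y + ?s \<in> E t" using sub(1) y subspace_E[OF stage_ranges(1)[OF assms(1)]]
    by (simp add: subspace_add)
  then have "?s \<bullet> ?s \<le> M t * norm ?s"
    using sub(2)[of "y + ?s"] stage_value_lipschitz[OF assms(1-3), of "y + ?s" y] y by simp
  then have "norm ?s \<le> M t"
    using M_pos[OF assms(1)] by (cases "?s = 0") (auto simp: power2_norm_eq_inner[symmetric] power2_eq_square)
  then have "norm ?s * norm (x - y) \<le> M t * norm (x - y)" by (rule mult_right_mono) simp
  moreover have "\<bar>?s \<bullet> (x - y)\<bar> \<le> norm ?s * norm (x - y)" by (rule Cauchy_Schwarz_ineq2)
  ultimately show ?thesis by linarith
qed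

lemma cut:
  assumes "t \<in> {1..T-1}" "convex_on (E (Suc t)) \<phi>" "y \<in> X t"
  shows cut_le: "\<And>x. x \<in> E t \<Longrightarrow> cut k t \<phi> y x \<le> expected_value t \<phi> x"
    and cut_ge: "\<And>x. x \<in> E t \<Longrightarrow> expected_value t \<phi> y \<le> cut k t \<phi> y x + M t * norm (x - y)"
    and cut_convex: "convex_on (E t) (cut k t \<phi> y)"
proof -
  fix x assume x: "x \<in> E t"
  have "cut k t \<phi> y x \<le> xi_mean t (stage_value t \<phi> x) + 0"
    unfolding cut_def
    by (rule xi_mean_mono_shift[OF assms(1)])
      (use oracle_subgradient[OF assms(1) _ assms(2,3)] x in \<open>auto simp: subdifferential_def\<close>)
  then show "cut k t \<phi> y x \<le> expected_value t \<phi> x" by (simp add: expected_value_def)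
  show "expected_value t \<phi> y \<le> cut k t \<phi> y x + M t * norm (x - y)"
    unfolding cut_def expected_value_def
  proof (rule xi_mean_mono_shift[OF assms(1)])
    fix \<omega> assume "\<omega> \<in> \<Xi> (Suc t)"
    from subgradient_lower_bound[OF assms(1) this assms(2,3) x, of k]
    show "stage_value t \<phi> y \<omega>
      \<le> stage_value t \<phi> y \<omega> + oracl k t \<omega> \<phi> y \<bullet> (x - y) + M t * norm (x - y)" by simp
  qed
next
  show "convex_on (E t) (cut k t \<phi> y)"
    unfolding cut_def
  proof (rule xi_mean_convex[OF assms(1)], rule convex_onI)
    fix \<omega> c x x'
    let ?s = "oracl k t \<omega> \<phi> y" and ?v = "stage_value t \<phi> y \<omega>"
    show "?v + ?s \<bullet> ((1 - c) *\<^sub>R x + c *\<^sub>R x' - y)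
      \<le> (1 - c) * (?v + ?s \<bullet> (x - y)) + c * (?v + ?s \<bullet> (x' - y))"
      by (simp add: inner_diff_right inner_add_right algebra_simps)
  qed (use subspace_E[OF stage_ranges(1)[OF assms(1)]] subspace_imp_convex in auto)
qed

lemma convex_on_max:
  assumes "convex_on S f" "convex_on S g"
  shows "convex_on S (\<lambda>x. max (f x) (g x))"
proof (rule convex_onI)
  fix t :: real and x y assume t: "0 < t" "t < 1" "x \<in> S" "y \<in> S"
  have "(1 - t) * f x \<le> (1 - t) * max (f x) (g x)" "t * f y \<le> t * max (f y) (g y)"
    "(1 - t) * g x \<le> (1 - t) * max (f x) (g x)" "t * g y \<le> t * max (f y) (g y)"
    using t by (auto intro!: mult_left_mono)
  then show "max (f ((1 - t) *\<^sub>R x + t *\<^sub>R y)) (g ((1 - t) *\<^sub>R x + t *\<^sub>R y))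
    \<le> (1 - t) * max (f x) (g x) + t * max (f y) (g y)"
    using convex_onD[OF assms(1), of t x y] convex_onD[OF assms(2), of t x y] t
    by (simp add: add_mono order_trans)
qed (use assms in \<open>simp add: convex_on_def\<close>)

lemma backward_step:
  "t < T \<Longrightarrow> backward k \<Gamma> y t = (\<lambda>x. max (\<Gamma> t x) (cut k t (backward k \<Gamma> y (Suc t)) (y t) x))"
  "T \<le> t \<Longrightarrow> backward k \<Gamma> y t = (\<lambda>x. 0)"
  unfolding backward_def by (subst backward_rec.simps, simp)+

lemma backward_valid:
  assumes "convex_model \<Gamma>" "model_le \<Gamma> Q" "\<And>t. t \<in> {1..T-1} \<Longrightarrow> y t \<in> X t"
  shows "t \<in> {1..T} \<Longrightarrow> convex_on (E t) (backward k \<Gamma> y t)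
    \<and> (\<forall>x\<in>E t. backward k \<Gamma> y t x \<le> Q t x)"
proof (induction "T - t" arbitrary: t)
  case 0
  then show ?case using convex_on_zero[of t] by (simp add: backward_step Q_last)
next
  case (Suc n)
  then have t: "t < T" "t \<in> {1..T-1}" by auto
  note t' = stage_ranges[OF t(2)]
  have IH: "convex_on (E (Suc t)) (backward k \<Gamma> y (Suc t))"
    "\<forall>x\<in>E (Suc t). backward k \<Gamma> y (Suc t) x \<le> Q (Suc t) x"
    using Suc t by auto
  let ?c = "cut k t (backward k \<Gamma> y (Suc t)) (y t)"
  have "convex_on (E t) (\<lambda>x. max (\<Gamma> t x) (?c x))"
    by (intro convex_on_max convex_modelD(1)[OF assms(1) t'(1)]
        cut_convex[OF t(2) IH(1) assms(3)[OF t(2)]])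
  moreover have "max (\<Gamma> t x) (?c x) \<le> Q t x" if "x \<in> E t" for x
  proof -
    have "?c x \<le> expected_value t (backward k \<Gamma> y (Suc t)) x"
      by (rule cut_le[OF t(2) IH(1) assms(3)[OF t(2)] that])
    also have "\<dots> \<le> expected_value t (Q (Suc t)) x + 0"
      by (rule expected_value_le_shift[OF t(2) IH(1) convex_modelD(2)[OF convex_model_Q t(2)] that])
        (use IH(2) X_subset[OF t'(3)] in auto)
    finally have "?c x \<le> Q t x" using Q_step[OF t(1)] by simp
    moreover have "\<Gamma> t x \<le> Q t x" using assms(2) that t'(1) unfolding model_le_def by blast
    ultimately show ?thesis by simp
  qed
  ultimately show ?case using t by (simp add: backward_step)
qed

text \<open>Only the scenarios from iteration \<open>1\<close> on are sampled; \<open>z 0\<close> is arbitrary.\<close>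

definition sampled :: "(nat \<Rightarrow> nat \<Rightarrow> 'o) \<Rightarrow> bool"
  where "sampled z \<longleftrightarrow> (\<forall>k\<ge>1. z k \<in> scenarios)"

lemma sampledD: "sampled z \<Longrightarrow> 1 \<le> k \<Longrightarrow> z k \<in> scenarios"
  by (simp add: sampled_def)

lemma model_init: "k \<le> 1 \<Longrightarrow> model z k = (\<lambda>t. if t < T then \<Gamma>\<^sub>1 t else (\<lambda>x. 0))"
  unfolding model_def by (subst revisit_rec.simps) simp

lemma model_new: "last_visit z k = k \<Longrightarrow> 1 < k \<Longrightarrow> model z k = model z (k - 1)"
  unfolding model_def by (subst revisit_rec.simps) simp

lemma model_revisit:
  assumes "last_visit z k < k"
  shows "model z k = backward k (model z (k - 1)) (decision z (last_visit z k))"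
proof -
  have "1 < k" using assms last_visit_less(1)[OF assms] by simp
  then show ?thesis
    unfolding decision_def unfolding model_def using assms
    by (subst revisit_rec.simps) simp
qed

lemma model_last: "T \<le> t \<Longrightarrow> model z k t = (\<lambda>x. 0)"
proof (induction k rule: less_induct)
  case (less k)
  consider "k \<le> 1" | "1 < k" "last_visit z k = k" | "last_visit z k < k"
    using last_visit_le[of z k] by linarith
  then show ?case
    by cases (use less in \<open>auto simp: model_init model_new model_revisit backward_step\<close>)
qed

lemma model_valid:
  assumes z: "sampled z"
  shows "convex_model (model z k) \<and> model_le (model z k) Q"
proof (induction k rule: less_induct)
  case (less k)
  consider "k \<le> 1" | "1 < k" "last_visit z k = k" | "last_visit z k < k"
    using last_visit_le[of z k] by linarith
  then show ?case
  proof cases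
    case 1
    then show ?thesis
      using init_convex init_le convex_on_zero
      by (auto simp: convex_model_def model_le_def model_init Q_last)
  next
    case 2
    then show ?thesis using less[of "k - 1"] by (simp add: model_new)
  next
    case 3
    let ?l = "last_visit z k"
    have l: "1 \<le> ?l" by (rule last_visit_less(1)[OF 3])
    have dec: "decision z ?l t \<in> X t" if "t \<in> {1..T-1}" for t
      unfolding decision_def
      by (rule forward_in) (use less[OF 3] sampledD[OF z l] that in auto)
    have "k - 1 < k" using 3 by simp
    with backward_valid[of "model z (k - 1)" "decision z ?l", OF _ _ dec] less[of "k - 1"]
    show ?thesis
      unfolding model_revisit[OF 3] by (simp add: convex_model_def model_le_def)
  qed
qed

lemmas model_convex = model_valid[THEN conjunct1]
  and model_le_Q = model_valid[THEN conjunct2]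

lemma model_le_Suc:
  "model_le (model z k) (model z (Suc k))"
proof -
  consider "Suc k \<le> 1" | "1 < Suc k" "last_visit z (Suc k) = Suc k" | "last_visit z (Suc k) < Suc k"
    using last_visit_le[of z "Suc k"] by linarith
  then show ?thesis
  proof cases
    case 1 then show ?thesis by (simp add: model_init model_le_refl)
  next
    case 2 then show ?thesis by (simp add: model_new model_le_refl)
  next
    case 3
    show ?thesis unfolding model_le_def
    proof (intro ballI)
      fix t x assume t: "t \<in> {1..T}" "x \<in> E t"
      show "model z k t x \<le> model z (Suc k) t x"
      proof (cases "t < T")
        case True
        then show ?thesis using 3 by (simp add: model_revisit backward_step)
      qed (simp add: model_last)
    qed
  qed
qed

lemma model_mono: "j \<le> k \<Longrightarrow> model_le (model z j) (model z k)"
  by (induction k rule: dec_induct) (auto intro: model_le_refl model_le_trans model_le_Suc)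

lemma decision_in:
  assumes "sampled z" "1 \<le> k" "t \<in> {1..T}"
  shows "decision z k t \<in> X t"
  unfolding decision_def
  by (rule forward_in[OF model_convex[OF assms(1)] sampledD[OF assms(1,2)] assms(3)])

text \<open>The model lies above its newest cut, whose value at the query point is that of \<open>\<V>\<^sub>t\<^sup>k\<close>.\<close>

lemma model_revisit_ge:
  assumes "sampled z" "last_visit z k < k" "t \<in> {1..T-1}" "x \<in> E t"
  shows "expected_value t (model z k (Suc t)) (decision z (last_visit z k) t)
    \<le> model z k t x + M t * norm (x - decision z (last_visit z k) t)"
proof -
  let ?y = "decision z (last_visit z k)"
  have t: "t < T" "t \<in> {1..T}" "Suc t \<in> {1..T}" using assms(3) by auto
  have "expected_value t (model z k (Suc t)) (?y t)
    \<le> cut k t (model z k (Suc t)) (?y t) x + M t * norm (x - ?y t)"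
    by (intro cut_ge assms(3,4) convex_modelD(2)[OF model_convex[OF assms(1)] assms(3)]
        decision_in[OF assms(1) last_visit_less(1)[OF assms(2)] t(2)])
  also have "cut k t (model z k (Suc t)) (?y t) x \<le> model z k t x"
    using t(1) model_revisit[OF assms(2)] backward_step(1)[OF t(1)] by simp
  finally show ?thesis by simp
qed

end

section \<open>Damping parameters and weights\<close>

text \<open>The parameters \<open>\<delta>\<^sub>t\<close> solve \<open>\<delta>\<^sub>t = \<epsilon> \<delta>\<^bsub>t+1\<^esub>\<^sup>2/2\<close> with \<open>\<delta>\<^sub>T = 2\<close>, except that \<open>\<delta>\<^sub>1\<close> is half of this solution and
  thereby the parameter of the averaging, \<open>\<tau> = 1/(1 + \<delta>\<^sub>1)\<close>. The factor \<open>2\<close> of the later stages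
  balances the costs of the stages; with the factor \<open>1\<close> those for \<open>T = 3\<close> would be too large.\<close>

definition damping :: "real \<Rightarrow> nat \<Rightarrow> nat \<Rightarrow> real"
  where "damping \<epsilon> T t = (if t = 1 then 1 else 2) * \<epsilon> ^ (2 ^ (T - t) - 1)"

lemma damping_pos: "0 < \<epsilon> \<Longrightarrow> 0 < damping \<epsilon> T t"
  by (simp add: damping_def)

lemma damping_square:
  assumes "1 \<le> t" "t < T"
  shows "damping \<epsilon> T t = (if t = 1 then 1 / 4 else 1 / 2) * \<epsilon> * (damping \<epsilon> T (Suc t))\<^sup>2"
proof -
  define e where "e = (2::nat) ^ (T - Suc t) - 1"
  have "(2::nat) ^ (T - t) = 2 * 2 ^ (T - Suc t)"
    using assms(2) by (metis Suc_diff_Suc power_Suc)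
  moreover have "(2::nat) ^ (T - Suc t) = Suc e" by (simp add: e_def)
  ultimately have "(2::nat) ^ (T - t) - 1 = Suc (e + e)" by simp
  moreover have "2 ^ (T - Suc t) - Suc 0 = e" by (simp add: e_def)
  ultimately show ?thesis using assms(1)
    by (cases "t = 1") (simp_all add: damping_def power_add power2_eq_square)
qed

lemma damping_le_one:
  assumes "0 < \<epsilon>" "\<epsilon> < 1 / 2" and t: "2 \<le> t" "t < T"
  shows "damping \<epsilon> T t \<le> 1"
proof -
  have "(2::nat) ^ 1 \<le> 2 ^ (T - t)" using t by (intro power_increasing) auto
  then have "1 \<le> (2::nat) ^ (T - t) - 1" by simp
  then have "\<epsilon> ^ (2 ^ (T - t) - 1) \<le> \<epsilon> ^ 1" using assms by (intro power_decreasing) auto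
  then show ?thesis using t assms by (simp add: damping_def)
qed

lemma damping_antimono:
  assumes "0 < \<epsilon>" "\<epsilon> < 1 / 2" "2 \<le> s" "s \<le> t"
  shows "damping \<epsilon> T s \<le> damping \<epsilon> T t"
proof -
  have "(2::nat) ^ (T - t) \<le> 2 ^ (T - s)" using assms by (intro power_increasing) auto
  then have "2 ^ (T - t) - 1 \<le> (2::nat) ^ (T - s) - 1" by (rule diff_le_mono)
  then have "\<epsilon> ^ (2 ^ (T - s) - 1) \<le> \<epsilon> ^ (2 ^ (T - t) - 1)"
    using assms by (intro power_decreasing) auto
  then show ?thesis using assms by (simp add: damping_def)
qed

text \<open>The maximum over the two moves \<open>\<alpha>, \<beta>\<close> of the terms of stage \<open>t\<close> in the weighted sum, in units of
  \<open>M\<^sub>t\<^sup>2/\<mu>\<^sub>t\<close>; see \<open>linear_minus_squares_le_stage_cost\<close>. The last stage \<open>n = T - 1\<close> with a nontrivial model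
  has no successor that contributes.\<close>

definition stage_cost :: "(nat \<Rightarrow> real) \<Rightarrow> (nat \<Rightarrow> real) \<Rightarrow> nat \<Rightarrow> nat \<Rightarrow> real"
  where "stage_cost \<delta> c n t = (if t = n then 4 * c n * \<delta> n
    else \<delta> t / (2 * c t) * ((4 * c t + 2 * c (Suc t) / \<delta> (Suc t))\<^sup>2 + (2 * c t + 2 * c (Suc t) / \<delta> (Suc t))\<^sup>2))"

text \<open>With these increments the weighted sum of the errors contracts at least as fast as the gap
  does. They also add up: the total weight of the errors, times \<open>\<delta>\<^sub>1\<close>, is at most \<open>c n - 1\<close>.\<close>

definition weights :: "(nat \<Rightarrow> real) \<Rightarrow> nat \<Rightarrow> (nat \<Rightarrow> real) \<Rightarrow> bool"
  where "weights \<delta> n c \<longleftrightarrow> c 1 = 1 \<and> (\<forall>t\<in>{1..n}. 1 \<le> c t) \<and>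
    (\<forall>t\<in>{1..<n}. \<delta> 1 * (c t + c (Suc t) / \<delta> (Suc t)) \<le> c (Suc t) - c t)"

text \<open>The quotient \<open>\<delta>\<^sub>t/\<delta>\<^bsub>t+1\<^esub>\<^sup>2\<close> made visible; for the damping parameters it is \<open>\<epsilon>/2\<close> or, at stage \<open>1\<close>, \<open>\<epsilon>/4\<close>.\<close>

lemma stage_cost_eq:
  assumes "t \<noteq> n" "\<delta> (Suc t) \<noteq> 0"
  shows "stage_cost \<delta> c n t = 2 * (\<delta> t / (\<delta> (Suc t))\<^sup>2) / c t *
    ((2 * c t * \<delta> (Suc t) + c (Suc t))\<^sup>2 + (c t * \<delta> (Suc t) + c (Suc t))\<^sup>2)"
proof -
  let ?d = "\<delta> (Suc t)"
  have lin: "4 * c t + 2 * c (Suc t) / ?d = 2 / ?d * (2 * c t * ?d + c (Suc t))"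
    "2 * c t + 2 * c (Suc t) / ?d = 2 / ?d * (c t * ?d + c (Suc t))"
    using assms(2) by (simp_all add: field_simps)
  have quad: "\<delta> t / (2 * c t) * ((2 / ?d * x)\<^sup>2 + (2 / ?d * y)\<^sup>2)
    = 2 * (\<delta> t / ?d\<^sup>2) / c t * (x\<^sup>2 + y\<^sup>2)" for x y
    using assms(2)
    by (cases "c t = 0") (simp_all add: power_mult_distrib power_divide field_simps)
  show ?thesis unfolding stage_cost_def if_not_P[OF assms(1)] lin by (rule quad)
qed

lemma stage_cost_le:
  assumes "0 < \<epsilon>" "1 \<le> t" "t < n" and c: "1 \<le> c t" "c t \<le> C" "0 \<le> c (Suc t)" "c (Suc t) \<le> C"
    and d: "damping \<epsilon> (Suc n) (Suc t) \<le> d"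
  shows "stage_cost (damping \<epsilon> (Suc n)) c n t
    \<le> (if t = 1 then 1 / 2 else 1) * \<epsilon> * C\<^sup>2 * ((2 * d + 1)\<^sup>2 + (d + 1)\<^sup>2)"
proof -
  define d' where "d' = damping \<epsilon> (Suc n) (Suc t)"
  define r :: real where "r = (if t = 1 then 1 / 2 else 1) * \<epsilon>"
  have d': "0 < d'" using assms(1) by (simp add: d'_def damping_pos)
  have r: "0 < r" using assms(1) by (simp add: r_def)
  have quot: "2 * (damping \<epsilon> (Suc n) t / d'\<^sup>2) = r"
    using damping_square[of t "Suc n" \<epsilon>] assms(2,3) d' by (simp add: d'_def[symmetric] r_def)
  have *: "(2 * c t * d' + c (Suc t))\<^sup>2 \<le> (C * (2 * d + 1))\<^sup>2"
    "(c t * d' + c (Suc t))\<^sup>2 \<le> (C * (d + 1))\<^sup>2"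
  proof -
    have "c t * d' \<le> C * d" using c d d' by (intro mult_mono) (auto simp: d'_def)
    moreover have "0 \<le> c t * d'" using c d' by simp
    ultimately show "(2 * c t * d' + c (Suc t))\<^sup>2 \<le> (C * (2 * d + 1))\<^sup>2"
      "(c t * d' + c (Suc t))\<^sup>2 \<le> (C * (d + 1))\<^sup>2"
      using c by (auto intro!: power_mono simp: algebra_simps)
  qed
  have "stage_cost (damping \<epsilon> (Suc n)) c n t
    = r / c t * ((2 * c t * d' + c (Suc t))\<^sup>2 + (c t * d' + c (Suc t))\<^sup>2)"
    unfolding quot[symmetric] d'_def
    by (rule stage_cost_eq) (use assms(3) d' in \<open>auto simp: d'_def\<close>)
  also have "\<dots> \<le> r * ((C * (2 * d + 1))\<^sup>2 + (C * (d + 1))\<^sup>2)"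
    using * r c(1) by (intro mult_mono add_mono) (auto simp: field_simps)
  finally show ?thesis
    unfolding r_def[symmetric] power_mult_distrib by (simp add: mult.assoc flip: distrib_left)
qed

text \<open>The tolerance is shared between the additive constant of the contraction, a fraction
  \<open>\<kappa>/40\<close>, and what remains of the initial potential after the contractions, a fraction
  \<open>c n (1 + \<delta>\<^sub>1)/2\<close>. The room is small for \<open>T = 3\<close> and \<open>\<epsilon>\<close> near \<open>1/2\<close>, and estimates good enough there are not
  uniform in \<open>T\<close>; hence three cases.\<close>

lemma weights_exist_two_stages:
  assumes \<epsilon>: "0 < \<epsilon>" "\<epsilon> < 1 / 2"
  shows "\<exists>c \<kappa>. weights (damping \<epsilon> 2) 1 c \<and> stage_cost (damping \<epsilon> 2) c 1 1 \<le> \<kappa> * \<epsilon>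
    \<and> \<kappa> / 40 + c 1 * (1 + damping \<epsilon> 2 1) / 2 \<le> 1"
  by (rule exI[of _ "\<lambda>_. 1"], rule exI[of _ 4])
    (use \<epsilon> in \<open>auto simp: weights_def stage_cost_def damping_def field_simps\<close>)

lemma weights_exist_three_stages:
  assumes \<epsilon>: "0 < \<epsilon>" "\<epsilon> < 1 / 2"
  shows "\<exists>c \<kappa>. weights (damping \<epsilon> 3) 2 c \<and> (\<forall>t\<in>{1..2}. stage_cost (damping \<epsilon> 3) c 2 t \<le> \<kappa> * \<epsilon>)
    \<and> \<kappa> / 40 + c 2 * (1 + damping \<epsilon> 3 1) / 2 \<le> 1"
proof -
  (* 9/7 is the least admissible weight for \<epsilon> = 1/2. *)
  define c :: "nat \<Rightarrow> real" where "c t = (if t = 1 then 1 else 9 / 7)" for t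
  have d: "damping \<epsilon> 3 1 = \<epsilon> ^ 3" "damping \<epsilon> 3 2 = 2 * \<epsilon>"
    by (simp_all add: damping_def)
  have sq: "\<epsilon>\<^sup>2 \<le> 1 / 4" using power_mono[of \<epsilon> "1/2" 2] \<epsilon> by (simp add: power2_eq_square)
  have cu: "\<epsilon> ^ 3 \<le> 1 / 8" using power_mono[of \<epsilon> "1/2" 3] \<epsilon> by (simp add: power3_eq_cube)
  have "\<epsilon> ^ 3 * (1 + 9 / 7 / (2 * \<epsilon>)) = \<epsilon> ^ 3 + 9 / 14 * \<epsilon>\<^sup>2"
    using \<epsilon> by (simp add: field_simps power3_eq_cube power2_eq_square)
  also have "\<dots> \<le> 9 / 7 - 1" using sq cu by simp
  finally have "damping \<epsilon> 3 1 * (c 1 + c (Suc 1) / damping \<epsilon> 3 (Suc 1)) \<le> c (Suc 1) - c 1"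
    unfolding numeral_2_eq_2[symmetric] One_nat_def[symmetric] Suc_1 d by (simp add: c_def)
  moreover have "{1..<2::nat} = {1}" by auto
  ultimately have "weights (damping \<epsilon> 3) 2 c"
    unfolding weights_def by (auto simp: c_def)
  moreover have "stage_cost (damping \<epsilon> 3) c 2 t \<le> 72 / 7 * \<epsilon>" if "t \<in> {1..2}" for t
  proof -
    have "t = 1 \<or> t = 2" using that by auto
    then consider "t = 1" | "t = 2" by blast
    then show ?thesis
    proof cases
      case 1
      have "stage_cost (damping \<epsilon> 3) c 2 1
        = \<epsilon> / 2 * ((4 * \<epsilon> + 9 / 7)\<^sup>2 + (2 * \<epsilon> + 9 / 7)\<^sup>2)"
        using stage_cost_eq[of 1 2 "damping \<epsilon> 3" c] \<epsilon> d
        by (simp add: c_def numeral_2_eq_2[symmetric] power3_eq_cube power2_eq_square)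
      also have "\<dots> \<le> \<epsilon> / 2 * ((4 * (1 / 2) + 9 / 7)\<^sup>2 + (2 * (1 / 2) + 9 / 7)\<^sup>2)"
        using \<epsilon> by (intro mult_left_mono add_mono power_mono) auto
      also have "\<dots> \<le> 72 / 7 * \<epsilon>" using \<epsilon> by (simp add: power2_eq_square)
      finally show ?thesis using 1 by simp
    next
      case 2
      then show ?thesis by (simp add: stage_cost_def c_def d)
    qed
  qed
  moreover have "72 / 7 / 40 + c 2 * (1 + damping \<epsilon> 3 1) / 2 \<le> 1"
    unfolding d c_def using cu by (simp add: field_simps)
  ultimately show ?thesis by blast
qed

lemma le_two_power_two_power: "2 \<le> m \<Longrightarrow> 8 * m \<le> (2::nat) ^ 2 ^ m"
proof -
  assume m: "2 \<le> m"
  have "2 * m \<le> (2::nat) ^ m"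
    using m by (induction m rule: dec_induct) auto
  have two: "m + 2 \<le> (2::nat) ^ m"
    using m by (induction m rule: dec_induct) auto
  have "8 * m \<le> 4 * (2::nat) ^ m" using \<open>2 * m \<le> 2 ^ m\<close> by simp
  also have "\<dots> = 2 ^ (m + 2)" by simp
  also have "\<dots> \<le> 2 ^ 2 ^ m" using two by (intro power_increasing) auto
  finally show ?thesis .
qed

lemma weights_exist_many_stages:
  assumes \<epsilon>: "0 < \<epsilon>" "\<epsilon> < 1 / 2" and n: "3 \<le> n"
  shows "\<exists>c \<kappa>. weights (damping \<epsilon> (Suc n)) n c
    \<and> (\<forall>t\<in>{1..n}. stage_cost (damping \<epsilon> (Suc n)) c n t \<le> \<kappa> * \<epsilon>)
    \<and> \<kappa> / 40 + c n * (1 + damping \<epsilon> (Suc n) 1) / 2 \<le> 1"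
proof -
  define m where "m = n - 1"
  have m: "2 \<le> m" "n = Suc m" using n by (auto simp: m_def)
  (* For T \<ge> 4 the number \<delta> 1 is so small that equal increments suffice; they add up to 1/10. *)
  define c :: "nat \<Rightarrow> real" where "c t = 1 + (real t - 1) / (10 * real m)" for t
  let ?d = "damping \<epsilon> (Suc n)"
  (* Twice the bound on \<delta> 1 / \<delta> 2, the largest of the quotients \<delta> 1 / \<delta> t. *)
  define q :: real where "q = (1 / 2) ^ 2 ^ m"
  have "8 * real m \<le> 2 ^ 2 ^ m"
    using le_two_power_two_power[OF m(1)] by (metis of_nat_le_iff of_nat_mult of_nat_numeral of_nat_power)
  then have q_m: "q * real m \<le> 1 / 8"
    by (simp add: q_def power_divide field_simps)
  have q16: "q \<le> 1 / 16"
  proof -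
    have "(2::nat) ^ 2 \<le> 2 ^ m" using m by (intro power_increasing) auto
    then have "q \<le> (1 / 2) ^ 4" unfolding q_def by (intro power_decreasing) auto
    then show ?thesis by (simp add: power_divide)
  qed
  have q0: "0 < q" by (simp add: q_def)
  have c_bounds: "1 \<le> c t" "c t \<le> 11 / 10" if "t \<in> {1..n}" for t
    using that m by (auto simp: c_def field_simps)
  have \<epsilon>q: "\<epsilon> ^ 2 ^ m \<le> q" unfolding q_def using \<epsilon> by (intro power_mono) auto
  have exps: "(2::nat) ^ n - 1 = 2 ^ m + (2 ^ m - 1)" "(1::nat) \<le> 2 ^ m" by (simp_all add: m(2))
  have d1: "?d 1 = \<epsilon> ^ 2 ^ m / 2 * ?d 2"
  proof -
    have "?d 1 = \<epsilon> ^ (2 ^ n - 1)" by (simp add: damping_def)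
    also have "\<dots> = \<epsilon> ^ 2 ^ m * \<epsilon> ^ (2 ^ m - 1)" unfolding exps(1) by (rule power_add)
    also have "\<dots> = \<epsilon> ^ 2 ^ m / 2 * ?d 2" using m by (simp add: damping_def)
    finally show ?thesis .
  qed
  have d2: "?d 2 \<le> 4 * q"
  proof -
    have "\<epsilon> ^ (2 ^ m - 1) \<le> (1 / 2) ^ (2 ^ m - 1)" using \<epsilon> by (intro power_mono) auto
    also have "(1 / 2 :: real) ^ (2 ^ m - 1) = 2 * q"
      using exps(2) by (simp add: q_def power_diff)
    finally show ?thesis using m by (simp add: damping_def numeral_2_eq_2[symmetric] Suc_diff_le)
  qed
  have dpos: "0 < ?d t" for t using \<epsilon> by (simp add: damping_pos)
  have d1_le: "?d 1 \<le> q / 2 * (4 * q)"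
    unfolding d1 using \<epsilon>q d2 dpos[of 2] q0 by (intro mult_mono) auto
  have d1_q: "?d 1 \<le> q / 8"
  proof -
    have "q / 2 * (4 * q) = q * (2 * q)" by simp
    also have "\<dots> \<le> q * (1 / 8)" using q16 q0 by (intro mult_left_mono) auto
    finally show ?thesis using d1_le by simp
  qed
  have "weights ?d n c"
    unfolding weights_def
  proof (intro conjI ballI)
    show "c 1 = 1" by (simp add: c_def)
    show "1 \<le> c t" if "t \<in> {1..n}" for t using c_bounds that by blast
    fix t assume t: "t \<in> {1..<n}"
    then have ct: "1 \<le> c t" "c t \<le> 11 / 10" "1 \<le> c (Suc t)" "c (Suc t) \<le> 11 / 10"
      using c_bounds by auto
    have "?d 2 \<le> ?d (Suc t)" using t by (intro damping_antimono \<epsilon>) auto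
    then have "?d 1 / ?d (Suc t) \<le> ?d 1 / ?d 2" using dpos by (intro divide_left_mono) (auto simp: less_imp_le)
    also have "\<dots> \<le> q / 2" unfolding d1 using dpos[of 2] \<epsilon>q by simp
    finally have quot: "?d 1 / ?d (Suc t) \<le> q / 2" .
    have "?d 1 * (c t + c (Suc t) / ?d (Suc t)) = ?d 1 * c t + c (Suc t) * (?d 1 / ?d (Suc t))"
      by (simp add: algebra_simps)
    also have "\<dots> \<le> q / 8 * (11 / 10) + 11 / 10 * (q / 2)"
      using d1_q quot ct dpos q0 by (intro add_mono mult_mono) (auto simp: less_imp_le)
    also have "\<dots> = 11 / 16 * q" by simp
    also have "\<dots> \<le> 1 / (10 * real m)"
      using q_m m by (simp add: field_simps)
    also have "\<dots> = c (Suc t) - c t" by (simp add: c_def add_divide_distrib diff_divide_distrib)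
    finally show "?d 1 * (c t + c (Suc t) / ?d (Suc t)) \<le> c (Suc t) - c t" .
  qed
  moreover have "stage_cost ?d c n t \<le> 16 * \<epsilon>" if t: "t \<in> {1..n}" for t
  proof (cases "t = n")
    case True
    then have "stage_cost ?d c n t = 8 * c n * \<epsilon>" using n by (simp add: stage_cost_def damping_def)
    then show ?thesis using c_bounds[of n] n \<epsilon> by simp
  next
    case False
    have "stage_cost ?d c n t \<le> (if t = 1 then 1 / 2 else 1) * \<epsilon> * (11 / 10)\<^sup>2 * ((2 * 1 + 1)\<^sup>2 + (1 + 1)\<^sup>2)"
      using t False c_bounds[of t] c_bounds[of "Suc t"] damping_le_one[OF \<epsilon>, of "Suc t" "Suc n"]
      by (intro stage_cost_le \<epsilon>) auto
    also have "\<dots> \<le> 16 * \<epsilon>" using \<epsilon> by (simp add: power2_eq_square)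
    finally show ?thesis .
  qed
  moreover have "16 / 40 + c n * (1 + ?d 1) / 2 \<le> 1"
  proof -
    have "?d 1 \<le> 1 / 128" using d1_q q16 by simp
    then have "c n * (1 + ?d 1) \<le> 11 / 10 * (1 + 1 / 128)"
      using c_bounds[of n] n dpos[of 1] by (intro mult_mono) auto
    then show ?thesis by simp
  qed
  ultimately show ?thesis by blast
qed

lemma weights_exist:
  assumes \<epsilon>: "0 < \<epsilon>" "\<epsilon> < 1 / 2" and n: "1 \<le> n"
  shows "\<exists>c \<kappa>. weights (damping \<epsilon> (Suc n)) n c
    \<and> (\<forall>t\<in>{1..n}. stage_cost (damping \<epsilon> (Suc n)) c n t \<le> \<kappa> * \<epsilon>)
    \<and> \<kappa> / 40 + c n * (1 + damping \<epsilon> (Suc n) 1) / 2 \<le> 1"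
proof -
  consider "n = 1" | "n = 2" | "3 \<le> n" using n by linarith
  then show ?thesis
  proof cases
    case 1 then show ?thesis using weights_exist_two_stages[OF \<epsilon>] by (simp add: numeral_2_eq_2)
  next
    case 2 then show ?thesis using weights_exist_three_stages[OF \<epsilon>] by (simp add: numeral_3_eq_3)
  next
    case 3 then show ?thesis by (rule weights_exist_many_stages[OF \<epsilon>])
  qed
qed

lemma weighted_sum_le:
  assumes "weights \<delta> n c" "1 \<le> n"
  shows "\<delta> 1 * (\<Sum>t=1..<n. c t + c (Suc t) / \<delta> (Suc t)) \<le> c n - 1"
proof -
  have "\<delta> 1 * (\<Sum>t=1..<n. c t + c (Suc t) / \<delta> (Suc t)) \<le> (\<Sum>t=1..<n. c (Suc t) - c t)"
    unfolding sum_distrib_left by (intro sum_mono) (use assms in \<open>auto simp: weights_def\<close>)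
  also have "\<dots> = c n - c 1" using sum_Suc_diff'[of 1 n c] assms(2) by simp
  finally show ?thesis using assms(1) by (simp add: weights_def)
qed

section \<open>Contraction at a revisit\<close>

lemma quadratic_upper_bound:
  fixes a q x :: real
  assumes "0 < q"
  shows "a * x - q * x\<^sup>2 \<le> a\<^sup>2 / (4 * q)"
proof -
  have "0 \<le> (a - 2 * q * x)\<^sup>2" by simp
  then have "4 * q * (a * x - q * x\<^sup>2) \<le> a\<^sup>2"
    by (simp add: power2_eq_square algebra_simps)
  then show ?thesis using assms by (simp add: field_simps)
qed

text \<open>Completing the squares in \<open>\<alpha>\<close> and \<open>\<beta>\<close>.\<close>

lemma linear_minus_squares_le_stage_cost:
  fixes c \<delta> M \<mu> :: "nat \<Rightarrow> real"
  assumes pos: "0 < c t" "0 < \<delta> t" "0 < \<mu> t"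
  defines "q \<equiv> c t * \<mu> t / (2 * \<delta> t)"
  shows "t \<noteq> n \<Longrightarrow> c t * (M t * (4 * \<alpha> + 2 * \<beta>)) + c (Suc t) / \<delta> (Suc t) * (2 * M t * (\<alpha> + \<beta>))
      - q * (\<alpha>\<^sup>2 + \<beta>\<^sup>2) \<le> stage_cost \<delta> c n t * ((M t)\<^sup>2 / \<mu> t)"
    and "t = n \<Longrightarrow> c t * (2 * M t * (\<alpha> + \<beta>)) - q * (\<alpha>\<^sup>2 + \<beta>\<^sup>2)
      \<le> stage_cost \<delta> c n t * ((M t)\<^sup>2 / \<mu> t)"
proof -
  have q: "0 < q" using pos by (simp add: q_def)
  let ?r = "c (Suc t) / \<delta> (Suc t)"
  have *: "a * \<alpha> + b * \<beta> - q * (\<alpha>\<^sup>2 + \<beta>\<^sup>2) \<le> \<delta> t / (2 * c t) * (a\<^sup>2 + b\<^sup>2) / \<mu> t" for a b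
  proof -
    have "a * \<alpha> + b * \<beta> - q * (\<alpha>\<^sup>2 + \<beta>\<^sup>2) = (a * \<alpha> - q * \<alpha>\<^sup>2) + (b * \<beta> - q * \<beta>\<^sup>2)"
      by (simp add: algebra_simps)
    also have "\<dots> \<le> a\<^sup>2 / (4 * q) + b\<^sup>2 / (4 * q)"
      by (intro add_mono quadratic_upper_bound q)
    also have "\<dots> = \<delta> t / (2 * c t) * (a\<^sup>2 + b\<^sup>2) / \<mu> t"
      using pos by (simp add: q_def field_simps)
    finally show ?thesis .
  qed
  show "c t * (M t * (4 * \<alpha> + 2 * \<beta>)) + ?r * (2 * M t * (\<alpha> + \<beta>)) - q * (\<alpha>\<^sup>2 + \<beta>\<^sup>2)
      \<le> stage_cost \<delta> c n t * ((M t)\<^sup>2 / \<mu> t)" if "t \<noteq> n"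
  proof -
    have "c t * (M t * (4 * \<alpha> + 2 * \<beta>)) + ?r * (2 * M t * (\<alpha> + \<beta>)) - q * (\<alpha>\<^sup>2 + \<beta>\<^sup>2)
      = (M t * (4 * c t + 2 * ?r)) * \<alpha> + (M t * (2 * c t + 2 * ?r)) * \<beta> - q * (\<alpha>\<^sup>2 + \<beta>\<^sup>2)"
      by (simp add: algebra_simps)
    also note *[of "M t * (4 * c t + 2 * ?r)" "M t * (2 * c t + 2 * ?r)"]
    also have "\<delta> t / (2 * c t) * ((M t * a)\<^sup>2 + (M t * b)\<^sup>2) / \<mu> t
        = \<delta> t / (2 * c t) * (a\<^sup>2 + b\<^sup>2) * ((M t)\<^sup>2 / \<mu> t)" for a b
      by (simp add: power_mult_distrib flip: distrib_left)
    also have "\<delta> t / (2 * c t) * ((4 * c t + 2 * ?r)\<^sup>2 + (2 * c t + 2 * ?r)\<^sup>2) = stage_cost \<delta> c n t"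
      using that by (simp add: stage_cost_def)
    finally show ?thesis .
  qed
  show "c t * (2 * M t * (\<alpha> + \<beta>)) - q * (\<alpha>\<^sup>2 + \<beta>\<^sup>2) \<le> stage_cost \<delta> c n t * ((M t)\<^sup>2 / \<mu> t)" if "t = n"
  proof -
    have "c t * (2 * M t * (\<alpha> + \<beta>)) - q * (\<alpha>\<^sup>2 + \<beta>\<^sup>2)
      = (2 * c t * M t) * \<alpha> + (2 * c t * M t) * \<beta> - q * (\<alpha>\<^sup>2 + \<beta>\<^sup>2)"
      by (simp add: algebra_simps)
    also note *[of "2 * c t * M t" "2 * c t * M t"]
    also have "\<delta> t / (2 * c t) * ((2 * c t * M t)\<^sup>2 + (2 * c t * M t)\<^sup>2) / \<mu> t
      = stage_cost \<delta> c n t * ((M t)\<^sup>2 / \<mu> t)"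
      using that pos by (simp add: stage_cost_def power2_eq_square)
    finally show ?thesis .
  qed
qed

text \<open>Here \<open>g\<close> is the gap, \<open>e t\<close> the error of the problem of stage \<open>t + 1\<close>, \<open>A t\<close> the error of the model
  of \<open>\<Q>\<^sub>t\<close> at the new decision, and \<open>\<alpha> t, \<beta> t\<close> are the two moves of stage \<open>t\<close>; primes mark the values at
  the later visit. Each \<open>e' t\<close> has two bounds: \<open>A (Suc t)\<close>, which is small if there is no movement,
  and \<open>e t\<close> minus squares, up to a Lipschitz term, which is small if there is. The first is added with weight \<open>c (Suc t)\<close>, the
  second with weight \<open>c (Suc t) / \<delta> (Suc t)\<close>.\<close>

lemma weighted_contraction:
  fixes \<alpha> \<beta> A e e' c \<delta> M \<mu> :: "nat \<Rightarrow> real" and g g' \<kappa>\<epsilon> :: real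
  assumes n: "1 \<le> n" and w: "weights \<delta> n c"
    and \<delta>: "\<And>t. t \<in> {1..n} \<Longrightarrow> 0 < \<delta> t" and \<mu>: "\<And>t. t \<in> {1..n} \<Longrightarrow> 0 < \<mu> t"
    and cost: "\<And>t. t \<in> {1..n} \<Longrightarrow> stage_cost \<delta> c n t \<le> \<kappa>\<epsilon>"
    and e'_nonneg: "\<And>t. t \<in> {1..<n} \<Longrightarrow> 0 \<le> e' t"
    and root: "(1 + \<delta> 1) * g' + \<mu> 1 / 2 * ((\<alpha> 1)\<^sup>2 + (\<beta> 1)\<^sup>2) \<le> g + \<delta> 1 * A 1"
    and A: "\<And>t. t \<in> {1..<n} \<Longrightarrow> A t \<le> M t * (4 * \<alpha> t + 2 * \<beta> t) + e t"
    and A_last: "A n \<le> 2 * M n * (\<alpha> n + \<beta> n)"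
    and e'_A: "\<And>t. t \<in> {1..<n} \<Longrightarrow> e' t \<le> A (Suc t)"
    and e'_e: "\<And>t. t \<in> {1..<n} \<Longrightarrow> e' t + \<mu> (Suc t) / 2 * ((\<alpha> (Suc t))\<^sup>2 + (\<beta> (Suc t))\<^sup>2)
      \<le> e t + 2 * M t * (\<alpha> t + \<beta> t)"
  defines "d \<equiv> \<lambda>t. c t + c (Suc t) / \<delta> (Suc t)"
  shows "(1 + \<delta> 1) * (g' + \<delta> 1 * (\<Sum>t=1..<n. d t * e' t))
    \<le> g + \<delta> 1 * (\<Sum>t=1..<n. d t * e t) + \<delta> 1 * (\<kappa>\<epsilon> * (\<Sum>t=1..n. (M t)\<^sup>2 / \<mu> t))"
proof -
  have c: "1 \<le> c t" if "t \<in> {1..n}" for t using w that by (auto simp: weights_def)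
  have c1: "c 1 = 1" using w by (simp add: weights_def)
  have \<delta>1: "0 < \<delta> 1" using \<delta> n by simp
  define q where "q t = c t * \<mu> t / (2 * \<delta> t) * ((\<alpha> t)\<^sup>2 + (\<beta> t)\<^sup>2)" for t
  (* Splitting the sum of B at its first or at its last index pairs the terms of stage t + 1 with
     e' t or with e t. *)
  define B where "B t = c t * A t - q t" for t
  define L where "L t = c (Suc t) / \<delta> (Suc t) * (2 * M t * (\<alpha> t + \<beta> t))" for t
  have split_first: "sum f {1..n} = f 1 + (\<Sum>t=1..<n. f (Suc t))" for f :: "nat \<Rightarrow> real"
    using n sum.atLeast_Suc_atMost[of 1 n f] sum.atLeast_Suc_lessThan_Suc_shift[of f 1 n]
    by (simp add: atLeastLessThanSuc_atLeastAtMost)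
  have split_last: "sum f {1..n} = (\<Sum>t=1..<n. f t) + f n" for f :: "nat \<Rightarrow> real"
    using n sum.last_plus[of 1 n f] by (simp add: atLeastLessThanSuc_atLeastAtMost[symmetric])
  have step: "(1 + \<delta> 1) * (d t * e' t) \<le> B (Suc t) + c (Suc t) / \<delta> (Suc t) * e t + L t"
    if t: "t \<in> {1..<n}" for t
  proof -
    let ?c = "c (Suc t)" and ?\<delta> = "\<delta> (Suc t)"
    have pos: "0 < ?c" "0 < ?\<delta>" using c[of "Suc t"] \<delta>[of "Suc t"] t by auto
    have "\<delta> 1 * d t \<le> ?c - c t" using w t by (simp add: weights_def d_def)
    moreover have "(1 + \<delta> 1) * d t = d t + \<delta> 1 * d t" by (simp add: distrib_right)
    moreover have "d t = c t + ?c / ?\<delta>" by (simp add: d_def)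
    ultimately have "(1 + \<delta> 1) * d t \<le> ?c + ?c / ?\<delta>" by linarith
    then have "(1 + \<delta> 1) * d t * e' t \<le> (?c + ?c / ?\<delta>) * e' t"
      using e'_nonneg[OF t] by (rule mult_right_mono)
    also have "\<dots> = ?c * e' t + ?c / ?\<delta> * e' t" by (simp add: algebra_simps)
    also have "\<dots> \<le> ?c * A (Suc t) + ?c / ?\<delta> * (e t + 2 * M t * (\<alpha> t + \<beta> t)
        - \<mu> (Suc t) / 2 * ((\<alpha> (Suc t))\<^sup>2 + (\<beta> (Suc t))\<^sup>2))"
      using e'_A[OF t] e'_e[OF t] pos by (intro add_mono mult_left_mono) auto
    also have "\<dots> = B (Suc t) + ?c / ?\<delta> * e t + L t"
      using pos by (simp add: B_def q_def L_def field_simps)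
    finally show ?thesis by (simp add: mult.assoc)
  qed
  have root': "(1 + \<delta> 1) * g' \<le> g + \<delta> 1 * B 1"
    using root \<delta>1 unfolding B_def q_def c1 by (simp add: right_diff_distrib)
  have "(1 + \<delta> 1) * (g' + \<delta> 1 * (\<Sum>t=1..<n. d t * e' t))
    = (1 + \<delta> 1) * g' + \<delta> 1 * (\<Sum>t=1..<n. (1 + \<delta> 1) * (d t * e' t))"
    by (simp add: sum_distrib_left algebra_simps)
  also have "\<dots> \<le> (g + \<delta> 1 * B 1)
      + \<delta> 1 * (\<Sum>t=1..<n. B (Suc t) + c (Suc t) / \<delta> (Suc t) * e t + L t)"
    using \<delta>1 by (intro add_mono root' mult_left_mono sum_mono step) auto
  also have "\<dots> = g + \<delta> 1 * (sum B {1..n} + (\<Sum>t=1..<n. c (Suc t) / \<delta> (Suc t) * e t + L t))"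
    unfolding split_first by (simp add: sum.distrib algebra_simps)
  also have "\<dots> = g + \<delta> 1 * ((\<Sum>t=1..<n. B t + c (Suc t) / \<delta> (Suc t) * e t + L t) + B n)"
    unfolding split_last by (simp add: sum.distrib algebra_simps)
  also have "\<dots> \<le> g + \<delta> 1 * ((\<Sum>t=1..<n. d t * e t + \<kappa>\<epsilon> * ((M t)\<^sup>2 / \<mu> t)) + \<kappa>\<epsilon> * ((M n)\<^sup>2 / \<mu> n))"
  proof (rule add_left_mono, rule mult_left_mono, rule add_mono, rule sum_mono)
    fix t assume t: "t \<in> {1..<n}"
    then have tn: "t \<in> {1..n}" "t \<noteq> n" by auto
    have pos: "0 < c t" "0 < \<delta> t" "0 < \<mu> t" using c[OF tn(1)] \<delta>[OF tn(1)] \<mu>[OF tn(1)] by auto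
    have "c t * A t \<le> c t * (M t * (4 * \<alpha> t + 2 * \<beta> t) + e t)"
      using A[OF t] pos by (intro mult_left_mono) auto
    moreover have "c t * (M t * (4 * \<alpha> t + 2 * \<beta> t)) + L t - q t \<le> stage_cost \<delta> c n t * ((M t)\<^sup>2 / \<mu> t)"
      unfolding L_def q_def by (rule linear_minus_squares_le_stage_cost(1)[where c = c and t = t and \<delta> = \<delta> and \<mu> = \<mu>, OF pos tn(2)])
    moreover have "\<dots> \<le> \<kappa>\<epsilon> * ((M t)\<^sup>2 / \<mu> t)"
      using cost[OF tn(1)] pos by (intro mult_right_mono) auto
    ultimately show "B t + c (Suc t) / \<delta> (Suc t) * e t + L t \<le> d t * e t + \<kappa>\<epsilon> * ((M t)\<^sup>2 / \<mu> t)"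
      unfolding B_def d_def by (simp add: algebra_simps)
  next
    have nn: "n \<in> {1..n}" using n by simp
    have pos: "0 < c n" "0 < \<delta> n" "0 < \<mu> n" using c[OF nn] \<delta>[OF nn] \<mu>[OF nn] by auto
    have "c n * A n \<le> c n * (2 * M n * (\<alpha> n + \<beta> n))"
      using A_last pos by (intro mult_left_mono) auto
    moreover have "c n * (2 * M n * (\<alpha> n + \<beta> n)) - q n \<le> stage_cost \<delta> c n n * ((M n)\<^sup>2 / \<mu> n)"
      unfolding q_def by (rule linear_minus_squares_le_stage_cost(2)[where c = c and t = n and \<delta> = \<delta> and \<mu> = \<mu>, OF pos refl])
    moreover have "\<dots> \<le> \<kappa>\<epsilon> * ((M n)\<^sup>2 / \<mu> n)"
      using cost[OF nn] pos by (intro mult_right_mono) auto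
    ultimately show "B n \<le> \<kappa>\<epsilon> * ((M n)\<^sup>2 / \<mu> n)" unfolding B_def by simp
  qed (use \<delta>1 in auto)
  also have "\<dots> = g + \<delta> 1 * (\<Sum>t=1..<n. d t * e t) + \<delta> 1 * (\<kappa>\<epsilon> * (\<Sum>t=1..n. (M t)\<^sup>2 / \<mu> t))"
    unfolding split_last[of "\<lambda>t. (M t)\<^sup>2 / \<mu> t"]
    by (simp add: sum.distrib sum_distrib_left algebra_simps)
  finally show ?thesis .
qed

text \<open>Derived from \<open>ln (1 + \<delta>) \<ge> \<delta>/(1 + \<delta>)\<close>; this is what determines \<open>P\<close>.\<close>

lemma ln_le_one_plus:
  assumes "0 < (\<delta>::real)" "1 \<le> a" "(1 + 1 / \<delta>) * ln a \<le> real P"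
  shows "a \<le> (1 + \<delta>) ^ P"
proof -
  have "\<delta> / (1 + \<delta>) \<le> ln (1 + \<delta>)"
    using ln_le_minus_one[of "1 / (1 + \<delta>)"] assms(1) by (simp add: ln_div field_simps)
  then have "(1 + 1 / \<delta>) * ln (1 + \<delta>) \<ge> 1"
    using assms(1) by (simp add: field_simps)
  moreover have "0 \<le> ln a" using assms(2) by simp
  ultimately have "ln a * 1 \<le> ln a * ((1 + 1 / \<delta>) * ln (1 + \<delta>))" by (rule mult_left_mono)
  also have "\<dots> = ((1 + 1 / \<delta>) * ln a) * ln (1 + \<delta>)" by simp
  also have "\<dots> \<le> real P * ln (1 + \<delta>)"
    using assms by (intro mult_right_mono) auto
  also have "\<dots> = ln ((1 + \<delta>) ^ P)" using assms(1) by (simp add: ln_realpow)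
  finally show ?thesis using assms by (simp add: ln_le_cancel_iff)
qed

context bsddp
begin

section \<open>Errors after a revisit\<close>

definition width :: "nat \<Rightarrow> real"
  where "width t = M t * diameter (X t)"

abbreviation total_width :: real
  where "total_width \<equiv> (\<Sum>t=1..T-1. width t)"

lemma norm_le_width:
  assumes "t \<in> {1..T-1}" "x \<in> X t" "y \<in> X t"
  shows "M t * norm (x - y) \<le> width t"
proof -
  have "dist x y \<le> diameter (X t)"
    using diameter_bounded_bound[OF compact_imp_bounded[OF X_compact] assms(2,3)]
      stage_ranges(1)[OF assms(1)] by blast
  then show ?thesis
    using M_pos[OF assms(1)] by (simp add: width_def dist_norm)
qed

lemma width_nonneg: "t \<in> {1..T-1} \<Longrightarrow> 0 \<le> width t"
  using norm_le_width[of t] X_nonempty[OF stage_ranges(1), of t]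
  by (metis all_not_in_conv diff_self mult_zero_right norm_zero)

text \<open>Every model below stage \<open>T\<close> has received a cut in the backward pass of iteration \<open>k\<close>, and
  \<open>\<Gamma>\<^sub>T = \<Q>\<^sub>T\<close>. Going down from stage \<open>T\<close>, each stage adds twice its width, for the slopes of the cut and of \<open>\<Q>\<^sub>t\<close>.\<close>

lemma model_error_le:
  assumes z: "sampled z" and k: "last_visit z k < k"
  shows "t \<in> {1..T} \<Longrightarrow> x \<in> X t \<Longrightarrow> Q t x - model z k t x \<le> 2 * (\<Sum>r=t..T-1. width r)"
proof (induction "T - t" arbitrary: t x)
  case 0
  then show ?case by (simp add: Q_last model_last)
next
  case (Suc n)
  then have t: "t < T" "t \<in> {1..T-1}" by auto
  note t' = stage_ranges[OF t(2)]
  let ?b = "decision z (last_visit z k) t"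
  have XE: "X t \<subseteq> E t" by (rule X_subset[OF t'(1)])
  have b: "?b \<in> X t" by (rule decision_in[OF z last_visit_less(1)[OF k] t'(1)])
  have next_stage: "Q (Suc t) u \<le> model z k (Suc t) u + 2 * (\<Sum>r=Suc t..T-1. width r)"
    if "u \<in> X (Suc t)" for u
    using Suc.hyps(1)[of "Suc t" u] Suc.hyps(2) that t'(3) by fastforce
  have "Q t x \<le> Q t ?b + M t * norm (x - ?b)"
    using Q_lipschitz[OF t(2)] Suc.prems(2) b XE by blast
  also have "Q t ?b \<le> expected_value t (model z k (Suc t)) ?b + 2 * (\<Sum>r=Suc t..T-1. width r)"
    unfolding Q_step[OF t(1)]
    by (rule expected_value_le_shift[OF t(2) convex_modelD(2)[OF convex_model_Q t(2)]
        convex_modelD(2)[OF model_convex[OF z] t(2)] _ next_stage]) (use b XE in auto)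
  also have "expected_value t (model z k (Suc t)) ?b \<le> model z k t x + M t * norm (x - ?b)"
    using model_revisit_ge[OF z k t(2)] Suc.prems(2) XE by blast
  finally have "Q t x - model z k t x \<le> 2 * (M t * norm (x - ?b)) + 2 * (\<Sum>r=Suc t..T-1. width r)"
    by linarith
  also have "\<dots> \<le> 2 * (width t + (\<Sum>r=Suc t..T-1. width r))"
    using norm_le_width[OF t(2) Suc.prems(2) b] by simp
  also have "width t + (\<Sum>r=Suc t..T-1. width r) = (\<Sum>r=t..T-1. width r)"
    using t by (simp add: sum.atLeast_Suc_atMost)
  finally show ?case .
qed

lemma path_error_le:
  assumes z: "sampled z" and k: "last_visit z k < k" and t: "t \<in> {1..T-1}"
  shows "path_error (model z k) (z k) t \<le> 2 * total_width"
proof -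
  have k1: "1 \<le> k" using k by simp
  have "path_error (model z k) (z k) t \<le> 2 * (\<Sum>r=Suc t..T-1. width r)"
    using path_error_le_model_error[OF model_convex[OF z] sampledD[OF z k1] t]
      model_error_le[OF z k stage_ranges(3)[OF t]
        forward_in[OF model_convex[OF z] sampledD[OF z k1] stage_ranges(3)[OF t]]]
    by (rule order_trans)
  also have "(\<Sum>r=Suc t..T-1. width r) \<le> total_width"
    by (intro sum_mono2) (use t in \<open>auto intro: width_nonneg\<close>)
  finally show ?thesis by simp
qed

definition true_cost :: "'a \<Rightarrow> real"
  where "true_cost u = F1 u + Q 1 u"

lemma true_cost_convex: "convex_on (X 1) true_cost"
proof -
  have "convex_on (X 1) F1"
    using strongly_convex_imp_convex[OF F1_strongly_convex] mu_pos[of 1] one_in_stages by simp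
  moreover have "convex_on (X 1) (Q 1)"
    using Q_convex[OF one_in_stages(1)] X_subset[OF one_in_stages(1)] X_convex[OF one_in_stages(1)]
    by (auto intro: convex_on_subset)
  ultimately show ?thesis unfolding true_cost_def by (rule convex_on_add)
qed

lemma gap_eq: "gap z k = true_cost (first_stage_solution z k) - root_value (model z k)"
  by (simp add: gap_def true_cost_def lower_value_def root_value_def)

lemma first_stage_solution_new:
  "last_visit z k = k \<Longrightarrow> first_stage_solution z k = decision z k 1"
  unfolding first_stage_solution_def by (subst revisit_average.simps) simp

lemma first_stage_solution_revisit:
  "last_visit z k < k \<Longrightarrow> first_stage_solution z k =
    (1 - \<tau>\<^sub>0) *\<^sub>R decision z k 1 + \<tau>\<^sub>0 *\<^sub>R first_stage_solution z (last_visit z k)"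
  unfolding first_stage_solution_def by (subst revisit_average.simps) simp

lemma decision_one_in: "sampled z \<Longrightarrow> decision z k 1 \<in> X 1"
  unfolding decision_def by (rule forward_one(1)[OF model_convex])

lemma first_stage_solution_in:
  assumes z: "sampled z"
  shows "first_stage_solution z k \<in> X 1"
proof (induction k rule: less_induct)
  case (less k)
  show ?case
  proof (cases "last_visit z k < k")
    case True
    then show ?thesis
      using first_stage_solution_revisit[OF True] decision_one_in[OF z, of k] less[OF True]
        X_convex[OF one_in_stages(1)] tau_range
      by (simp add: convex_alt)
  next
    case False
    then have "last_visit z k = k" using last_visit_le[of z k] by simp
    then show ?thesis by (simp only: first_stage_solution_new decision_one_in[OF z])
  qed
qed

lemma true_cost_revisit:
  assumes z: "sampled z" and k: "last_visit z k < k"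
  shows "true_cost (first_stage_solution z k)
    \<le> (1 - \<tau>\<^sub>0) * true_cost (decision z k 1) + \<tau>\<^sub>0 * true_cost (first_stage_solution z (last_visit z k))"
  unfolding first_stage_solution_revisit[OF k]
  using tau_range by (intro convex_onD[OF true_cost_convex] decision_one_in first_stage_solution_in z) auto

lemma root_value_attained:
  "sampled z \<Longrightarrow> root_value (model z k) = F1 (decision z k 1) + model z k 1 (decision z k 1)"
  unfolding decision_def by (rule forward_one(2)[OF model_convex])

lemma root_value_mono:
  assumes "sampled z" "j \<le> k"
  shows "root_value (model z j) \<le> root_value (model z k)"
proof -
  define x where "x j = forward (model z j) (z k) 1" for j
  have "root_value (model z j) + \<mu> 1 / 2 * (norm (x k - x j))\<^sup>2 \<le> root_value (model z k)"
    unfolding x_def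
    by (rule root_value_growth[OF model_convex[OF assms(1)] model_convex[OF assms(1)] model_mono[OF assms(2)]])
  moreover have "0 \<le> \<mu> 1 / 2 * (norm (x k - x j))\<^sup>2"
    using mu_pos[OF one_in_stages(1)] by simp
  ultimately show ?thesis by linarith
qed

text \<open>The cut was made at this very point, so the slope of \<open>\<Q>\<^sub>1\<close> does not enter; it would make the bound on
  the gap too large.\<close>

lemma true_cost_previous_decision:
  assumes z: "sampled z" and k: "last_visit z k < k"
  shows "true_cost (decision z (last_visit z k) 1) \<le> root_value (model z k) + 2 * total_width"
proof -
  let ?b = "decision z (last_visit z k) 1" and ?x = "decision z k 1"
  have in_X: "?b \<in> X 1" "?x \<in> X 1" by (rule decision_one_in[OF z])+
  then have in_E: "?b \<in> E 1" "?x \<in> E 1" using X_subset[OF one_in_stages(1)] by auto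
  have "F1 ?b \<le> F1 ?x + M 1 * norm (?x - ?b)"
    using lipschitz_on_normD[OF F1_lipschitz in_X] by (simp add: norm_minus_commute)
  moreover have "Q 1 ?b \<le> expected_value 1 (model z k (Suc 1)) ?b + 2 * (\<Sum>r=Suc 1..T-1. width r)"
  proof -
    have "Q 1 = expected_value 1 (Q (Suc 1))" by (rule Q_step) (use T_ge_2 in simp)
    moreover have "Q (Suc 1) u \<le> model z k (Suc 1) u + 2 * (\<Sum>r=Suc 1..T-1. width r)"
      if "u \<in> X (Suc 1)" for u
      using model_error_le[OF z k _ that] stage_ranges(3)[OF one_in_stages(2)] by simp
    ultimately show ?thesis
      using expected_value_le_shift[OF one_in_stages(2) convex_modelD(2)[OF convex_model_Q one_in_stages(2)]
          convex_modelD(2)[OF model_convex[OF z] one_in_stages(2)] in_E(1)]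
      by simp
  qed
  moreover have "expected_value 1 (model z k (Suc 1)) ?b \<le> model z k 1 ?x + M 1 * norm (?x - ?b)"
    by (rule model_revisit_ge[OF z k one_in_stages(2) in_E(2)])
  moreover have "M 1 * norm (?x - ?b) \<le> width 1"
    by (rule norm_le_width[OF one_in_stages(2) in_X(2,1)])
  moreover have "total_width = width 1 + (\<Sum>r=Suc 1..T-1. width r)"
    using T_ge_2 by (intro sum.atLeast_Suc_atMost) auto
  ultimately show ?thesis
    unfolding true_cost_def root_value_attained[OF z] by linarith
qed

text \<open>Both points of which the first-stage solution is an average satisfy the bound. For the
  earlier average this is the induction hypothesis, as the lower bounds increase with \<open>k\<close>.\<close>

lemma gap_le:
  assumes z: "sampled z"
  shows "last_visit z k < k \<Longrightarrow> gap z k \<le> 2 * total_width"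
proof (induction k rule: less_induct)
  case (less k)
  let ?l = "last_visit z k" and ?m = "root_value (model z k) + 2 * total_width"
  have "true_cost (first_stage_solution z ?l) \<le> ?m"
  proof (cases "last_visit z ?l < ?l")
    case True
    then show ?thesis
      using less.IH[OF less.prems True] root_value_mono[OF z, of ?l k] less.prems by (simp add: gap_eq)
  next
    case False
    then have "last_visit z ?l = ?l" using last_visit_le[of z ?l] by simp
    then show ?thesis
      using true_cost_previous_decision[OF z less.prems] by (simp only: first_stage_solution_new)
  qed
  moreover have "true_cost (decision z k 1) \<le> ?m"
    using model_error_le[OF z less.prems one_in_stages(1) decision_one_in[OF z, of k]]
    by (simp add: true_cost_def root_value_attained[OF z])
  ultimately have "(1 - \<tau>\<^sub>0) * true_cost (decision z k 1) + \<tau>\<^sub>0 * true_cost (first_stage_solution z ?l)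
    \<le> (1 - \<tau>\<^sub>0) * ?m + \<tau>\<^sub>0 * ?m"
    using tau_range by (intro add_mono mult_left_mono) auto
  then show ?case
    using true_cost_revisit[OF z less.prems] unfolding gap_eq by (simp add: algebra_simps)
qed

section \<open>One revisit\<close>

abbreviation error :: "(nat \<Rightarrow> nat \<Rightarrow> 'o) \<Rightarrow> nat \<Rightarrow> nat \<Rightarrow> real"
  where "error z k \<equiv> path_error (model z k) (z k)"

lemma error_nonneg: "sampled z \<Longrightarrow> 1 \<le> k \<Longrightarrow> t \<in> {1..T-1} \<Longrightarrow> 0 \<le> error z k t"
  by (intro path_error_nonneg model_convex model_le_Q sampledD)

text \<open>The decisions that the scenario of iteration \<open>k\<close> would have produced before its cuts were
  added. The scenario is the worst one with respect to them.\<close>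

definition tentative :: "(nat \<Rightarrow> nat \<Rightarrow> 'o) \<Rightarrow> nat \<Rightarrow> nat \<Rightarrow> 'a"
  where "tentative z k = forward (model z (k - 1)) (z k)"

context
  fixes z k l
  assumes z: "sampled z" and revisit: "last_visit z k < k" and l_def: "l = last_visit z k"
    and worst: "worst_scenario (model z (k - 1)) (z k)"
begin

abbreviation "first_move t \<equiv> norm (tentative z k t - decision z l t)"
abbreviation "second_move t \<equiv> norm (decision z k t - tentative z k t)"

lemma revisit_basics:
  shows k_pos: "1 \<le> k" and l_le: "l \<le> k - 1" "k - 1 \<le> k" and scen: "z k \<in> scenarios"
    and prev: "decision z l = forward (model z l) (z k)"
proof -
  show "1 \<le> k" "l \<le> k - 1" "k - 1 \<le> k" using revisit l_def by auto
  then show "z k \<in> scenarios" using sampledD[OF z] by blast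
  show "decision z l = forward (model z l) (z k)"
    using last_visit_less(2)[OF revisit] by (simp add: decision_def l_def)
qed

lemma l_same: "z l = z k"
  using last_visit_less(2)[OF revisit] by (simp add: l_def)

lemma decisions_in_E:
  assumes "t \<in> {1..T}"
  shows "decision z l t \<in> E t" "tentative z k t \<in> E t" "decision z k t \<in> E t"
  unfolding prev tentative_def decision_def[of z k]
  by (rule forward_in_E[OF model_convex[OF z] scen assms])+

lemma error_step:
  assumes "t \<in> {1..T-1}"
  shows "error z k t + \<mu> (Suc t) / 2 * ((first_move (Suc t))\<^sup>2 + (second_move (Suc t))\<^sup>2)
    \<le> error z l t + 2 * M t * (first_move t + second_move t)"
proof -
  have "path_error (model z (k - 1)) (z k) t + \<mu> (Suc t) / 2 * (first_move (Suc t))\<^sup>2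
    \<le> path_error (model z l) (z k) t + 2 * M t * first_move t"
    unfolding prev tentative_def
    by (rule path_error_change[OF model_convex[OF z] model_convex[OF z] model_mono[OF l_le(1)] scen assms])
  moreover have "path_error (model z k) (z k) t + \<mu> (Suc t) / 2 * (second_move (Suc t))\<^sup>2
    \<le> path_error (model z (k - 1)) (z k) t + 2 * M t * second_move t"
    unfolding tentative_def decision_def
    by (rule path_error_change[OF model_convex[OF z] model_convex[OF z] model_mono[OF l_le(2)] scen assms])
  ultimately show ?thesis by (simp add: l_same algebra_simps)
qed

lemma cut_at_decision:
  assumes t: "t \<in> {1..T-1}"
  shows "expected_value t (model z k (Suc t)) (decision z l t)
    \<le> model z k t (decision z k t) + M t * (first_move t + second_move t)"
proof -
  have "expected_value t (model z k (Suc t)) (decision z l t)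
    \<le> model z k t (decision z k t) + M t * norm (decision z k t - decision z l t)"
    using model_revisit_ge[OF z revisit t] decisions_in_E(3)[OF stage_ranges(1)[OF t]] l_def by simp
  also have "norm (decision z k t - decision z l t) \<le> first_move t + second_move t"
    using norm_triangle_ineq[of "decision z k t - tentative z k t" "tentative z k t - decision z l t"]
    by simp
  finally show ?thesis using M_pos[OF t] by (simp add: mult_left_mono)
qed

text \<open>At stage \<open>T - 1\<close> the cuts are exact because the model of stage \<open>T\<close> is.\<close>

lemma model_error_last:
  shows "Q (T - 1) (decision z k (T - 1)) - model z k (T - 1) (decision z k (T - 1))
    \<le> 2 * M (T - 1) * (first_move (T - 1) + second_move (T - 1))"
proof -
  let ?t = "T - 1"
  have t: "?t \<in> {1..T-1}" "Suc ?t = T" "?t < T" using T_ge_2 by auto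
  note in_E = decisions_in_E[OF stage_ranges(1)[OF t(1)]]
  have "Q ?t (decision z l ?t) = expected_value ?t (model z k (Suc ?t)) (decision z l ?t)"
    using Q_step[OF t(3)] t(2) by (simp add: Q_last model_last)
  moreover have "Q ?t (decision z k ?t) \<le> Q ?t (tentative z k ?t) + M ?t * second_move ?t"
    "Q ?t (tentative z k ?t) \<le> Q ?t (decision z l ?t) + M ?t * first_move ?t"
    using Q_lipschitz[OF t(1)] in_E by blast+
  ultimately show ?thesis using cut_at_decision[OF t(1)] by (simp add: algebra_simps)
qed

text \<open>The cut at the old decision is accurate up to the error of \<open>\<V>\<^sub>t\<close> there. The scenario controls this
  error only at the tentative decision, where it is at most the error of the path, and the latter is
  compared with that of the previous visit. The passages between the three decisions cost four
  times the first move and twice the second one.\<close>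

lemma model_error_inner:
  assumes t: "t \<in> {1..T-1}"
  shows "Q t (decision z k t) - model z k t (decision z k t)
    \<le> M t * (4 * first_move t + 2 * second_move t) + error z l t"
proof -
  let ?a = "tentative z k t" and ?b = "decision z l t" and ?W = "model z (k - 1)"
  note in_E = decisions_in_E[OF stage_ranges(1)[OF t]]
  have conv: "convex_on (E (Suc t)) (model z j (Suc t))" for j
    by (rule convex_modelD(2)[OF model_convex[OF z] t])
  have tT: "t < T" using t by auto
  have "Q t (decision z k t) \<le> Q t ?a + M t * second_move t"
    using Q_lipschitz[OF t] in_E by blast
  moreover have "Q t ?a - expected_value t (?W (Suc t)) ?a \<le> path_error ?W (z k) t"
    using expected_error_le[OF worst t] Q_step[OF tT] by (simp add: tentative_def)
  moreover have "path_error ?W (z k) t \<le> error z l t + 2 * M t * first_move t"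
  proof -
    have "path_error ?W (z k) t + \<mu> (Suc t) / 2 * (first_move (Suc t))\<^sup>2
      \<le> path_error (model z l) (z k) t + 2 * M t * first_move t"
      unfolding prev tentative_def
      by (rule path_error_change[OF model_convex[OF z] model_convex[OF z] model_mono[OF l_le(1)] scen t])
    moreover have "0 \<le> \<mu> (Suc t) / 2 * (first_move (Suc t))\<^sup>2"
      using mu_pos[OF stage_ranges(3)[OF t]] by simp
    ultimately show ?thesis unfolding l_same by linarith
  qed
  moreover have "expected_value t (?W (Suc t)) ?a
    \<le> expected_value t (?W (Suc t)) ?b + M t * first_move t"
    by (rule expected_value_lipschitz[OF t conv in_E(2,1)])
  moreover have "expected_value t (?W (Suc t)) ?b \<le> expected_value t (model z k (Suc t)) ?b + 0"
    by (rule expected_value_le_shift[OF t conv conv in_E(1)])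
      (use model_leD[OF model_mono[OF l_le(2)] stage_ranges(3)[OF t]] in simp)
  ultimately show ?thesis using cut_at_decision[OF t] by (simp add: algebra_simps)
qed

text \<open>The lower value rises by the squares of the moves, and the cost of the average is bounded by
  convexity.\<close>

lemma gap_step:
  assumes tau: "\<tau>\<^sub>0 = 1 / (1 + \<delta>)" and \<delta>: "0 < \<delta>"
  shows "(1 + \<delta>) * gap z k + \<mu> 1 / 2 * ((first_move 1)\<^sup>2 + (second_move 1)\<^sup>2)
    \<le> gap z l + \<delta> * (Q 1 (decision z k 1) - model z k 1 (decision z k 1))"
proof -
  have "root_value (model z l) + \<mu> 1 / 2 * (first_move 1)\<^sup>2 \<le> root_value (model z (k - 1))"
    unfolding prev tentative_def
    by (rule root_value_growth[OF model_convex[OF z] model_convex[OF z] model_mono[OF l_le(1)]])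
  moreover have "root_value (model z (k - 1)) + \<mu> 1 / 2 * (second_move 1)\<^sup>2 \<le> root_value (model z k)"
    unfolding decision_def tentative_def
    by (rule root_value_growth[OF model_convex[OF z] model_convex[OF z] model_mono[OF l_le(2)]])
  moreover have "(1 + \<delta>) * true_cost (first_stage_solution z k)
    \<le> \<delta> * true_cost (decision z k 1) + true_cost (first_stage_solution z l)"
  proof -
    have "1 - \<tau>\<^sub>0 = \<delta> / (1 + \<delta>)" using \<delta> by (simp add: tau field_simps)
    then have "true_cost (first_stage_solution z k)
      \<le> \<delta> / (1 + \<delta>) * true_cost (decision z k 1) + 1 / (1 + \<delta>) * true_cost (first_stage_solution z l)"
      using true_cost_revisit[OF z revisit] by (simp only: tau l_def)
    also have "\<dots> = (\<delta> * true_cost (decision z k 1) + true_cost (first_stage_solution z l)) / (1 + \<delta>)"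
      by (simp add: add_divide_distrib)
    finally show ?thesis using \<delta> by (simp add: field_simps)
  qed
  moreover have "true_cost (decision z k 1) - root_value (model z k)
    = Q 1 (decision z k 1) - model z k 1 (decision z k 1)"
    unfolding true_cost_def root_value_attained[OF z] by simp
  then have "\<delta> * true_cost (decision z k 1) - \<delta> * root_value (model z k)
    = \<delta> * (Q 1 (decision z k 1) - model z k 1 (decision z k 1))"
    by (metis right_diff_distrib)
  ultimately show ?thesis unfolding gap_eq by (simp add: algebra_simps)
qed

lemma potential_contraction:
  fixes c \<delta> :: "nat \<Rightarrow> real" and C :: real
  assumes tau: "\<tau>\<^sub>0 = 1 / (1 + \<delta> 1)" and \<delta>: "\<And>t. 0 < \<delta> t" and w: "weights \<delta> (T - 1) c"
    and cost: "\<And>t. t \<in> {1..T-1} \<Longrightarrow> stage_cost \<delta> c (T - 1) t \<le> C"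
  shows "(1 + \<delta> 1) * (gap z k + \<delta> 1 * (\<Sum>t=1..<T-1. (c t + c (Suc t) / \<delta> (Suc t)) * error z k t))
    \<le> gap z l + \<delta> 1 * (\<Sum>t=1..<T-1. (c t + c (Suc t) / \<delta> (Suc t)) * error z l t)
      + \<delta> 1 * (C * (\<Sum>t=1..T-1. (M t)\<^sup>2 / \<mu> t))"
proof (rule weighted_contraction[where \<alpha> = first_move and \<beta> = second_move and
      A = "\<lambda>t. Q t (decision z k t) - model z k t (decision z k t)"])
  show "1 \<le> T - 1" using T_ge_2 by simp
  show "weights \<delta> (T - 1) c" by (rule w)
  show "0 < \<delta> t" for t by (rule \<delta>)
  show "0 < \<mu> t" if "t \<in> {1..T-1}" for t using mu_pos stage_ranges(1)[OF that] by blast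
  show "stage_cost \<delta> c (T - 1) t \<le> C" if "t \<in> {1..T-1}" for t by (rule cost[OF that])
  show "0 \<le> error z k t" if "t \<in> {1..<T-1}" for t
    using error_nonneg[OF z k_pos] that by simp
  show "(1 + \<delta> 1) * gap z k + \<mu> 1 / 2 * ((first_move 1)\<^sup>2 + (second_move 1)\<^sup>2)
    \<le> gap z l + \<delta> 1 * (Q 1 (decision z k 1) - model z k 1 (decision z k 1))"
    by (rule gap_step[OF tau \<delta>])
  show "Q t (decision z k t) - model z k t (decision z k t)
      \<le> M t * (4 * first_move t + 2 * second_move t) + error z l t" if "t \<in> {1..<T-1}" for t
    by (rule model_error_inner) (use that in auto)
  show "Q (T - 1) (decision z k (T - 1)) - model z k (T - 1) (decision z k (T - 1))
    \<le> 2 * M (T - 1) * (first_move (T - 1) + second_move (T - 1))"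
    by (rule model_error_last)
  show "error z k t \<le> Q (Suc t) (decision z k (Suc t)) - model z k (Suc t) (decision z k (Suc t))"
    if "t \<in> {1..<T-1}" for t
    unfolding decision_def
    by (rule path_error_le_model_error[OF model_convex[OF z] scen]) (use that in auto)
  show "error z k t + \<mu> (Suc t) / 2 * ((first_move (Suc t))\<^sup>2 + (second_move (Suc t))\<^sup>2)
    \<le> error z l t + 2 * M t * (first_move t + second_move t)" if "t \<in> {1..<T-1}" for t
    by (rule error_step) (use that in auto)
qed

end

section \<open>A run of worst scenarios\<close>

lemma finite_scenarios: "finite scenarios"
  unfolding scenarios_def by (intro finite_PiE) (auto intro: support_finite)

lemma card_scenarios: "card scenarios = (\<Prod>t=2..T. card (\<Xi> t))"
  unfolding scenarios_def by (subst card_PiE) auto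

text \<open>The potential \<open>W\<close> is followed along the visits of one scenario within the run. At its second visit
  \<open>W\<close> is at most \<open>2 c \<Sum>\<^sub>t M\<^sub>t D\<^sub>t\<close>, with \<open>c\<close> the last weight, and then the distance to the limit \<open>C\<close> contracts.\<close>

lemma gap_small_in_run:
  fixes z :: "nat \<Rightarrow> nat \<Rightarrow> 'o" and \<epsilon> \<epsilon>bar :: real and a P :: nat
  assumes z: "sampled z" and \<epsilon>bar: "0 < \<epsilon>bar"
    and \<epsilon>_def: "\<epsilon> = \<epsilon>bar / (40 * (\<Sum>t=1..T-1. (M t)\<^sup>2 / \<mu> t))" and \<epsilon>_half: "\<epsilon> < 1 / 2"
    and tau: "\<tau>\<^sub>0 = 1 / (1 + \<epsilon> ^ (2 ^ (T - 1) - 1))"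
    and width_large: "1 < 4 / \<epsilon>bar * total_width"
    and P: "(1 + 1 / \<epsilon> ^ (2 ^ (T - 1) - 1)) * ln (4 / \<epsilon>bar * total_width) \<le> real P"
    and worst: "\<And>k. k \<in> {a<..a + (P * card scenarios + 1)} \<Longrightarrow> worst_scenario (model z (k - 1)) (z k)"
  shows "\<exists>k\<in>{a<..a + (P * card scenarios + 1)}. gap z k \<le> \<epsilon>bar"
proof -
  let ?S = "\<Sum>t=1..T-1. (M t)\<^sup>2 / \<mu> t" and ?I = "{a<..a + (P * card scenarios + 1)}"
  have S_pos: "0 < ?S"
  proof (rule sum_pos)
    show "0 < (M t)\<^sup>2 / \<mu> t" if "t \<in> {1..T-1}" for t
      using M_pos[OF that] mu_pos[OF stage_ranges(1)[OF that]] by simp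
  qed (use one_in_stages(2) in auto)
  have \<epsilon>: "0 < \<epsilon>" using S_pos \<epsilon>bar by (simp add: \<epsilon>_def)
  define \<delta> where "\<delta> = damping \<epsilon> T"
  have \<delta>: "0 < \<delta> t" for t using \<epsilon> by (simp add: \<delta>_def damping_pos)
  have \<delta>1: "\<delta> 1 = \<epsilon> ^ (2 ^ (T - 1) - 1)" by (simp add: \<delta>_def damping_def)
  have T: "Suc (T - 1) = T" "1 \<le> T - 1" using T_ge_2 by auto
  obtain c \<kappa> where w: "weights \<delta> (T - 1) c"
    and cost: "\<forall>t\<in>{1..T-1}. stage_cost \<delta> c (T - 1) t \<le> \<kappa> * \<epsilon>"
    and budget: "\<kappa> / 40 + c (T - 1) * (1 + \<delta> 1) / 2 \<le> 1"
    using weights_exist[OF \<epsilon> \<epsilon>_half T(2)] unfolding T(1) \<delta>_def by blast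
  have c_last: "1 \<le> c (T - 1)" using w T(2) by (simp add: weights_def)
  (* The fixed point of the contraction. *)
  define C where "C = \<kappa> * \<epsilon> * ?S"
  have C_eq: "C = \<epsilon>bar * (\<kappa> / 40)" using S_pos by (simp add: C_def \<epsilon>_def)
  have "0 \<le> stage_cost \<delta> c (T - 1) (T - 1)"
    using c_last \<delta>[of "T - 1"] by (simp add: stage_cost_def)
  also have "\<dots> \<le> \<kappa> * \<epsilon>" using cost T(2) by simp
  finally have C_nonneg: "0 \<le> C" using S_pos by (simp add: C_def)
  define d where "d t = c t + c (Suc t) / \<delta> (Suc t)" for t
  have d_nonneg: "0 \<le> d t" if "t \<in> {1..<T-1}" for t
  proof -
    have "1 \<le> c t" "1 \<le> c (Suc t)" using w that by (auto simp: weights_def)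
    then show ?thesis using \<delta>[of "Suc t"] by (simp add: d_def)
  qed
  define W where "W k = gap z k + \<delta> 1 * (\<Sum>t=1..<T-1. d t * error z k t)" for k
  have gap_le_W: "gap z k \<le> W k" if "1 \<le> k" for k
  proof -
    have "0 \<le> (\<Sum>t=1..<T-1. d t * error z k t)"
      by (rule sum_nonneg, rule mult_nonneg_nonneg[OF d_nonneg error_nonneg[OF z that]]) auto
    then show ?thesis using \<delta>[of 1] by (simp add: W_def)
  qed
  have tw: "0 < total_width" using width_large \<epsilon>bar by (simp add: zero_less_mult_iff field_simps)
  have W_init: "W k \<le> 2 * total_width * c (T - 1)" if "last_visit z k < k" for k
  proof -
    have "d t * error z k t \<le> d t * (2 * total_width)" if "t \<in> {1..<T-1}" for t
      by (rule mult_left_mono[OF path_error_le[OF z \<open>last_visit z k < k\<close>] d_nonneg[OF that]])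
        (use that in auto)
    then have "(\<Sum>t=1..<T-1. d t * error z k t) \<le> (\<Sum>t=1..<T-1. d t * (2 * total_width))"
      by (rule sum_mono)
    also have "\<dots> = (\<Sum>t=1..<T-1. d t) * (2 * total_width)" by (rule sum_distrib_right[symmetric])
    finally have "W k \<le> 2 * total_width + \<delta> 1 * ((\<Sum>t=1..<T-1. d t) * (2 * total_width))"
      unfolding W_def by (rule add_mono[OF gap_le[OF z that] mult_left_mono]) (use \<delta>[of 1] in simp)
    also have "\<dots> = (1 + \<delta> 1 * (\<Sum>t=1..<T-1. d t)) * (2 * total_width)" by (simp add: algebra_simps)
    also have "\<dots> \<le> c (T - 1) * (2 * total_width)"
    proof (rule mult_right_mono)
      show "1 + \<delta> 1 * (\<Sum>t=1..<T-1. d t) \<le> c (T - 1)"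
        using weighted_sum_le[OF w T(2)] unfolding d_def by linarith
      show "0 \<le> 2 * total_width" using tw by linarith
    qed
    finally show ?thesis by (simp add: mult.commute)
  qed
  have W_step: "(1 + \<delta> 1) * (W k - C) \<le> W (last_visit z k) - C" if "last_visit z k < k" "k \<in> ?I" for k
  proof -
    have "(1 + \<delta> 1) * W k \<le> W (last_visit z k) + \<delta> 1 * C"
      unfolding W_def d_def C_def
      by (rule potential_contraction[OF z that(1) refl worst[OF that(2)] tau[folded \<delta>1] \<delta> w])
        (use cost in blast)
    then show ?thesis by (simp add: distrib_right right_diff_distrib)
  qed
  define visits where "visits k = {j \<in> {a<..k}. z j = z k}" for k
  have W_visits: "(1 + \<delta> 1) ^ (card (visits k) - 2) * (W k - C) \<le> 2 * total_width * c (T - 1)"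
    if "k \<in> ?I" "2 \<le> card (visits k)" for k
    using that
  proof (induction k rule: less_induct)
    case (less k)
    let ?l = "last_visit z k"
    have fin: "finite (visits k)" by (simp add: visits_def)
    have k_in: "k \<in> visits k" using less.prems by (simp add: visits_def)
    have "\<not> visits k \<subseteq> {k}"
    proof
      assume "visits k \<subseteq> {k}"
      then have "card (visits k) \<le> card {k}" by (intro card_mono) auto
      then show False using less.prems(2) by simp
    qed
    then obtain j where "j \<in> visits k" "j \<noteq> k" by blast
    then have j: "a < j" "j < k" "z j = z k" by (auto simp: visits_def)
    then have l: "j \<le> ?l" "?l < k" using last_visit_ge[of j k z] by auto
    have zl: "z ?l = z k" by (rule last_visit_less(2)[OF l(2)])
    have l_in: "?l \<in> ?I" using l j less.prems(1) by auto
    have "visits k = insert k (visits ?l)"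
    proof (rule set_eqI)
      fix i
      show "i \<in> visits k \<longleftrightarrow> i \<in> insert k (visits ?l)"
        using last_visit_less(3)[OF l(2), of i] l zl less.prems(1)
        by (cases "i \<le> ?l"; cases "i = k") (auto simp: visits_def)
    qed
    moreover have "k \<notin> visits ?l" "finite (visits ?l)" using l by (auto simp: visits_def)
    ultimately have card: "card (visits k) = Suc (card (visits ?l))" by simp
    show ?case
    proof (cases "2 \<le> card (visits ?l)")
      case True
      then have "card (visits k) - 2 = Suc (card (visits ?l) - 2)" using card by simp
      then have "(1 + \<delta> 1) ^ (card (visits k) - 2) * (W k - C)
        = (1 + \<delta> 1) ^ (card (visits ?l) - 2) * ((1 + \<delta> 1) * (W k - C))" by simp
      also have "\<dots> \<le> (1 + \<delta> 1) ^ (card (visits ?l) - 2) * (W ?l - C)"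
        using \<delta>[of 1] by (intro mult_left_mono W_step l(2) less.prems(1)) auto
      also have "\<dots> \<le> 2 * total_width * c (T - 1)" by (rule less.IH[OF l(2) l_in True])
      finally show ?thesis .
    next
      case False
      then have "card (visits k) - 2 = 0" using card by simp
      then show ?thesis using W_init[OF l(2)] C_nonneg by simp
    qed
  qed
  have P1: "1 \<le> P"
  proof -
    have "0 < (1 + 1 / \<delta> 1) * ln (4 / \<epsilon>bar * total_width)"
      using width_large \<delta>[of 1] by (intro mult_pos_pos add_pos_pos) auto
    then show ?thesis using P unfolding \<delta>1 by (cases P) auto
  qed
  obtain s where "P < card {j \<in> ?I. z j = s}"
  proof (rule ccontr)
    assume "\<not> thesis"
    then have le: "card {j \<in> ?I. z j = s} \<le> P" for s using that by (meson not_le)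
    have "card ?I \<le> card (\<Union>s\<in>scenarios. {j \<in> ?I. z j = s})"
      using sampledD[OF z] finite_scenarios by (intro card_mono) auto
    also have "\<dots> \<le> (\<Sum>s\<in>scenarios. card {j \<in> ?I. z j = s})"
      by (rule card_UN_le[OF finite_scenarios])
    also have "\<dots> \<le> (\<Sum>s\<in>scenarios. P)" by (intro sum_mono le)
    finally show False by simp
  qed
  moreover define J where "J = {j \<in> ?I. z j = s}"
  ultimately have J: "P < card J" "finite J" by simp_all
  define k where "k = Max J"
  have "J \<noteq> {}" using J(1) by auto
  with J(2) have k: "k \<in> J" unfolding k_def by (rule Max_in)
  have "J \<subseteq> visits k"
    using k J(2) by (auto simp: visits_def J_def k_def intro: Max_ge)
  then have visits_k: "P < card (visits k)"
    using J(1) card_mono[of "visits k" J] by (simp add: visits_def)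
  have kI: "k \<in> ?I" "1 \<le> k" using k by (auto simp: J_def)
  have "gap z k \<le> \<epsilon>bar"
  proof (cases "W k \<le> C")
    case True
    have "0 \<le> c (T - 1) * (1 + \<delta> 1) / 2" using c_last \<delta>[of 1] by simp
    then have "\<kappa> / 40 \<le> 1" using budget by linarith
    then have "\<epsilon>bar * (\<kappa> / 40) \<le> \<epsilon>bar * 1" using \<epsilon>bar by (intro mult_left_mono) auto
    then show ?thesis using True gap_le_W[OF kI(2)] C_eq by simp
  next
    case False
    have "4 / \<epsilon>bar * total_width * (W k - C) \<le> (1 + \<delta> 1) ^ P * (W k - C)"
      using ln_le_one_plus[OF \<delta>[of 1] _ P[folded \<delta>1]] width_large False by (intro mult_right_mono) auto
    also have "\<dots> = (1 + \<delta> 1) * ((1 + \<delta> 1) ^ (P - 1) * (W k - C))"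
      using P1 by (cases P) auto
    also have "\<dots> \<le> (1 + \<delta> 1) * ((1 + \<delta> 1) ^ (card (visits k) - 2) * (W k - C))"
      using \<delta>[of 1] False visits_k by (intro mult_left_mono mult_right_mono power_increasing) auto
    also have "\<dots> \<le> (1 + \<delta> 1) * (2 * total_width * c (T - 1))"
      using \<delta>[of 1] visits_k P1 kI(1) by (intro mult_left_mono W_visits) auto
    finally have "total_width * (4 / \<epsilon>bar * (W k - C)) \<le> total_width * (2 * ((1 + \<delta> 1) * c (T - 1)))"
      by (simp add: algebra_simps)
    then have "4 / \<epsilon>bar * (W k - C) \<le> 2 * ((1 + \<delta> 1) * c (T - 1))"
      by (rule mult_left_le_imp_le[OF _ tw])
    then have "W k \<le> C + \<epsilon>bar * (c (T - 1) * (1 + \<delta> 1) / 2)"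
      using \<epsilon>bar by (simp add: field_simps)
    also have "\<dots> = \<epsilon>bar * (\<kappa> / 40 + c (T - 1) * (1 + \<delta> 1) / 2)" by (simp add: C_eq distrib_left)
    also have "\<dots> \<le> \<epsilon>bar * 1" using budget \<epsilon>bar by (intro mult_left_mono) auto
    finally show ?thesis using gap_le_W[OF kI(2)] by simp
  qed
  then show ?thesis using kI(1) by blast
qed

end

section \<open>Runs of successes in random histories\<close>

text \<open>Histories are lists with the most recent outcome first. \<open>average q S f n h\<close> is the expectation
  of \<open>f\<close> after \<open>n\<close> independent outcomes with law \<open>q\<close> on \<open>S\<close> have been added to \<open>h\<close>.\<close>

fun average :: "('s \<Rightarrow> real) \<Rightarrow> 's set \<Rightarrow> ('s list \<Rightarrow> real) \<Rightarrow> nat \<Rightarrow> 's list \<Rightarrow> real"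
  where
    "average q S f 0 h = f h"
  | "average q S f (Suc n) h = (\<Sum>s\<in>S. q s * average q S f n (s # h))"

text \<open>The number of most recent outcomes that are good after the history that precedes them.\<close>

fun streak :: "('s list \<Rightarrow> bool) \<Rightarrow> 's list \<Rightarrow> nat"
  where
    "streak G [] = 0"
  | "streak G (s # h) = (if G (s # h) then Suc (streak G h) else 0)"

fun pending :: "('s list \<Rightarrow> bool) \<Rightarrow> nat \<Rightarrow> 's list \<Rightarrow> bool"
  where
    "pending G R [] = True"
  | "pending G R (s # h) = (pending G R h \<and> streak G (s # h) < R)"

lemma average_add: "average q S f (m + n) h = average q S (average q S f n) m h"
  by (induction m arbitrary: h) simp_all

lemma average_mono:
  assumes "\<And>s. s \<in> S \<Longrightarrow> 0 \<le> q s" "\<And>h. f h \<le> g h"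
  shows "average q S f n h \<le> average q S g n h"
  by (induction n arbitrary: h) (auto intro!: sum_mono mult_left_mono assms)

lemma average_scale: "average q S (\<lambda>h. c * f h) n h = c * average q S f n h"
  by (induction n arbitrary: h) (simp_all add: sum_distrib_left mult.left_commute)

lemma average_Suc_right:
  "average q S f (Suc n) h = average q S (\<lambda>h. \<Sum>s\<in>S. q s * f (s # h)) n h"
proof -
  have "average q S f 1 = (\<lambda>h. \<Sum>s\<in>S. q s * f (s # h))" by (rule ext) simp
  then show ?thesis using average_add[of q S f n 1 h] by simp
qed

definition histories :: "'s set \<Rightarrow> nat \<Rightarrow> 's list set"
  where "histories S n = {h. set h \<subseteq> S \<and> length h = n}"

lemma average_eq_sum:
  assumes "finite S"
  shows "average q S f n [] = (\<Sum>h\<in>histories S n. prod_list (map q h) * f h)"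
proof (induction n arbitrary: f)
  case 0
  have "histories S 0 = {[]}" by (auto simp: histories_def)
  then show ?case by simp
next
  case (Suc n)
  have eq: "histories S (Suc n) = (\<lambda>(h, s). s # h) ` (histories S n \<times> S)"
    by (auto simp: histories_def image_iff length_Suc_conv)
  have inj: "inj_on (\<lambda>(h, s). s # h) (histories S n \<times> S)" by (auto simp: inj_on_def)
  have "average q S f (Suc n) [] = (\<Sum>h\<in>histories S n. \<Sum>s\<in>S. prod_list (map q h) * (q s * f (s # h)))"
    unfolding average_Suc_right Suc.IH by (simp add: sum_distrib_left)
  also have "\<dots> = (\<Sum>(h, s)\<in>histories S n \<times> S. prod_list (map q h) * (q s * f (s # h)))"
    by (rule sum.cartesian_product)
  also have "\<dots> = (\<Sum>h\<in>histories S (Suc n). prod_list (map q h) * f h)"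
    unfolding eq by (subst sum.reindex[OF inj]) (auto intro!: sum.cong simp: mult_ac)
  finally show ?case .
qed

text \<open>The law of the outcomes is the same after every history, but which outcomes are good may change.\<close>

locale good_outcomes =
  fixes S :: "'s set" and q :: "'s \<Rightarrow> real" and p :: real and G :: "'s list \<Rightarrow> bool" and R :: nat
  assumes finite_S: "finite S" and q_sum: "sum q S = 1"
    and p_pos: "0 < p" and p_le: "\<And>s. s \<in> S \<Longrightarrow> p \<le> q s"
    and good_exists: "\<And>h. \<exists>s\<in>S. G (s # h)" and R_pos: "1 \<le> R"
begin

abbreviation indicator_pending :: "'s list \<Rightarrow> real"
  where "indicator_pending h \<equiv> of_bool (pending G R h)"

abbreviation survival :: "nat \<Rightarrow> 's list \<Rightarrow> real"
  where "survival \<equiv> average q S indicator_pending"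

lemma q_nonneg: "s \<in> S \<Longrightarrow> 0 \<le> q s"
  using p_le p_pos by force

lemma p_le_one: "p \<le> 1"
proof -
  obtain s where s: "s \<in> S" using good_exists by blast
  have "q s \<le> sum q S" by (rule member_le_sum[OF s]) (auto intro: q_nonneg finite_S)
  then show ?thesis using p_le[OF s] q_sum by simp
qed

lemma streak_less: "pending G R h \<Longrightarrow> streak G h < R"
  using R_pos by (cases h) auto

text \<open>As \<open>a \<le> b\<close>, the bound is weakest when the good outcome \<open>s0\<close> has the least possible probability \<open>p\<close>.\<close>

lemma average_step_le:
  assumes "s0 \<in> S" "f s0 \<le> a" "a \<le> b" "\<And>s. s \<in> S \<Longrightarrow> f s \<le> b"
  shows "(\<Sum>s\<in>S. q s * f s) \<le> p * a + (1 - p) * b"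
proof -
  have rest: "sum q (S - {s0}) = 1 - q s0"
    using sum.remove[OF finite_S assms(1), of q] q_sum by simp
  have "(\<Sum>s\<in>S. q s * f s) = q s0 * f s0 + (\<Sum>s\<in>S - {s0}. q s * f s)"
    by (rule sum.remove[OF finite_S assms(1)])
  also have "\<dots> \<le> q s0 * a + (\<Sum>s\<in>S - {s0}. q s * b)"
    using assms q_nonneg by (intro add_mono sum_mono mult_left_mono) auto
  also have "(\<Sum>s\<in>S - {s0}. q s * b) = (1 - q s0) * b"
    unfolding rest[symmetric] by (rule sum_distrib_right[symmetric])
  also have "q s0 * a + (1 - q s0) * b = b - q s0 * (b - a)"
    by (simp add: algebra_simps)
  also have "\<dots> \<le> b - p * (b - a)"
    using mult_right_mono[OF p_le[OF assms(1)], of "b - a"] assms(3) by simp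
  finally show ?thesis by (simp add: algebra_simps)
qed

lemma survival_le: "survival m h \<le> indicator_pending h"
proof (induction m arbitrary: h)
  case (Suc m)
  have "survival (Suc m) h \<le> (\<Sum>s\<in>S. q s * indicator_pending h)"
    unfolding average.simps
  proof (intro sum_mono mult_left_mono q_nonneg)
    fix s
    show "survival m (s # h) \<le> indicator_pending h" using Suc[of "s # h"] by (rule order_trans) auto
  qed
  also have "\<dots> = indicator_pending h" by (simp add: q_sum flip: sum_distrib_right)
  finally show ?case .
qed simp

text \<open>The run is completed if the next \<open>R - streak G h\<close> outcomes are all good.\<close>

lemma survival_after_streak:
  assumes "R - streak G h \<le> m"
  shows "survival m h \<le> 1 - p ^ (R - streak G h)"
  using assms
proof (induction m arbitrary: h)
  case 0
  then have "\<not> pending G R h" using streak_less[of h] by auto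
  then show ?case using 0 by simp
next
  case (Suc m)
  show ?case
  proof (cases "pending G R h")
    case False
    then have "survival (Suc m) h \<le> 0" using survival_le[of "Suc m" h] by simp
    also have "0 \<le> 1 - p ^ (R - streak G h)" using p_pos p_le_one by (simp add: power_le_one)
    finally show ?thesis .
  next
    case True
    then have less: "streak G h < R" by (rule streak_less)
    let ?r = "R - Suc (streak G h)"
    have r: "R - streak G h = Suc ?r" using less by simp
    obtain s0 where s0: "s0 \<in> S" "G (s0 # h)" using good_exists by blast
    have "survival m (s0 # h) \<le> 1 - p ^ ?r"
      using Suc.IH[of "s0 # h"] Suc.prems s0(2) r by simp
    moreover have "survival m (s # h) \<le> 1" for s
      using survival_le[of m "s # h"] by (rule order_trans) simp
    ultimately have "survival (Suc m) h \<le> p * (1 - p ^ ?r) + (1 - p) * 1"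
      unfolding average.simps using p_pos by (intro average_step_le[OF s0(1)]) auto
    then show ?thesis unfolding r by (simp add: algebra_simps)
  qed
qed

text \<open>Blocks of \<open>R\<close> outcomes: each one completes a run with probability at least \<open>p\<^sup>R\<close>, whatever happened
  before it.\<close>

lemma survival_tail: "survival n [] \<le> (1 - p ^ R) ^ (n div R)"
proof (induction n rule: less_induct)
  case (less n)
  show ?case
  proof (cases "n < R")
    case True
    then show ?thesis using survival_le[of n "[]"] by simp
  next
    case False
    have block: "survival R h \<le> (1 - p ^ R) * indicator_pending h" for h
    proof (cases "pending G R h")
      case True
      have "p ^ R \<le> p ^ (R - streak G h)" using p_pos p_le_one by (intro power_decreasing) auto
      then show ?thesis using survival_after_streak[of h R] True by simp
    next
      case False
      then show ?thesis using survival_le[of R h] by simp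
    qed
    have "survival n [] = average q S (survival R) (n - R) []"
      using average_add[of q S indicator_pending "n - R" R "[]"] False by simp
    also have "\<dots> \<le> average q S (\<lambda>h. (1 - p ^ R) * indicator_pending h) (n - R) []"
      by (intro average_mono block q_nonneg)
    also have "\<dots> = (1 - p ^ R) * survival (n - R) []" by (rule average_scale)
    also have "\<dots> \<le> (1 - p ^ R) * (1 - p ^ R) ^ ((n - R) div R)"
      using less[of "n - R"] False R_pos p_pos p_le_one by (intro mult_left_mono) (auto simp: power_le_one)
    also have "\<dots> = (1 - p ^ R) ^ (n div R)"
      using False R_pos by (simp add: le_div_geq)
    finally show ?thesis .
  qed
qed

text \<open>The expected time to the first run of length \<open>R\<close> after \<open>i\<close> successes in a row, if the success
  probability is exactly \<open>p\<close>: the recursion below conditions on the next outcome.\<close>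

definition remaining :: "nat \<Rightarrow> real"
  where "remaining i = (\<Sum>j=Suc i..R. 1 / p ^ j)"

lemma remaining_antimono: "i \<le> j \<Longrightarrow> remaining j \<le> remaining i"
  unfolding remaining_def using p_pos by (intro sum_mono2) auto

lemma remaining_recursion:
  assumes "i < R"
  shows "1 + (p * remaining (Suc i) + (1 - p) * remaining 0) = remaining i"
proof -
  have shift: "p * remaining j = (\<Sum>k=j..<R. 1 / p ^ k)" for j
  proof -
    have "p * remaining j = (\<Sum>k=Suc j..<Suc R. p * (1 / p ^ k))"
      unfolding remaining_def by (simp add: sum_distrib_left atLeastLessThanSuc_atLeastAtMost)
    also have "\<dots> = (\<Sum>k=j..<R. p * (1 / p ^ Suc k))" by (rule sum.shift_bounds_Suc_ivl)
    also have "\<dots> = (\<Sum>k=j..<R. 1 / p ^ k)" using p_pos by (intro sum.cong) auto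
    finally show ?thesis .
  qed
  have last: "remaining j = (\<Sum>k=Suc j..<R. 1 / p ^ k) + 1 / p ^ R" if "j < R" for j
    unfolding remaining_def
    using that sum.last_plus[of "Suc j" R "\<lambda>k. 1 / p ^ k"] by simp
  have "p * remaining (Suc i) = remaining i - 1 / p ^ R"
    using shift[of "Suc i"] last[OF assms] by simp
  moreover have "p * remaining 0 = 1 + remaining 0 - 1 / p ^ R"
    using shift[of 0] last[of 0] assms by (simp add: sum.atLeast_Suc_lessThan)
  ultimately show ?thesis by (simp add: algebra_simps)
qed

text \<open>\<open>remaining\<close> decreases with the streak, so a success probability larger than \<open>p\<close> only helps:
  \<open>remaining (streak G h)\<close> loses on average at least \<open>1\<close> per outcome while the run is pending.\<close>

lemma survival_sum_le:
  "(\<Sum>n<N. survival n h) \<le> indicator_pending h * remaining (streak G h)"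
proof (induction N arbitrary: h)
  case 0
  have "0 \<le> remaining i" for i unfolding remaining_def using p_pos by (intro sum_nonneg) auto
  then show ?case by simp
next
  case (Suc N)
  have "(\<Sum>n<Suc N. survival n h) = indicator_pending h + (\<Sum>n<N. survival (Suc n) h)"
    by (subst sum.lessThan_Suc_shift) simp
  also have "(\<Sum>n<N. survival (Suc n) h) = (\<Sum>s\<in>S. q s * (\<Sum>n<N. survival n (s # h)))"
    by (simp add: sum_distrib_left) (rule sum.swap)
  finally have split: "(\<Sum>n<Suc N. survival n h)
    = indicator_pending h + (\<Sum>s\<in>S. q s * (\<Sum>n<N. survival n (s # h)))" .
  show ?case
  proof (cases "pending G R h")
    case False
    have "(\<Sum>s\<in>S. q s * (\<Sum>n<N. survival n (s # h))) \<le> (\<Sum>s\<in>S. q s * 0)"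
    proof (intro sum_mono mult_left_mono q_nonneg)
      fix s
      show "(\<Sum>n<N. survival n (s # h)) \<le> 0" using Suc[of "s # h"] False by simp
    qed
    then show ?thesis using split False by simp
  next
    case True
    obtain s0 where s0: "s0 \<in> S" "G (s0 # h)" using good_exists by blast
    let ?i = "streak G h"
    have nonneg: "0 \<le> remaining i" for i
      unfolding remaining_def using p_pos by (intro sum_nonneg) auto
    have "(\<Sum>n<N. survival n (s # h)) \<le> remaining (streak G (s # h))" for s
      by (rule order_trans[OF Suc[of "s # h"]]) (use nonneg[of "streak G (s # h)"] in \<open>auto simp: of_bool_def\<close>)
    then have *: "(\<Sum>n<N. survival n (s # h)) \<le> remaining 0" "(\<Sum>n<N. survival n (s0 # h)) \<le> remaining (Suc ?i)" for s
      using s0(2) remaining_antimono[of 0 "streak G (s # h)"] by (force intro: order_trans)+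
    have "(\<Sum>s\<in>S. q s * (\<Sum>n<N. survival n (s # h))) \<le> p * remaining (Suc ?i) + (1 - p) * remaining 0"
      by (rule average_step_le[where f = "\<lambda>s. \<Sum>n<N. survival n (s # h)", OF s0(1) *(2)])
        (auto intro: *(1) remaining_antimono)
    then show ?thesis
      using split True remaining_recursion[OF streak_less[OF True]] by simp
  qed
qed

end

primrec history :: "(nat \<Rightarrow> 's) \<Rightarrow> nat \<Rightarrow> 's list"
  where
    "history z 0 = []"
  | "history z (Suc n) = z (Suc n) # history z n"

text \<open>Recovers the outcomes at the positions \<open>{1..length h}\<close>; the other values are arbitrary.\<close>

definition of_history :: "'s list \<Rightarrow> nat \<Rightarrow> 's"
  where "of_history h j = h ! (length h - j)"

lemma length_history: "length (history z n) = n"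
  by (induction n) simp_all

lemma of_history_Cons: "of_history (s # h) j = (if length h < j then s else of_history h j)"
  by (auto simp: of_history_def nth_Cons' Suc_diff_le)

lemma of_history_history: "j \<in> {1..n} \<Longrightarrow> of_history (history z n) j = z j"
proof (induction n)
  case (Suc n)
  then show ?case by (cases "j = Suc n") (auto simp: of_history_Cons length_history)
qed simp

lemma history_eq_iff:
  "length h = n \<Longrightarrow> history z n = h \<longleftrightarrow> (\<forall>j\<in>{1..n}. z j = of_history h j)"
proof (induction n arbitrary: h)
  case (Suc n)
  then obtain s g where h: "h = s # g" "length g = n" by (auto simp: length_Suc_conv)
  have "(\<forall>j\<in>{1..Suc n}. z j = of_history h j) \<longleftrightarrow> z (Suc n) = s \<and> (\<forall>j\<in>{1..n}. z j = of_history g j)"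
    using h by (auto simp: of_history_Cons atLeastAtMostSuc_conv)
  then show ?case using Suc.IH[OF h(2)] h by simp
qed simp

lemma prod_of_history:
  "(\<Prod>j\<in>{1..length h}. f (of_history h j)) = prod_list (map f h)"
proof (induction h)
  case (Cons s h)
  have "(\<Prod>j\<in>{1..Suc (length h)}. f (of_history (s # h) j))
    = f s * (\<Prod>j\<in>{1..length h}. f (of_history (s # h) j))"
    by (simp add: atLeastAtMostSuc_conv of_history_Cons)
  also have "(\<Prod>j\<in>{1..length h}. f (of_history (s # h) j)) = (\<Prod>j\<in>{1..length h}. f (of_history h j))"
    by (rule prod.cong) (auto simp: of_history_Cons)
  finally show ?case using Cons by simp
qed simp

lemma streak_history:
  assumes "r \<le> streak G (history z n)"
  shows "r \<le> n \<and> (\<forall>j\<in>{n - r<..n}. G (history z j))"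
  using assms
proof (induction n arbitrary: r)
  case (Suc n)
  show ?case
  proof (cases r)
    case (Suc r')
    then have "G (history z (Suc n))" "r' \<le> streak G (history z n)"
      using Suc.prems by (auto split: if_splits)
    with Suc.IH[of r'] Suc show ?thesis by (auto simp: le_Suc_eq)
  qed simp
qed simp

lemma not_pending_history:
  assumes "\<not> pending G R (history z n)"
  shows "\<exists>a. a + R \<le> n \<and> (\<forall>j\<in>{a<..a + R}. G (history z j))"
  using assms
proof (induction n)
  case (Suc n)
  show ?case
  proof (cases "pending G R (history z n)")
    case True
    then have "R \<le> streak G (history z (Suc n))" using Suc.prems by auto
    from streak_history[OF this] show ?thesis
      by (intro exI[of _ "Suc n - R"]) auto
  next
    case False
    with Suc.IH show ?thesis by (meson le_SucI)
  qed
qed simp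

text \<open>There are finitely many histories of length \<open>n\<close>, and by independence the probability of each is the
  product of the probabilities of its outcomes.\<close>

lemma (in prob_space) prob_history:
  fixes Z :: "nat \<Rightarrow> 'a \<Rightarrow> 's" and N :: "'s measure"
  assumes indep: "indep_vars (\<lambda>_. N) Z {1..}" and S: "finite S" "space N = S"
    and single: "\<And>s. s \<in> S \<Longrightarrow> {s} \<in> sets N"
    and law: "\<And>k s. 1 \<le> k \<Longrightarrow> s \<in> S \<Longrightarrow> prob {w \<in> space M. Z k w = s} = q s"
  shows "{w \<in> space M. Pr (history (\<lambda>k. Z k w) n)} \<in> events"
    and "prob {w \<in> space M. Pr (history (\<lambda>k. Z k w) n)} = average q S (\<lambda>h. of_bool (Pr h)) n []"
proof -
  let ?H = "\<lambda>h. {w \<in> space M. history (\<lambda>k. Z k w) n = h}"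
  have meas: "Z k \<in> M \<rightarrow>\<^sub>M N" if "1 \<le> k" for k using indep that by (auto simp: indep_vars_def)
  have in_S: "Z k w \<in> S" if "1 \<le> k" "w \<in> space M" for k w
    using measurable_space[OF meas[OF that(1)] that(2)] S(2) by simp
  have hist_in: "history (\<lambda>k. Z k w) n \<in> histories S n" if "w \<in> space M" for w
  proof -
    have "set (history (\<lambda>k. Z k w) m) \<subseteq> S" for m by (induction m) (auto intro: in_S that)
    then show ?thesis by (simp add: histories_def length_history)
  qed
  have fin: "finite (histories S n)"
    unfolding histories_def by (rule finite_lists_length_eq[OF S(1)])
  have H_eq: "?H h = {w \<in> space M. \<forall>j\<in>{1..n}. Z j w = of_history h j}" if "h \<in> histories S n" for h
    using that by (auto simp: histories_def history_eq_iff)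
  have single_event: "{w \<in> space M. Z k w = s} \<in> events" if "1 \<le> k" "s \<in> S" for k s
  proof -
    have "{w \<in> space M. Z k w = s} = Z k -` {s} \<inter> space M" by auto
    then show ?thesis using measurable_sets[OF meas[OF that(1)] single[OF that(2)]] by simp
  qed
  have of_in: "of_history h j \<in> S" if "h \<in> histories S n" "j \<in> {1..n}" for h j
  proof -
    have "length h - j < length h" "set h \<subseteq> S" using that by (auto simp: histories_def)
    then show ?thesis using nth_mem unfolding of_history_def by blast
  qed
  have H_event: "?H h \<in> events" if "h \<in> histories S n" for h
    unfolding H_eq[OF that]
    by (rule sets.sets_Collect_finite_All) (auto intro!: single_event of_in[OF that])
  have H_prob: "prob (?H h) = prod_list (map q h)" if h: "h \<in> histories S n" for h
  proof (cases "n = 0")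
    case True
    then show ?thesis using h by (simp add: histories_def prob_space)
  next
    case False
    have "?H h = (\<Inter>j\<in>{1..n}. Z j -` {of_history h j} \<inter> space M)"
      unfolding H_eq[OF h] using False by auto
    then have "prob (?H h) = (\<Prod>j\<in>{1..n}. prob (Z j -` {of_history h j} \<inter> space M))"
      using indep_varsD[OF indep, of "{1..n}" "\<lambda>j. {of_history h j}"] False single of_in[OF h] by auto
    also have "\<dots> = (\<Prod>j\<in>{1..n}. q (of_history h j))"
    proof (rule prod.cong[OF refl])
      fix j assume j: "j \<in> {1..n}"
      have "Z j -` {of_history h j} \<inter> space M = {w \<in> space M. Z j w = of_history h j}" by auto
      then show "prob (Z j -` {of_history h j} \<inter> space M) = q (of_history h j)"
        using law[OF _ of_in[OF h j], of j] j by simp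
    qed
    also have "\<dots> = prod_list (map q h)"
      using prod_of_history[of q h] h by (simp add: histories_def)
    finally show ?thesis .
  qed
  have union: "{w \<in> space M. Pr (history (\<lambda>k. Z k w) n)} = (\<Union>h\<in>{h \<in> histories S n. Pr h}. ?H h)"
    using hist_in by auto
  show "{w \<in> space M. Pr (history (\<lambda>k. Z k w) n)} \<in> events"
    unfolding union using fin H_event by (intro sets.finite_UN) auto
  have "prob {w \<in> space M. Pr (history (\<lambda>k. Z k w) n)} = (\<Sum>h\<in>{h \<in> histories S n. Pr h}. prob (?H h))"
    unfolding union using fin H_event
    by (intro finite_measure_finite_Union) (auto simp: disjoint_family_on_def)
  also have "\<dots> = (\<Sum>h\<in>{h \<in> histories S n. Pr h}. prod_list (map q h))"
    by (intro sum.cong H_prob) auto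
  also have "\<dots> = (\<Sum>h\<in>histories S n. prod_list (map q h) * of_bool (Pr h))"
    using fin by (simp add: sum.inter_filter of_bool_def if_distrib cong: if_cong)
  also have "\<dots> = average q S (\<lambda>h. of_bool (Pr h)) n []"
    by (rule average_eq_sum[OF S(1), symmetric])
  finally show "prob {w \<in> space M. Pr (history (\<lambda>k. Z k w) n)} = average q S (\<lambda>h. of_bool (Pr h)) n []" .
qed

context bsddp
begin

section \<open>Dependence on the history\<close>

text \<open>The run of the algorithm up to iteration \<open>k\<close> is a function of the first \<open>k\<close> scenarios. This makes
  the events measurable and lets worst scenarios be chosen after each history.\<close>

lemma model_cong:
  assumes "\<And>j. j \<in> {1..k} \<Longrightarrow> z j = z' j"
  shows "model z k = model z' k"
  using assms
proof (induction k rule: less_induct)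
  case (less k)
  consider "k \<le> 1" | "1 < k" "last_visit z k = k" | "last_visit z k < k"
    using last_visit_le[of z k] by linarith
  then show ?case
  proof cases
    case 1
    then show ?thesis by (simp add: model_init)
  next
    case 2
    have "last_visit z k = last_visit z' k" using 2 less.prems by (intro last_visit_cong) auto
    moreover have "model z (k - 1) = model z' (k - 1)" using 2 less.prems by (intro less.IH) auto
    ultimately show ?thesis using 2 by (simp add: model_new)
  next
    case 3
    let ?l = "last_visit z k"
    have l: "1 \<le> ?l" by (rule last_visit_less(1)[OF 3])
    have same: "last_visit z k = last_visit z' k" using 3 less.prems by (intro last_visit_cong) auto
    have "model z (k - 1) = model z' (k - 1)" "model z ?l = model z' ?l" "z ?l = z' ?l"
      using 3 l less.prems by (auto intro!: less.IH)
    then show ?thesis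
      using model_revisit[OF 3] model_revisit[of z' k] 3 same by (simp add: decision_def)
  qed
qed

lemma decision_cong:
  assumes "1 \<le> k" "\<And>j. j \<in> {1..k} \<Longrightarrow> z j = z' j"
  shows "decision z k = decision z' k"
  using model_cong[of k z z'] assms by (simp add: decision_def)

lemma first_stage_solution_cong:
  assumes "1 \<le> k" "\<And>j. j \<in> {1..k} \<Longrightarrow> z j = z' j"
  shows "first_stage_solution z k = first_stage_solution z' k"
  using assms
proof (induction k rule: less_induct)
  case (less k)
  have same: "last_visit z k = last_visit z' k" "decision z k = decision z' k"
    using less.prems by (auto intro!: last_visit_cong decision_cong)
  show ?case
  proof (cases "last_visit z k < k")
    case True
    have "first_stage_solution z (last_visit z k) = first_stage_solution z' (last_visit z k)"
      using True last_visit_less(1)[OF True] less.prems by (intro less.IH) auto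
    then show ?thesis
      using first_stage_solution_revisit[OF True] first_stage_solution_revisit[of z' k] same True by simp
  next
    case False
    then have "last_visit z k = k" using last_visit_le[of z k] by simp
    then show ?thesis using same first_stage_solution_new by metis
  qed
qed

lemma gap_cong:
  assumes "1 \<le> k" "\<And>j. j \<in> {1..k} \<Longrightarrow> z j = z' j"
  shows "gap z k = gap z' k"
  unfolding gap_def lower_value_def
  using first_stage_solution_cong[of k z z', OF assms] model_cong[of k z z', OF assms(2)] by simp

text \<open>Predicates of histories, as required by \<open>good_outcomes\<close>; the run of the algorithm is
  reconstructed from the history.\<close>

definition worst_choice :: "(nat \<Rightarrow> 'o) list \<Rightarrow> bool"
  where "worst_choice h = (case h of [] \<Rightarrow> False
    | s # past \<Rightarrow> worst_scenario (model (of_history past) (length past)) s)"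

definition large_gaps :: "real \<Rightarrow> (nat \<Rightarrow> 'o) list \<Rightarrow> bool"
  where "large_gaps \<epsilon> h \<longleftrightarrow> (\<forall>k\<in>{1..length h}. \<epsilon> < gap (of_history h) k)"

lemma worst_choice_history:
  assumes "1 \<le> k"
  shows "worst_choice (history z k) \<longleftrightarrow> worst_scenario (model z (k - 1)) (z k)"
proof -
  obtain n where k: "k = Suc n" using assms by (cases k) auto
  have "model (of_history (history z n)) n = model z n"
    by (intro model_cong of_history_history)
  then show ?thesis unfolding k by (simp add: worst_choice_def length_history)
qed

lemma large_gaps_history:
  "large_gaps \<epsilon> (history z n) \<longleftrightarrow> (\<forall>k\<in>{1..n}. \<epsilon> < gap z k)"
proof -
  have "gap (of_history (history z n)) k = gap z k" if "k \<in> {1..n}" for k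
    using that by (intro gap_cong of_history_history) auto
  then show ?thesis by (auto simp: large_gaps_def length_history)
qed

section \<open>The law of the sampled scenarios\<close>

abbreviation scenario_space :: "(nat \<Rightarrow> 'o) measure"
  where "scenario_space \<equiv> \<Pi>\<^sub>M t\<in>{2..T}. count_space (\<Xi> t)"

definition scenario_prob :: "(nat \<Rightarrow> 'o) \<Rightarrow> real"
  where "scenario_prob s = (\<Prod>t=2..T. xi_prob t (s t))"

lemma space_scenario_space: "space scenario_space = scenarios"
  by (simp add: space_PiM scenarios_def)

lemma scenario_measurable_singleton:
  assumes "s \<in> scenarios"
  shows "{s} \<in> sets scenario_space"
proof -
  have "{s} = PiE {2..T} (\<lambda>t. {s t})"
    using assms by (intro PiE_singleton[symmetric]) (auto simp: scenarios_def PiE_iff)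
  also have "\<dots> \<in> sets scenario_space"
    by (rule sets_PiM_I_finite) (use assms in \<open>auto simp: scenarios_def PiE_iff\<close>)
  finally show ?thesis .
qed

lemma sampled_scenario_measurable: "1 \<le> k \<Longrightarrow> \<zeta> k \<in> \<Omega> \<rightarrow>\<^sub>M scenario_space"
  using samples_indep by (auto simp: indep_vars_def)

lemma sampled_runs: "w \<in> space \<Omega> \<Longrightarrow> sampled (\<lambda>k. \<zeta> k w)"
  unfolding sampled_def space_scenario_space[symmetric]
  using measurable_space[OF sampled_scenario_measurable] by blast

lemma sampled_scenario_law:
  assumes "1 \<le> k" "s \<in> scenarios"
  shows "prob {w \<in> space \<Omega>. \<zeta> k w = s} = scenario_prob s"
proof -
  let ?xi = "\<lambda>w. \<lambda>t\<in>{2..T}. \<xi> t w"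
  note s = scenario_measurable_singleton[OF assms(2)]
  have xi: "?xi \<in> \<Omega> \<rightarrow>\<^sub>M scenario_space"
    by (rule measurable_restrict) (rule xi_measurable)
  have "{w \<in> space \<Omega>. \<zeta> k w = s} = \<zeta> k -` {s} \<inter> space \<Omega>" by auto
  then have "prob {w \<in> space \<Omega>. \<zeta> k w = s} = measure (distr \<Omega> scenario_space (\<zeta> k)) {s}"
    by (simp add: measure_distr[OF sampled_scenario_measurable[OF assms(1)] s])
  also have "\<dots> = measure (distr \<Omega> scenario_space ?xi) {s}" by (simp add: samples_distr[OF assms(1)])
  also have "\<dots> = prob (?xi -` {s} \<inter> space \<Omega>)" by (rule measure_distr[OF xi s])
  also have "?xi -` {s} \<inter> space \<Omega> = (\<Inter>t\<in>{2..T}. \<xi> t -` {s t} \<inter> space \<Omega>)"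
  proof -
    have "?xi w = s \<longleftrightarrow> (\<forall>t\<in>{2..T}. \<xi> t w = s t)" for w
    proof
      show "\<forall>t\<in>{2..T}. \<xi> t w = s t" if "?xi w = s"
        unfolding that[symmetric] by simp
      show "?xi w = s" if "\<forall>t\<in>{2..T}. \<xi> t w = s t"
        by (rule extensionalityI[of _ "{2..T}"])
          (use that assms(2) in \<open>auto simp: scenarios_def PiE_iff\<close>)
    qed
    then show ?thesis using T_ge_2 by auto
  qed
  also have "prob \<dots> = (\<Prod>t=2..T. prob (\<xi> t -` {s t} \<inter> space \<Omega>))"
    by (rule indep_varsD_finite[OF xi_indep]) (use assms(2) T_ge_2 in \<open>auto simp: scenarios_def PiE_iff\<close>)
  also have "\<dots> = scenario_prob s"
  proof -
    have "\<xi> t -` {s t} \<inter> space \<Omega> = {w \<in> space \<Omega>. \<xi> t w = s t}" for t by auto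
    then show ?thesis by (simp add: scenario_prob_def)
  qed
  finally show ?thesis .
qed

lemma scenario_prob_sum: "sum scenario_prob scenarios = 1"
proof -
  have "(\<Sum>\<omega>\<in>\<Xi> t. xi_prob t \<omega>) = 1" if "t \<in> {2..T}" for t
  proof -
    have "t - 1 \<in> {1..T-1}" "Suc (t - 1) = t" using that by auto
    then show ?thesis using xi_prob_sum[of "t - 1"] by simp
  qed
  then have "(\<Prod>t=2..T. \<Sum>\<omega>\<in>\<Xi> t. xi_prob t \<omega>) = 1" by simp
  then show ?thesis
    unfolding scenario_prob_def scenarios_def
    by (subst prod_sum_PiE[symmetric]) (auto intro: support_finite)
qed

lemma min_probability:
  defines "p \<equiv> \<Prod>t=2..T. Min (xi_prob t ` \<Xi> t)"
  shows "0 < p" and "\<And>s. s \<in> scenarios \<Longrightarrow> p \<le> scenario_prob s"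
proof -
  have ne: "\<Xi> t \<noteq> {}" if "t \<in> {2..T}" for t
  proof -
    have "t - 1 \<in> {1..T-1}" "Suc (t - 1) = t" using that by auto
    then show ?thesis using support_nonempty[of "t - 1"] by simp
  qed
  have pos: "0 < Min (xi_prob t ` \<Xi> t)" if "t \<in> {2..T}" for t
    using ne[OF that] support_finite[OF that] support_pos[OF that] by simp
  then show "0 < p" unfolding p_def by (intro prod_pos) auto
  fix s assume "s \<in> scenarios"
  then have "Min (xi_prob t ` \<Xi> t) \<le> xi_prob t (s t)" if "t \<in> {2..T}" for t
    using support_finite[OF that] that by (intro Min_le) (auto simp: scenarios_def PiE_iff)
  then show "p \<le> scenario_prob s"
    unfolding p_def scenario_prob_def using pos by (intro prod_mono) (auto simp: less_imp_le)
qed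

section \<open>The hitting time\<close>

lemma less_first_hit_iff:
  "enat n < first_hit \<epsilon> w \<longleftrightarrow> (\<forall>k\<in>{1..n}. \<epsilon> < gap (\<lambda>j. \<zeta> j w) k)"
proof -
  have "enat n < first_hit \<epsilon> w \<longleftrightarrow> (\<forall>k. 1 \<le> k \<and> gap (\<lambda>j. \<zeta> j w) k \<le> \<epsilon> \<longrightarrow> n < k)"
    unfolding Suc_ile_eq[symmetric] first_hit_def by (auto simp: le_Inf_iff Suc_le_eq)
  then show ?thesis by (auto simp: not_le[symmetric])
qed

lemma first_hit_event:
  "{w \<in> space \<Omega>. enat n < first_hit \<epsilon> w} = {w \<in> space \<Omega>. large_gaps \<epsilon> (history (\<lambda>k. \<zeta> k w) n)}"
  by (simp add: less_first_hit_iff large_gaps_history)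

lemmas history_prob = prob_history[OF samples_indep finite_scenarios space_scenario_space
    scenario_measurable_singleton sampled_scenario_law]

lemma first_hit_events: "{w \<in> space \<Omega>. enat n < first_hit \<epsilon> w} \<in> events"
  unfolding first_hit_event by (rule history_prob(1))

lemma first_hit_measurable: "first_hit \<epsilon> \<in> \<Omega> \<rightarrow>\<^sub>M count_space UNIV"
proof (rule measurable_count_space_eq_countable[THEN iffD2])
  note [measurable] = first_hit_events[of _ \<epsilon>]
  show "countable (UNIV :: enat set)" by simp
  have "first_hit \<epsilon> -` {x} \<inter> space \<Omega> \<in> events" for x
  proof (cases x)
    case infinity
    have "y = \<infinity> \<longleftrightarrow> (\<forall>n. enat n < y)" for y :: enat by (cases y) auto
    from this[of "first_hit \<epsilon> w" for w]
    have "first_hit \<epsilon> -` {x} \<inter> space \<Omega> = (\<Inter>n. {w \<in> space \<Omega>. enat n < first_hit \<epsilon> w})"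
      unfolding infinity by blast
    then show ?thesis using first_hit_events by auto
  next
    case (enat n)
    have "y = enat n \<longleftrightarrow> \<not> enat n < y \<and> (\<forall>m\<in>{..<n}. enat m < y)" for y
      by (cases y) (auto simp: not_less intro: le_antisym leI)
    from this[of "first_hit \<epsilon> w" for w] have "first_hit \<epsilon> -` {x} \<inter> space \<Omega> = {w \<in> space \<Omega>. \<not> enat n < first_hit \<epsilon> w
        \<and> (\<forall>m\<in>{..<n}. enat m < first_hit \<epsilon> w)}"
      unfolding enat by blast
    also have "\<dots> \<in> events"
      by (intro sets.sets_Collect_conj sets.sets_Collect_neg sets.sets_Collect_finite_All
          first_hit_events) auto
    finally show ?thesis .
  qed
  then show "first_hit \<epsilon> \<in> space \<Omega> \<rightarrow> UNIV \<and> (\<forall>x\<in>UNIV. first_hit \<epsilon> -` {x} \<inter> space \<Omega> \<in> events)"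
    by simp
qed

lemma good_outcomes_scenarios:
  "good_outcomes scenarios scenario_prob (\<Prod>t=2..T. Min (xi_prob t ` \<Xi> t)) worst_choice (Suc n)"
proof
  show "\<exists>s\<in>scenarios. worst_choice (s # h)" for h
    using worst_scenario_exists by (simp add: worst_choice_def)
qed (auto intro: finite_scenarios scenario_prob_sum min_probability)

text \<open>If the tolerance has not been reached after \<open>n\<close> iterations, no run of \<open>R\<close> worst scenarios has been
  completed.\<close>

lemma first_hit_bounds:
  fixes \<epsilon> \<epsilon>bar :: real and P :: nat
  assumes \<epsilon>bar: "0 < \<epsilon>bar"
    and \<epsilon>_def: "\<epsilon> = \<epsilon>bar / (40 * (\<Sum>t=1..T-1. (M t)\<^sup>2 / \<mu> t))" and \<epsilon>_half: "\<epsilon> < 1 / 2"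
    and tau: "\<tau>\<^sub>0 = 1 / (1 + \<epsilon> ^ (2 ^ (T - 1) - 1))"
    and width_large: "1 < 4 / \<epsilon>bar * total_width"
    and P: "(1 + 1 / \<epsilon> ^ (2 ^ (T - 1) - 1)) * ln (4 / \<epsilon>bar * total_width) \<le> real P"
  defines "p \<equiv> \<Prod>t=2..T. Min (xi_prob t ` \<Xi> t)"
    and "R \<equiv> P * card scenarios + 1"
  shows "(\<integral>\<^sup>+w. ennreal_of_enat (first_hit \<epsilon>bar w) \<partial>\<Omega>) \<le> ennreal (\<Sum>i=1..R. 1 / p ^ i)"
    and "prob {w \<in> space \<Omega>. enat n < first_hit \<epsilon>bar w} \<le> (1 - p ^ R) ^ (n div R)"
proof -
  interpret good_outcomes scenarios scenario_prob p worst_choice R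
    using good_outcomes_scenarios[of "P * card scenarios"] by (simp add: p_def R_def)
  have tail: "prob {w \<in> space \<Omega>. enat n < first_hit \<epsilon>bar w} \<le> survival n []" for n
  proof -
    have "pending worst_choice R (history (\<lambda>k. \<zeta> k w) n)"
      if w: "w \<in> space \<Omega>" and large: "enat n < first_hit \<epsilon>bar w" for w
    proof (rule ccontr)
      let ?z = "\<lambda>k. \<zeta> k w"
      assume "\<not> ?thesis"
      then obtain a where a: "a + R \<le> n" "\<forall>j\<in>{a<..a + R}. worst_choice (history ?z j)"
        using not_pending_history by blast
      then have "worst_scenario (model ?z (k - 1)) (?z k)" if "k \<in> {a<..a + (P * card scenarios + 1)}" for k
        using that worst_choice_history[of k ?z] by (auto simp: R_def)
      from gap_small_in_run[OF sampled_runs[OF w] \<epsilon>bar \<epsilon>_def \<epsilon>_half tau width_large P this]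
      obtain k where k: "k \<in> {a<..a + R}" "gap ?z k \<le> \<epsilon>bar" unfolding R_def by blast
      then have "k \<in> {1..n}" using a(1) by auto
      then show False using large k(2) unfolding less_first_hit_iff by force
    qed
    then have "prob {w \<in> space \<Omega>. enat n < first_hit \<epsilon>bar w}
      \<le> prob {w \<in> space \<Omega>. pending worst_choice R (history (\<lambda>k. \<zeta> k w) n)}"
      by (intro finite_measure_mono history_prob(1)) auto
    also have "\<dots> = survival n []" by (rule history_prob(2))
    finally show ?thesis .
  qed
  show "prob {w \<in> space \<Omega>. enat n < first_hit \<epsilon>bar w} \<le> (1 - p ^ R) ^ (n div R)"
    using tail survival_tail by (rule order_trans)
  have "(\<integral>\<^sup>+w. ennreal_of_enat (first_hit \<epsilon>bar w) \<partial>\<Omega>)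
    = (\<Sum>n. emeasure \<Omega> {w \<in> space \<Omega>. enat n < first_hit \<epsilon>bar w})"
    by (rule nn_integral_enat_function[OF first_hit_measurable])
  also have "\<dots> \<le> ennreal (\<Sum>i=1..R. 1 / p ^ i)"
  proof (rule suminf_le_const[OF summableI])
    fix N
    have "(\<Sum>n<N. emeasure \<Omega> {w \<in> space \<Omega>. enat n < first_hit \<epsilon>bar w})
      = ennreal (\<Sum>n<N. prob {w \<in> space \<Omega>. enat n < first_hit \<epsilon>bar w})"
      by (simp add: emeasure_eq_measure)
    also have "\<dots> \<le> ennreal (\<Sum>n<N. survival n [])"
      by (intro ennreal_leI sum_mono tail)
    also have "\<dots> \<le> ennreal (\<Sum>i=1..R. 1 / p ^ i)"
      using survival_sum_le[where h = "[]" and N = N] by (intro ennreal_leI) (simp add: remaining_def)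
    finally show "(\<Sum>n<N. emeasure \<Omega> {w \<in> space \<Omega>. enat n < first_hit \<epsilon>bar w})
      \<le> ennreal (\<Sum>i=1..R. 1 / p ^ i)" .
  qed
  finally show "(\<integral>\<^sup>+w. ennreal_of_enat (first_hit \<epsilon>bar w) \<partial>\<Omega>) \<le> ennreal (\<Sum>i=1..R. 1 / p ^ i)" .
qed

end

theorem theorem4p13:
  fixes \<Omega> :: "'w measure"
    and T :: nat
    and E X :: "nat \<Rightarrow> 'a::euclidean_space set"
    and F1 :: "'a \<Rightarrow> real"
    and F :: "nat \<Rightarrow> 'a \<Rightarrow> 'a \<Rightarrow> 'o \<Rightarrow> real"
    and M \<mu> :: "nat \<Rightarrow> real"
    and \<Xi> :: "nat \<Rightarrow> 'o set"
    and \<xi> :: "nat \<Rightarrow> 'w \<Rightarrow> 'o"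
    and \<tau> \<epsilon> \<epsilon>bar p :: real
    and \<Gamma>\<^sub>1 :: "nat \<Rightarrow> 'a \<Rightarrow> real"
    and oracl :: "nat \<Rightarrow> nat \<Rightarrow> 'o \<Rightarrow> ('a \<Rightarrow> real) \<Rightarrow> 'a \<Rightarrow> 'a"
    and \<zeta> :: "nat \<Rightarrow> 'w \<Rightarrow> nat \<Rightarrow> 'o"
    and K :: "'w \<Rightarrow> enat"
    and P R :: nat
  assumes run: "bsddp \<Omega> T E X F1 F M \<mu> \<Xi> \<xi> \<tau> \<Gamma>\<^sub>1 oracl \<zeta>"
    and epsbar_pos: "0 < \<epsilon>bar"
    and eps_def: "\<epsilon> = \<epsilon>bar / (40 * (\<Sum>t=1..T-1. (M t)\<^sup>2 / \<mu> t))"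
    and eps_less: "\<epsilon> < 1 / 2"
    and log_pos: "1 < 4 / \<epsilon>bar * (\<Sum>t=1..T-1. M t * diameter (X t))"
    and tau_def: "\<tau> = 1 / (1 + \<epsilon> ^ (2 ^ (T - 1) - 1))"
    and K_def: "K = bsddp.first_hit \<Omega> T X F1 F \<xi> \<tau> \<Gamma>\<^sub>1 oracl \<zeta> \<epsilon>bar"
    and P_def: "P = nat \<lceil>(1 + (40 / \<epsilon>bar * (\<Sum>t=1..T-1. (M t)\<^sup>2 / \<mu> t)) ^ (2 ^ (T - 1) - 1))
                       * ln (4 / \<epsilon>bar * (\<Sum>t=1..T-1. M t * diameter (X t)))\<rceil>"
    and p_def: "p = (\<Prod>t=2..T. Min ((\<lambda>\<omega>. measure \<Omega> {w \<in> space \<Omega>. \<xi> t w = \<omega>}) ` \<Xi> t))"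
    and R_def: "R = P * (\<Prod>t=2..T. card (\<Xi> t)) + 1"
  shows "(\<integral>\<^sup>+w. ennreal_of_enat (K w) \<partial>\<Omega>) \<le> ennreal (\<Sum>i=1..R. 1 / p ^ i)
    \<and> (\<forall>n\<ge>1. measure \<Omega> {w \<in> space \<Omega>. enat n < K w} \<le> (1 - p ^ R) ^ (n div R))"
proof -
  interpret bsddp \<Omega> T E X F1 F M \<mu> \<Xi> \<xi> \<tau> \<Gamma>\<^sub>1 oracl \<zeta> by (rule run)
  have inverse: "40 / \<epsilon>bar * (\<Sum>t=1..T-1. (M t)\<^sup>2 / \<mu> t) = 1 / \<epsilon>"
    by (simp add: eps_def)
  have P: "(1 + 1 / \<epsilon> ^ (2 ^ (T - 1) - 1)) * ln (4 / \<epsilon>bar * total_width) \<le> real P"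
    unfolding P_def inverse width_def power_one_over by (rule real_nat_ceiling_ge)
  note bounds = first_hit_bounds[OF epsbar_pos eps_def eps_less tau_def log_pos[folded width_def] P,
      folded p_def, unfolded card_scenarios, folded R_def K_def]
  show ?thesis using bounds by blast
qed

end
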